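(* Let $\Phi(z,1,r)=\sum_{k\ge0}\frac{z^k}{k+r}$ for $|z|<1$. For all $\nu\in(0,1)$ and $r>0$ such that $\big(2\nu^2+r(1-\nu^2)\big)\Phi(\nu^2,1,r)\le2$, we have \[ \mathrm{gap}\,L=\frac{\mu^2}{2}\big(2\nu^2+r(1-\nu^2)\big). \] In particular this identity holds whenever $r\ge2\nu^2/(1-\nu^2)$.
   Context: Let $\mathsf h=\ell^2(\mathbb N)$ with canonical orthonormal basis $(e_n)_{n\ge0}$, $Ne_n=ne_n$. Fix $r>0$, $\omega_n=n(n+r-1)$. On $\mathrm{Dom}(N)$ define $Be_n=\omega_n^{1/2}e_{n-1}$ ($n\ge1$), $Be_0=0$, $B^+e_n=\omega_{n+1}^{1/2}e_{n+1}$. Fix real $0<\lambda<\mu$ and $\zeta^\pm\in\mathbb R$, and put $\nu=\lambda/\mu$. Let $G$ on $\mathrm{Dom}(N^2)$ be $Ge_n=-\big((\tfrac{\lambda^2}{2}+i\zeta^+)\omega_{n+1}+(\tfrac{\mu^2}{2}+i\zeta^-)\omega_n\big)e_n$, $P_t=e^{tG}$, $L_1=\mu B$, $L_2=\lambda B^+$, and let $\mathcal T$ be the minimal quantum dynamical semigroup associated with $G,L_1,L_2$ (the minimal solution of $\langle v,\mathcal T_t(x)u\rangle=\langle P_tv,xP_tu\rangle+\sum_{\ell=1}^2\int_0^t\langle L_\ell P_{t-s}v,\mathcal T_s(x)L_\ell P_{t-s}u\rangle ds$), a quantum Markov semigroup with generator formally $\mathcal L(x)=-\frac{\lambda^2}{2}(BB^+x-2BxB^++xBB^+)-\frac{\mu^2}{2}(B^+Bx-2B^+xB+xB^+B)+i[\zeta^+BB^++\zeta^-B^+B,x]$.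 Let $\rho=(1-\nu^2)\sum_n\nu^{2n}|e_n\rangle\langle e_n|$. Let $L_2(\mathsf h)$ be the Hilbert–Schmidt operators with $\langle x,y\rangle=\mathrm{tr}(x^*y)$, $\iota(x)=\rho^{1/4}x\rho^{1/4}$, and let $T=(T_t)$ be the strongly continuous contraction semigroup on $L_2(\mathsf h)$ determined by $T_t(\iota(x))=\iota(\mathcal T_t(x))$, with generator $L$. With the Dirichlet form $\mathcal E(\xi)=-\mathrm{Re}\langle\xi,L(\xi)\rangle$, the spectral gap is $\mathrm{gap}\,L=\inf\{\mathcal E(\xi):\|\xi\|=1,\ \xi\in D(L)\cap(\mathrm{Ker}\,L)^\perp\}$. *)

theory Defs
  imports "HOL-Analysis.Analysis"
begin

text \<open>Vectors of h = l2(N) are represented by their coordinates w.r.t. the canonical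
basis (e_n); (bounded or Hilbert-Schmidt) operators by their matrices
X i j = <e_i, X e_j>.\<close>

type_synonym vec = "nat \<Rightarrow> complex"
type_synonym mat = "nat \<Rightarrow> nat \<Rightarrow> complex"

definition l2 :: "vec \<Rightarrow> bool" where
  "l2 u \<longleftrightarrow> summable (\<lambda>n. (cmod (u n))^2)"

definition ip :: "vec \<Rightarrow> vec \<Rightarrow> complex" where
  "ip v w = (\<Sum>n. cnj (v n) * w n)"

definition vnorm :: "vec \<Rightarrow> real" where
  "vnorm u = sqrt (\<Sum>n. (cmod (u n))^2)"

definition mat_app :: "mat \<Rightarrow> vec \<Rightarrow> vec" where
  "mat_app X u = (\<lambda>i. \<Sum>j. X i j * u j)"

definition bounded_mat :: "mat \<Rightarrow> bool" where
  "bounded_mat X \<longleftrightarrow> (\<exists>C. \<forall>u. l2 u \<longrightarrow>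
      (\<forall>i. summable (\<lambda>j. X i j * u j)) \<and> l2 (mat_app X u) \<and>
      vnorm (mat_app X u) \<le> C * vnorm u)"

definition positive_mat :: "mat \<Rightarrow> bool" where
  "positive_mat X \<longleftrightarrow> (\<forall>u. l2 u \<longrightarrow>
      Im (ip u (mat_app X u)) = 0 \<and> 0 \<le> Re (ip u (mat_app X u)))"

definition omega :: "real \<Rightarrow> nat \<Rightarrow> real" where
  "omega r n = real n * (real n + r - 1)"

definition gdiag :: "real \<Rightarrow> real \<Rightarrow> real \<Rightarrow> real \<Rightarrow> real \<Rightarrow> nat \<Rightarrow> complex" where
  "gdiag r lam mu zp zm n =
     - ((complex_of_real (lam^2/2) + \<i> * complex_of_real zp) * complex_of_real (omega r (Suc n))
      + (complex_of_real (mu^2/2) + \<i> * complex_of_real zm) * complex_of_real (omega r n))"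

definition domG :: "vec \<Rightarrow> bool" where
  "domG u \<longleftrightarrow> l2 u \<and> l2 (\<lambda>n. of_nat n ^ 2 * u n)"

definition Psg :: "real \<Rightarrow> real \<Rightarrow> real \<Rightarrow> real \<Rightarrow> real \<Rightarrow> real \<Rightarrow> vec \<Rightarrow> vec" where
  "Psg r lam mu zp zm t u = (\<lambda>n. exp (complex_of_real t * gdiag r lam mu zp zm n) * u n)"

text \<open>B e_n = sqrt(omega_n) e_{n-1}, B^+ e_n = sqrt(omega_{n+1}) e_{n+1}.\<close>
definition Bop :: "real \<Rightarrow> vec \<Rightarrow> vec" where
  "Bop r u = (\<lambda>n. complex_of_real (sqrt (omega r (Suc n))) * u (Suc n))"

definition Bplus :: "real \<Rightarrow> vec \<Rightarrow> vec" where
  "Bplus r u = (\<lambda>n. if n = 0 then 0 else complex_of_real (sqrt (omega r n)) * u (n - 1))"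

definition L1op :: "real \<Rightarrow> real \<Rightarrow> vec \<Rightarrow> vec" where
  "L1op r mu u = (\<lambda>n. complex_of_real mu * Bop r u n)"

definition L2op :: "real \<Rightarrow> real \<Rightarrow> vec \<Rightarrow> vec" where
  "L2op r lam u = (\<lambda>n. complex_of_real lam * Bplus r u n)"

definition qds_solution ::
  "real \<Rightarrow> real \<Rightarrow> real \<Rightarrow> real \<Rightarrow> real \<Rightarrow> (real \<Rightarrow> mat \<Rightarrow> mat) \<Rightarrow> bool" where
  "qds_solution r lam mu zp zm S \<longleftrightarrow>
    (\<forall>t\<ge>0. \<forall>x. bounded_mat x \<longrightarrow> bounded_mat (S t x)) \<and>
    (\<forall>t\<ge>0. \<forall>x y. bounded_mat x \<longrightarrow> bounded_mat y \<longrightarrow>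
        S t (\<lambda>i j. x i j + y i j) = (\<lambda>i j. S t x i j + S t y i j)) \<and>
    (\<forall>t\<ge>0. \<forall>c x. bounded_mat x \<longrightarrow> S t (\<lambda>i j. c * x i j) = (\<lambda>i j. c * S t x i j)) \<and>
    (\<forall>t\<ge>0. \<forall>x. bounded_mat x \<longrightarrow> positive_mat x \<longrightarrow> positive_mat (S t x)) \<and>
    (\<forall>t\<ge>0. \<forall>x. bounded_mat x \<longrightarrow> (\<forall>u v. domG u \<longrightarrow> domG v \<longrightarrow>
       (let P = Psg r lam mu zp zm;
            f1 = (\<lambda>s. ip (L1op r mu (P (t - s) v)) (mat_app (S s x) (L1op r mu (P (t - s) u))));
            f2 = (\<lambda>s. ip (L2op r lam (P (t - s) v)) (mat_app (S s x) (L2op r lam (P (t - s) u))))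
        in f1 integrable_on {0..t} \<and> f2 integrable_on {0..t} \<and>
           ip v (mat_app (S t x) u) =
             ip (P t v) (mat_app x (P t u)) + integral {0..t} f1 + integral {0..t} f2)))"

definition minimal_qds ::
  "real \<Rightarrow> real \<Rightarrow> real \<Rightarrow> real \<Rightarrow> real \<Rightarrow> (real \<Rightarrow> mat \<Rightarrow> mat) \<Rightarrow> bool" where
  "minimal_qds r lam mu zp zm S \<longleftrightarrow> qds_solution r lam mu zp zm S \<and>
    (\<forall>S'. qds_solution r lam mu zp zm S' \<longrightarrow>
       (\<forall>t\<ge>0. \<forall>x. bounded_mat x \<longrightarrow> positive_mat x \<longrightarrow>
          positive_mat (\<lambda>i j. S' t x i j - S t x i j)))"

definition hs :: "mat \<Rightarrow> bool" where
  "hs \<xi> \<longleftrightarrow> (\<lambda>(i,j). (cmod (\<xi> i j))^2) summable_on (UNIV :: (nat \<times> nat) set)"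

definition hs_ip :: "mat \<Rightarrow> mat \<Rightarrow> complex" where
  "hs_ip \<xi> \<eta> = infsum (\<lambda>(i,j). cnj (\<xi> i j) * \<eta> i j) (UNIV :: (nat \<times> nat) set)"

definition hs_norm :: "mat \<Rightarrow> real" where
  "hs_norm \<xi> = sqrt (infsum (\<lambda>(i,j). (cmod (\<xi> i j))^2) (UNIV :: (nat \<times> nat) set))"

text \<open>rho^{1/4}: diagonal, rho = (1-nu^2) sum nu^{2n} |e_n><e_n|, nu = lam/mu.\<close>
definition rho4 :: "real \<Rightarrow> real \<Rightarrow> nat \<Rightarrow> real" where
  "rho4 lam mu n = ((1 - (lam/mu)^2) * (lam/mu)^(2*n)) powr (1/4)"

definition iota :: "real \<Rightarrow> real \<Rightarrow> mat \<Rightarrow> mat" where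
  "iota lam mu x = (\<lambda>i j. complex_of_real (rho4 lam mu i) * x i j * complex_of_real (rho4 lam mu j))"

text \<open>T_t: bounded linear maps on L_2(h) with T_t(iota x) = iota(S_t x) (this determines T).\<close>
definition hs_semigroup_of :: "real \<Rightarrow> real \<Rightarrow> (real \<Rightarrow> mat \<Rightarrow> mat) \<Rightarrow> (real \<Rightarrow> mat \<Rightarrow> mat) \<Rightarrow> bool" where
  "hs_semigroup_of lam mu S T \<longleftrightarrow> (\<forall>t\<ge>0.
     (\<forall>\<xi>. hs \<xi> \<longrightarrow> hs (T t \<xi>)) \<and>
     (\<forall>\<xi> \<eta>. hs \<xi> \<longrightarrow> hs \<eta> \<longrightarrow> T t (\<lambda>i j. \<xi> i j + \<eta> i j) = (\<lambda>i j. T t \<xi> i j + T t \<eta> i j)) \<and>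
     (\<forall>c \<xi>. hs \<xi> \<longrightarrow> T t (\<lambda>i j. c * \<xi> i j) = (\<lambda>i j. c * T t \<xi> i j)) \<and>
     (\<exists>C. \<forall>\<xi>. hs \<xi> \<longrightarrow> hs_norm (T t \<xi>) \<le> C * hs_norm \<xi>) \<and>
     (\<forall>x. bounded_mat x \<longrightarrow> T t (iota lam mu x) = iota lam mu (S t x)))"

definition gen_rel :: "(real \<Rightarrow> mat \<Rightarrow> mat) \<Rightarrow> mat \<Rightarrow> mat \<Rightarrow> bool" where
  "gen_rel T \<xi> \<eta> \<longleftrightarrow> hs \<eta> \<and>
     ((\<lambda>t. hs_norm (\<lambda>i j. (T t \<xi> i j - \<xi> i j) / complex_of_real t - \<eta> i j)) \<longlongrightarrow> 0) (at_right 0)"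

definition gen_dom :: "(real \<Rightarrow> mat \<Rightarrow> mat) \<Rightarrow> mat \<Rightarrow> bool" where
  "gen_dom T \<xi> \<longleftrightarrow> hs \<xi> \<and> (\<exists>\<eta>. gen_rel T \<xi> \<eta>)"

definition gen :: "(real \<Rightarrow> mat \<Rightarrow> mat) \<Rightarrow> mat \<Rightarrow> mat" where
  "gen T \<xi> = (SOME \<eta>. gen_rel T \<xi> \<eta>)"

definition spectral_gap :: "(real \<Rightarrow> mat \<Rightarrow> mat) \<Rightarrow> real" where
  "spectral_gap T = Inf {- Re (hs_ip \<xi> (gen T \<xi>)) | \<xi>.
      gen_dom T \<xi> \<and> hs_norm \<xi> = 1 \<and>
      (\<forall>\<zeta>. gen_dom T \<zeta> \<and> gen T \<zeta> = (\<lambda>i j. 0) \<longrightarrow> hs_ip \<zeta> \<xi> = 0)}"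

definition lerch_phi :: "real \<Rightarrow> real \<Rightarrow> real" where
  "lerch_phi z r = (\<Sum>k. z ^ k / (real k + r))"

end

theory Submission
  imports Defs
begin

text \<open>The semigroup acts separately on each diagonal \<open>(n, n + d)\<close>. Conjugated with \<open>rho^(1/4)\<close>,
the generator is on every diagonal a symmetric Jacobi matrix plus an imaginary diagonal matrix. For
\<open>d \<noteq> 0\<close> the real part of its diagonal is \<open>- (al + be + kappa_d)\<close> with \<open>al\<close> and \<open>be\<close> factoring the square of the
off-diagonal entry, so the arithmetic-geometric inequality gives the bound \<open>kappa_d\<close>, which is
smallest for \<open>d = 1\<close>; there it is attained at the eigenvector \<open>nu^n sqrt ((n + 1) / (n + r))\<close>. On the
main diagonal the form is that of a birth-death chain with a geometric invariant measure, for which a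
Hardy inequality with increments \<open>1 / (n + r)\<close> gives the Poincare constant \<open>mu^2 / Phi\<close>; the
hypothesis says that this is at least \<open>kappa_1\<close>.

Minimality bounds \<open>S\<close> by the Dyson solution, which is contractive. The entries of \<open>S t x\<close> are thus bounded
uniformly in time, and since the weights \<open>rho^(1/4)\<close> decay geometrically, the boundary terms of the energy
balance on a finite box vanish in the limit. This yields the exponential decay of \<open>T\<close> on
Hilbert-Schmidt matrices orthogonal to \<open>rho^(1/2)\<close>, without any description of the domain of the generator.\<close>

section \<open>Vectors, matrices and finite sesquilinear forms\<close>

text \<open>Operators are known only through their entries and the coefficients \<open>omega\<close>
  are unbounded, so operator statements are reduced to sesquilinear forms on finite corners, where
  all sums are finite, and limits are taken last. Minimality is an ordering of positive matrices and
  says nothing about norms. It yields diagonal entries of \<open>S t idm\<close> at most 1;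
  positivity of \<open>S t\<close> on \<open>C * 1 + x\<close> and \<open>C * 1 - x\<close> then
  bounds every entry of \<open>S t x\<close>. Once entries are bounded, the energy estimate also
  gives uniqueness: applied to a difference with initial value 0 it forces
  \<open>S t idm = idm\<close>. The gap is an infimum over a domain that is not described. The lower
  bound needs only the decay of \<open>T t\<close>, differentiated at time 0. The upper bound needs
  explicit vectors in the domain: finitely supported matrices, by dominated convergence of
  difference quotients. Orthogonality to the kernel comes for free on the first superdiagonal,
  because the dissipation estimate confines the kernel to the main diagonal.\<close>

definition form :: "nat \<Rightarrow> mat \<Rightarrow> vec \<Rightarrow> vec \<Rightarrow> complex" where
  "form N X v u = (\<Sum>n<N. \<Sum>m<N. cnj (v n) * X n m * u m)"

definition unitv :: "nat \<Rightarrow> vec" where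
  "unitv k = (\<lambda>n. if n = k then 1 else 0)"

definition trunc :: "nat \<Rightarrow> vec \<Rightarrow> vec" where
  "trunc N u = (\<lambda>n. if n < N then u n else 0)"

definition idm :: mat where
  "idm = (\<lambda>n m. if n = m then 1 else 0)"

abbreviation nrm :: "nat \<Rightarrow> vec \<Rightarrow> real" where
  "nrm N u \<equiv> L2_set (\<lambda>n. cmod (u n)) {..<N}"

lemma nrm_sq: "(nrm N u)\<^sup>2 = (\<Sum>n<N. (cmod (u n))\<^sup>2)"
  by (simp add: L2_set_def sum_nonneg)

lemma summable_cmod_mult:
  assumes "l2 v" "l2 u"
  shows "summable (\<lambda>n. cmod (v n * u n))"
proof (rule summable_comparison_test')
  show "summable (\<lambda>n. (cmod (v n))\<^sup>2 + (cmod (u n))\<^sup>2)"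
    using assms by (auto simp: l2_def intro: summable_add)
  show "norm (cmod (v n * u n)) \<le> (cmod (v n))\<^sup>2 + (cmod (u n))\<^sup>2" for n
  proof -
    have "0 \<le> cmod (v n) * cmod (u n)" by simp
    with sum_squares_bound[of "cmod (v n)" "cmod (u n)"]
    have "cmod (v n) * cmod (u n) \<le> (cmod (v n))\<^sup>2 + (cmod (u n))\<^sup>2" by linarith
    then show ?thesis by (simp add: norm_mult)
  qed
qed

lemma l2_cnj: "l2 u \<Longrightarrow> l2 (\<lambda>n. cnj (u n))"
  by (simp add: l2_def)

lemma summable_ip:
  assumes "l2 v" "l2 u"
  shows "summable (\<lambda>n. cnj (v n) * u n)"
  using summable_norm_cancel[OF summable_cmod_mult[OF l2_cnj[OF assms(1)] assms(2)]] .

lemma vnorm_nonneg: "l2 u \<Longrightarrow> 0 \<le> vnorm u"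
  unfolding vnorm_def l2_def by (simp add: suminf_nonneg)

lemma nrm_le_vnorm: "l2 u \<Longrightarrow> nrm N u \<le> vnorm u"
  unfolding vnorm_def L2_set_def l2_def
  by (intro real_sqrt_le_mono sum_le_suminf) auto

lemma nrm_tendsto_vnorm: "l2 u \<Longrightarrow> (\<lambda>N. nrm N u) \<longlonglongrightarrow> vnorm u"
  unfolding vnorm_def L2_set_def l2_def
  by (intro tendsto_real_sqrt summable_LIMSEQ)

lemma l2_bounded:
  assumes "\<And>N. nrm N u \<le> C"
  shows "l2 u" "vnorm u \<le> C"
proof -
  have *: "(\<Sum>n<N. (cmod (u n))\<^sup>2) \<le> C\<^sup>2" for N
    using power_mono[OF assms[of N], of 2] by (simp add: nrm_sq)
  show "l2 u" unfolding l2_def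
    by (rule summableI_nonneg_bounded[OF _ *]) simp
  then show "vnorm u \<le> C"
    using LIMSEQ_le_const2[OF nrm_tendsto_vnorm] assms by blast
qed

lemma l2_finite: "(\<And>n. n \<ge> N \<Longrightarrow> u n = 0) \<Longrightarrow> l2 u"
  unfolding l2_def by (rule summable_finite[of "{..<N}"]) auto

lemma l2_trunc: "l2 (trunc N u)"
  by (rule l2_finite[of N]) (simp add: trunc_def)

lemma l2_unitv: "l2 (unitv k)"
  by (rule l2_finite[of "Suc k"]) (simp add: unitv_def)

lemma l2_add:
  assumes "l2 u" "l2 v" shows "l2 (\<lambda>n. u n + v n)"
proof (rule l2_bounded(1))
  fix N
  have "nrm N (\<lambda>n. u n + v n) \<le> L2_set (\<lambda>n. cmod (u n) + cmod (v n)) {..<N}"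
    by (rule L2_set_mono) (auto simp: norm_triangle_ineq)
  also have "\<dots> \<le> nrm N u + nrm N v" by (rule L2_set_triangle_ineq)
  also have "\<dots> \<le> vnorm u + vnorm v" using assms by (intro add_mono nrm_le_vnorm)
  finally show "nrm N (\<lambda>n. u n + v n) \<le> vnorm u + vnorm v" .
qed

lemma nrm_cmult: "nrm N (\<lambda>n. c * u n) = cmod c * nrm N u"
  by (simp add: L2_set_right_distrib norm_mult)

lemma l2_cmult: "l2 u \<Longrightarrow> l2 (\<lambda>n. c * u n)"
  unfolding l2_def by (simp add: norm_mult power_mult_distrib summable_mult)

lemma l2_diff: assumes "l2 u" "l2 v" shows "l2 (\<lambda>n. u n - v n)"
  using l2_add[OF assms(1) l2_cmult[OF assms(2), of "-1"]] by simp

lemma sum_cs: "cmod (\<Sum>n<N. cnj (v n) * u n) \<le> nrm N v * nrm N u"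
proof -
  have "cmod (\<Sum>n<N. cnj (v n) * u n) \<le> (\<Sum>n<N. cmod (cnj (v n) * u n))"
    by (rule norm_sum)
  also have "\<dots> = (\<Sum>n<N. \<bar>cmod (v n)\<bar> * \<bar>cmod (u n)\<bar>)"
    by (simp add: norm_mult)
  also have "\<dots> \<le> nrm N v * nrm N u" by (rule L2_set_mult_ineq)
  finally show ?thesis .
qed

lemma ip_cs:
  assumes "l2 v" "l2 u"
  shows "cmod (ip v u) \<le> vnorm v * vnorm u"
proof (rule LIMSEQ_le)
  show "(\<lambda>N. cmod (\<Sum>n<N. cnj (v n) * u n)) \<longlonglongrightarrow> cmod (ip v u)"
    unfolding ip_def by (intro tendsto_norm summable_LIMSEQ summable_ip assms)
  show "(\<lambda>N. nrm N v * nrm N u) \<longlonglongrightarrow> vnorm v * vnorm u"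
    by (intro tendsto_mult nrm_tendsto_vnorm assms)
qed (use sum_cs in blast)

lemma ip_diff_right:
  assumes "l2 v" "l2 u" "l2 w"
  shows "ip v (\<lambda>n. u n - w n) = ip v u - ip v w"
  unfolding ip_def suminf_diff[OF summable_ip[OF assms(1,2)] summable_ip[OF assms(1,3)]]
  by (simp add: right_diff_distrib)

lemma ip_diff_left:
  assumes "l2 v" "l2 u" "l2 w"
  shows "ip (\<lambda>n. v n - w n) u = ip v u - ip w u"
  unfolding ip_def suminf_diff[OF summable_ip[OF assms(1,2)] summable_ip[OF assms(3,2)]]
  by (simp add: left_diff_distrib)

lemma ip_finite:
  assumes "\<And>n. n \<ge> N \<Longrightarrow> v n = 0"
  shows "ip v u = (\<Sum>n<N. cnj (v n) * u n)"
  unfolding ip_def by (rule suminf_finite) (use assms in auto)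

lemma mat_app_finite:
  assumes "\<And>n. n \<ge> N \<Longrightarrow> u n = 0"
  shows "mat_app X u = (\<lambda>i. \<Sum>j<N. X i j * u j)"
  unfolding mat_app_def by (intro ext suminf_finite) (use assms in auto)

lemma form_trunc: "form N X v u = ip (trunc N v) (mat_app X (trunc N u))"
proof -
  have *: "mat_app X (trunc N u) = (\<lambda>i. \<Sum>j<N. X i j * trunc N u j)"
    by (rule mat_app_finite) (simp add: trunc_def)
  have "ip (trunc N v) (mat_app X (trunc N u)) =
      (\<Sum>n<N. cnj (trunc N v n) * mat_app X (trunc N u) n)"
    by (rule ip_finite) (simp add: trunc_def)
  also have "\<dots> = form N X v u"
    unfolding form_def * sum_distrib_left
    by (intro sum.cong refl) (simp add: trunc_def mult.assoc)
  finally show ?thesis by (rule sym)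
qed

lemma form_unitv:
  assumes "n < N" "m < N"
  shows "form N X (unitv n) (unitv m) = X n m"
proof -
  have "form N X (unitv n) (unitv m) = (\<Sum>i<N. if i = n then X i m else 0)"
    unfolding form_def
  proof (intro sum.cong refl)
    fix i
    have "(\<Sum>j<N. cnj (unitv n i) * X i j * unitv m j) = (\<Sum>j<N. if j = m then cnj (unitv n i) * X i j else 0)"
      by (intro sum.cong) (auto simp: unitv_def)
    then show "(\<Sum>j<N. cnj (unitv n i) * X i j * unitv m j) = (if i = n then X i m else 0)"
      using assms(2) by (simp add: sum.delta unitv_def)
  qed
  then show ?thesis using assms(1) by (simp add: sum.delta)
qed

lemma ip_unitv: "ip (\<lambda>j. a * unitv n j) (mat_app X (\<lambda>j. b * unitv m j)) = cnj a * X n m * b"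
proof -
  have "mat_app X (\<lambda>j. b * unitv m j) i = (\<Sum>j\<in>{m}. X i j * (b * unitv m j))" for i
    unfolding mat_app_def by (rule suminf_finite) (auto simp: unitv_def)
  then have 1: "mat_app X (\<lambda>j. b * unitv m j) i = X i m * b" for i
    by (simp add: unitv_def)
  have "ip (\<lambda>j. a * unitv n j) (mat_app X (\<lambda>j. b * unitv m j)) =
     (\<Sum>i\<in>{n}. cnj (a * unitv n i) * mat_app X (\<lambda>j. b * unitv m j) i)"
    unfolding ip_def by (rule suminf_finite) (auto simp: unitv_def)
  then show ?thesis unfolding 1 by (simp add: unitv_def)
qed

lemma form_idm: "form N idm u u = of_real (\<Sum>n<N. (cmod (u n))\<^sup>2)"
proof -
  have "form N idm u u = (\<Sum>n<N. \<Sum>m<N. if n = m then cnj (u n) * u n else 0)"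
    unfolding form_def idm_def by (intro sum.cong refl) auto
  also have "\<dots> = (\<Sum>n<N. cnj (u n) * u n)"
    by (intro sum.cong refl) (simp add: sum.delta')
  also have "\<dots> = (\<Sum>n<N. of_real ((cmod (u n))\<^sup>2))"
    by (intro sum.cong refl) (simp only: complex_norm_square mult.commute)
  finally show ?thesis by simp
qed

lemma form_add: "form N (\<lambda>i j. X i j + Y i j) v u = form N X v u + form N Y v u"
  by (simp only: form_def sum.distrib distrib_left distrib_right)

lemma form_cmult: "form N (\<lambda>i j. c * X i j) v u = c * form N X v u"
  unfolding form_def sum_distrib_left by (intro sum.cong refl) (simp only: mult_ac)

lemma form_sum: "form N (\<lambda>i j. \<Sum>k\<in>K. X k i j) v u = (\<Sum>k\<in>K. form N (X k) v u)"
  unfolding form_def sum_distrib_left sum_distrib_right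
  by (subst sum.swap[of _ K "{..<N}"], subst (2) sum.swap[of _ "{..<N}" K], rule refl)

lemma form_scale: "form N X (\<lambda>n. a * v n) (\<lambda>n. b * u n) = cnj a * b * form N X v u"
  unfolding form_def sum_distrib_left by (intro sum.cong refl) (simp only: complex_cnj_mult mult_ac)

section \<open>Bounded operators through uniform bounds on finite corners\<close>

text \<open>An operator norm bound that never mentions an infinite sum. Uniformity in the corner
  size \<open>N\<close> makes it survive entrywise limits.\<close>

definition form_bounded :: "real \<Rightarrow> mat \<Rightarrow> bool" where
  "form_bounded C X \<longleftrightarrow> 0 \<le> C \<and> (\<forall>(N::nat) (v::vec) (u::vec). cmod (form N X v u) \<le> C * nrm N v * nrm N u)"

lemma form_boundedD: "form_bounded C X \<Longrightarrow> cmod (form N X v u) \<le> C * nrm N v * nrm N u"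
  by (simp add: form_bounded_def)

lemma form_bounded_le:
  assumes "form_bounded C X"
  shows "cmod (form N X v u) \<le> C / 2 * ((nrm N v)\<^sup>2 + (nrm N u)\<^sup>2)"
proof -
  have "cmod (form N X v u) \<le> C * (nrm N v * nrm N u)"
    using form_boundedD[OF assms] by (simp add: mult.assoc)
  also have "\<dots> \<le> C * (((nrm N v)\<^sup>2 + (nrm N u)\<^sup>2) / 2)"
    using assms sum_squares_bound[of "nrm N v" "nrm N u"]
    by (intro mult_left_mono) (auto simp: form_bounded_def)
  finally show ?thesis by simp
qed

lemma form_eq_0: "nrm N v = 0 \<or> nrm N u = 0 \<Longrightarrow> form N X v u = 0"
  by (auto simp: form_def L2_set_eq_0_iff)

text \<open>The product bound follows from the additive one by rescaling the two vectors to equal norm.\<close>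
lemma form_boundedI:
  assumes C: "0 \<le> C"
    and le: "\<And>N v u. cmod (form N X v u) \<le> C / 2 * ((nrm N v)\<^sup>2 + (nrm N u)\<^sup>2)"
  shows "form_bounded C X"
  unfolding form_bounded_def
proof (intro conjI allI)
  fix N v u
  let ?a = "nrm N v" and ?b = "nrm N u"
  show "cmod (form N X v u) \<le> C * ?a * ?b"
  proof (cases "?a = 0 \<or> ?b = 0")
    case True then show ?thesis using form_eq_0[where N=N and v=v and u=u] by auto
  next
    case False
    then have pos: "?a > 0" "?b > 0" by (simp_all add: order_less_le)
    have "cmod (form N X (\<lambda>n. of_real ?b * v n) (\<lambda>n. of_real ?a * u n)) \<le>
       C / 2 * ((?b * ?a)\<^sup>2 + (?a * ?b)\<^sup>2)"
      using le[of N "\<lambda>n. of_real ?b * v n" "\<lambda>n. of_real ?a * u n"]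
      by (simp only: nrm_cmult norm_of_real abs_of_nonneg L2_set_nonneg)
    also have "\<dots> = (?a * ?b) * (C * ?a * ?b)" by (simp add: power2_eq_square algebra_simps)
    finally have "(?a * ?b) * cmod (form N X v u) \<le> (?a * ?b) * (C * ?a * ?b)"
      unfolding form_scale by (simp add: norm_mult algebra_simps)
    then show ?thesis using pos by (simp add: mult_le_cancel_left)
  qed
qed (rule C)

lemma bounded_mat_imp_form_bounded:
  assumes "bounded_mat X"
  obtains C where "form_bounded C X"
proof -
  obtain C where C: "\<And>u. l2 u \<Longrightarrow> l2 (mat_app X u) \<and> vnorm (mat_app X u) \<le> C * vnorm u"
    using assms unfolding bounded_mat_def by blast
  have vt: "vnorm (trunc N u) = nrm N u" for N u
    unfolding vnorm_def L2_set_def by (subst suminf_finite[of "{..<N}"]) (auto simp: trunc_def)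
  \<comment> \<open>The constant in \<open>bounded_mat\<close> carries no sign, whereas
    \<open>form_bounded\<close> asks for a nonnegative one.\<close>
  have "form_bounded \<bar>C\<bar> X"
    unfolding form_bounded_def
  proof (intro conjI allI)
    fix N v u
    have "cmod (form N X v u) \<le> vnorm (trunc N v) * vnorm (mat_app X (trunc N u))"
      unfolding form_trunc using C l2_trunc by (intro ip_cs) auto
    also have "\<dots> \<le> nrm N v * (\<bar>C\<bar> * nrm N u)"
      using C[OF l2_trunc[of N u]] unfolding vt
      by (intro mult_left_mono order_trans[OF conjunct2[OF C[OF l2_trunc[of N u]]], unfolded vt] mult_right_mono) auto
    finally show "cmod (form N X v u) \<le> \<bar>C\<bar> * nrm N v * nrm N u" by (simp add: mult_ac)
  qed simp
  then show thesis by (rule that)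
qed

lemma le_of_sq_le: fixes x C :: real assumes "x\<^sup>2 \<le> C * x" "0 \<le> C" "0 \<le> x" shows "x \<le> C"
  using assms by (cases "x = 0") (auto simp: power2_eq_square)

text \<open>The rows and the images serve as their own test vectors: inserting the conjugate of a
  truncated row, or a truncated image, gives an inequality of the type \<open>x^2 <= C * x\<close>.
  Norms are thereby bounded before any series is known to converge.\<close>

lemma form_bounded_mat:
  assumes X: "form_bounded C X"
  shows "\<And>u i. l2 u \<Longrightarrow> summable (\<lambda>j. X i j * u j)"
    "\<And>u. l2 u \<Longrightarrow> l2 (mat_app X u)"
    "\<And>u. l2 u \<Longrightarrow> vnorm (mat_app X u) \<le> C * vnorm u"
    "bounded_mat X"
proof -
  have C: "0 \<le> C" using X by (simp add: form_bounded_def)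
  have row: "l2 (\<lambda>j. X i j)" for i
  proof (rule l2_bounded(1))
    fix N
    let ?x = "L2_set (\<lambda>j. cmod (X i j)) {..<N}"
    define M where "M = max N (Suc i)"
    have "form M X (unitv i) (trunc N (\<lambda>j. cnj (X i j)))
       = (\<Sum>n<M. if n = i then (\<Sum>m<M. if m < N then X i m * cnj (X i m) else 0) else 0)"
      unfolding form_def unitv_def trunc_def by (intro sum.cong refl) (auto intro!: sum.cong)
    also have "\<dots> = (\<Sum>m<M. if m \<in> {..<N} then X i m * cnj (X i m) else 0)"
      by (simp add: sum.delta M_def)
    also have "\<dots> = (\<Sum>m<N. X i m * cnj (X i m))"
    proof -
      have "{..<M} \<inter> {..<N} = {..<N}" by (auto simp: M_def)
      then show ?thesis by (subst sum.inter_restrict[symmetric]) auto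
    qed
    also have "\<dots> = of_real (\<Sum>m<N. (cmod (X i m))\<^sup>2)"
      by (simp only: of_real_sum complex_norm_square)
    finally have "cmod (form M X (unitv i) (trunc N (\<lambda>j. cnj (X i j)))) = ?x\<^sup>2"
      by (simp add: nrm_sq sum_nonneg del: of_real_sum)
    moreover have "nrm M (unitv i) = 1"
    proof -
      have "(\<Sum>n<M. (cmod (unitv i n))\<^sup>2) = (\<Sum>n<M. if n = i then 1 else 0)"
        by (intro sum.cong) (auto simp: unitv_def)
      then show ?thesis unfolding L2_set_def by (simp add: M_def)
    qed
    moreover have "nrm M (trunc N (\<lambda>j. cnj (X i j))) = ?x"
    proof -
      have "(\<Sum>n<M. (cmod (trunc N (\<lambda>j. cnj (X i j)) n))\<^sup>2) = (\<Sum>n<N. (cmod (X i n))\<^sup>2)"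
        by (rule sum.mono_neutral_cong_right) (auto simp: trunc_def M_def)
      then show ?thesis unfolding L2_set_def by simp
    qed
    ultimately have "?x\<^sup>2 \<le> C * ?x"
      using form_boundedD[OF X, of M "unitv i" "trunc N (\<lambda>j. cnj (X i j))"] by simp
    then show "?x \<le> C" using C by (rule le_of_sq_le) auto
  qed
  have summ: "summable (\<lambda>j. X i j * u j)" if "l2 u" for i u
    using summable_norm_cancel[OF summable_cmod_mult[OF row that]] .
  have est: "nrm M (mat_app X u) \<le> C * vnorm u" if u: "l2 u" for M u
  proof (rule LIMSEQ_le_const2)
    define y where "y K i = (\<Sum>j<K. X i j * u j)" for K i
    have lim: "(\<lambda>K. y K i) \<longlonglongrightarrow> mat_app X u i" for i
      unfolding y_def mat_app_def by (intro summable_LIMSEQ summ u)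
    show "(\<lambda>K. nrm M (y K)) \<longlonglongrightarrow> nrm M (mat_app X u)"
      unfolding L2_set_def by (intro tendsto_real_sqrt tendsto_sum tendsto_power tendsto_norm lim)
    \<comment> \<open>The number \<open>M\<close> of rows stays fixed while the number
      \<open>K\<close> of columns grows; for \<open>K \<ge> M\<close> the image cut at
      \<open>M\<close> fits into the corner of size \<open>K\<close>.\<close>
    show "\<exists>K0. \<forall>K\<ge>K0. nrm M (y K) \<le> C * vnorm u"
    proof (intro exI allI impI)
      fix K assume K: "M \<le> K"
      let ?x = "nrm M (y K)"
      have "form K X (trunc M (y K)) u = (\<Sum>n<K. if n < M then cnj (y K n) * y K n else 0)"
        unfolding form_def trunc_def y_def
        by (intro sum.cong refl) (auto simp: sum_distrib_left mult.assoc)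
      also have "\<dots> = (\<Sum>n<M. cnj (y K n) * y K n)"
        using K by (intro sum.mono_neutral_cong_right) auto
      also have "\<dots> = of_real (\<Sum>m<M. (cmod (y K m))\<^sup>2)"
        by (simp only: of_real_sum complex_norm_square mult.commute)
      finally have "cmod (form K X (trunc M (y K)) u) = ?x\<^sup>2"
        by (simp add: nrm_sq sum_nonneg del: of_real_sum)
      moreover have "nrm K (trunc M (y K)) = ?x"
      proof -
        have "(\<Sum>n<K. (cmod (trunc M (y K) n))\<^sup>2) = (\<Sum>n<M. (cmod (y K n))\<^sup>2)"
          using K by (intro sum.mono_neutral_cong_right) (auto simp: trunc_def)
        then show ?thesis unfolding L2_set_def by simp
      qed
      ultimately have "?x\<^sup>2 \<le> C * ?x * nrm K u"
        using form_boundedD[OF X, of K "trunc M (y K)" u] by simp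
      then have "?x \<le> C * nrm K u"
        by (intro le_of_sq_le[of ?x "C * nrm K u"] mult_nonneg_nonneg C L2_set_nonneg) (simp add: mult_ac)
      also have "\<dots> \<le> C * vnorm u" using C nrm_le_vnorm[OF u] by (intro mult_left_mono)
      finally show "?x \<le> C * vnorm u" .
    qed
  qed
  show "summable (\<lambda>j. X i j * u j)" if "l2 u" for i u by (rule summ[OF that])
  show l: "l2 (mat_app X u)" if "l2 u" for u using l2_bounded(1)[OF est[OF that]] .
  show v: "vnorm (mat_app X u) \<le> C * vnorm u" if "l2 u" for u using l2_bounded(2)[OF est[OF that]] .
  show "bounded_mat X" unfolding bounded_mat_def using summ l v by blast
qed

lemma vnorm_tail: assumes "l2 u" shows "(\<lambda>N. vnorm (\<lambda>n. u n - trunc N u n)) \<longlonglongrightarrow> 0"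
proof -
  have s: "summable (\<lambda>n. (cmod (u n))\<^sup>2)" using assms by (simp add: l2_def)
  have "(\<Sum>n. (cmod (u n - trunc N u n))\<^sup>2) = (\<Sum>n. (cmod (u (n + N)))\<^sup>2)" for N
  proof -
    have "summable (\<lambda>n. (cmod (u n - trunc N u n))\<^sup>2)"
      using l2_diff[OF assms l2_trunc] by (simp add: l2_def)
    from suminf_split_initial_segment[OF this, of N] show ?thesis by (simp add: trunc_def)
  qed
  then have "(\<lambda>N. vnorm (\<lambda>n. u n - trunc N u n)) = (\<lambda>N. sqrt (\<Sum>n. (cmod (u (n + N)))\<^sup>2))"
    by (simp add: vnorm_def)
  moreover have "(\<lambda>N. sqrt (\<Sum>n. (cmod (u (n + N)))\<^sup>2)) \<longlonglongrightarrow> sqrt 0"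
    by (intro tendsto_real_sqrt suminf_exist_split2 s)
  ultimately show ?thesis by simp
qed

text \<open>The error splits into the tail of \<open>v\<close> against \<open>X u\<close> and the
  truncated \<open>v\<close> against the image of the tail of \<open>u\<close>. Both vanish because
  tails of square-summable vectors do and \<open>X\<close> is bounded.\<close>

lemma form_tendsto:
  assumes X: "bounded_mat X" and v: "l2 v" and u: "l2 u"
  shows "(\<lambda>N. form N X v u) \<longlonglongrightarrow> ip v (mat_app X u)"
proof -
  obtain C where C: "form_bounded C X" using bounded_mat_imp_form_bounded[OF X] .
  note fb = form_bounded_mat[OF C]
  let ?R = "\<lambda>w N. vnorm (\<lambda>n. w n - trunc N w n)"
  have C0: "0 \<le> C" using C by (simp add: form_bounded_def)
  have hop_boundary: "cmod (form N X v u - ip v (mat_app X u)) \<le> ?R v N * (C * vnorm u) + vnorm v * (C * ?R u N)" for N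
  proof -
    let ?vN = "trunc N v" and ?uN = "trunc N u"
    have vt: "vnorm ?vN \<le> vnorm v"
    proof -
      have "vnorm ?vN = nrm N v"
        unfolding vnorm_def L2_set_def by (subst suminf_finite[of "{..<N}"]) (auto simp: trunc_def)
      then show ?thesis using nrm_le_vnorm[OF v] by simp
    qed
    have "mat_app X (\<lambda>n. u n - ?uN n) = (\<lambda>i. mat_app X u i - mat_app X ?uN i)"
      unfolding mat_app_def
      by (intro ext) (simp add: right_diff_distrib suminf_diff fb(1)[OF u] fb(1)[OF l2_trunc])
    then have "ip v (mat_app X u) - form N X v u =
       ip (\<lambda>n. v n - ?vN n) (mat_app X u) + ip ?vN (mat_app X (\<lambda>n. u n - ?uN n))"
      unfolding form_trunc
      by (simp add: ip_diff_left ip_diff_right v u l2_trunc fb(2))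
    then have "cmod (form N X v u - ip v (mat_app X u)) \<le>
       cmod (ip (\<lambda>n. v n - ?vN n) (mat_app X u)) + cmod (ip ?vN (mat_app X (\<lambda>n. u n - ?uN n)))"
      by (metis norm_minus_commute norm_triangle_ineq)
    also have "\<dots> \<le> ?R v N * vnorm (mat_app X u) + vnorm ?vN * vnorm (mat_app X (\<lambda>n. u n - ?uN n))"
      by (intro add_mono ip_cs l2_diff l2_trunc v u fb(2))
    also have "\<dots> \<le> ?R v N * (C * vnorm u) + vnorm v * (C * ?R u N)"
      by (intro add_mono mult_mono fb(3) order_refl vt l2_diff u v l2_trunc vnorm_nonneg C0 mult_nonneg_nonneg fb(2))
    finally show ?thesis .
  qed
  have "(\<lambda>N. ?R v N * (C * vnorm u) + vnorm v * (C * ?R u N)) \<longlonglongrightarrow> 0 * (C * vnorm u) + vnorm v * (C * 0)"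
    by (intro tendsto_add tendsto_mult tendsto_const vnorm_tail v u)
  then have "(\<lambda>N. form N X v u - ip v (mat_app X u)) \<longlonglongrightarrow> 0"
    using Lim_null_comparison[OF always_eventually[OF allI[OF hop_boundary]]] by simp
  then show ?thesis using LIM_zero_iff by blast
qed

section \<open>Positivity tested on finite corners\<close>

definition form_pos :: "mat \<Rightarrow> bool" where
  "form_pos X \<longleftrightarrow> (\<forall>N u. Im (form N X u u) = 0 \<and> 0 \<le> Re (form N X u u))"

lemma positive_mat_iff:
  assumes X: "bounded_mat X"
  shows "positive_mat X \<longleftrightarrow> form_pos X"
proof
  assume "positive_mat X"
  then show "form_pos X" unfolding positive_mat_def form_pos_def form_trunc
    using l2_trunc by blast
next
  assume p: "form_pos X"
  show "positive_mat X" unfolding positive_mat_def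
  proof (intro allI impI conjI)
    fix u assume u: "l2 u"
    note t = form_tendsto[OF X u u]
    have "(\<lambda>N. Im (form N X u u)) \<longlonglongrightarrow> Im (ip u (mat_app X u))" by (intro tendsto_Im t)
    then show "Im (ip u (mat_app X u)) = 0"
      using p by (simp add: form_pos_def LIMSEQ_const_iff)
    have "(\<lambda>N. Re (form N X u u)) \<longlonglongrightarrow> Re (ip u (mat_app X u))" by (intro tendsto_Re t)
    then show "0 \<le> Re (ip u (mat_app X u))"
      by (rule LIMSEQ_le_const) (use p in \<open>auto simp: form_pos_def\<close>)
  qed
qed

lemma form_pos_diag:
  assumes "form_pos X" shows "Im (X n n) = 0" "0 \<le> Re (X n n)"
  using assms form_unitv[of n "Suc n" n X] unfolding form_pos_def by (metis lessI)+

lemma positive_mat_form_pos: "positive_mat X \<Longrightarrow> form_pos X"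
  unfolding positive_mat_def form_pos_def form_trunc using l2_trunc by blast

text \<open>Test vectors \<open>e_n + c e_m\<close> suffice: \<open>c = 1\<close> and
  \<open>c = i\<close> force hermitian symmetry, and a \<open>c\<close> of modulus 1 that turns the
  entry into minus its modulus gives \<open>2 |X n m|\<close> at most the sum of the two diagonal
  entries.\<close>

lemma form_pos_offdiag:
  assumes "form_pos X"
  shows "cmod (X n m) \<le> Re (X n n) + Re (X m m)"
proof (cases "n = m")
  case True
  have "cmod (X n n) = \<bar>Re (X n n)\<bar>" using form_pos_diag[OF assms, of n] by (simp add: cmod_def)
  then show ?thesis using True form_pos_diag[OF assms, of n] by simp
next
  case False
  define N where "N = Suc (max n m)"
  have N: "n < N" "m < N" by (auto simp: N_def)
  have ex: "form N X (\<lambda>j. unitv n j + c * unitv m j) (\<lambda>j. unitv n j + c * unitv m j)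
     = X n n + c * X n m + cnj c * X m n + cnj c * c * X m m" for c
  proof -
    have "form N X (\<lambda>j. unitv n j + c * unitv m j) (\<lambda>j. unitv n j + c * unitv m j)
      = form N X (unitv n) (unitv n) + c * form N X (unitv n) (unitv m)
      + cnj c * form N X (unitv m) (unitv n) + cnj c * c * form N X (unitv m) (unitv m)"
      unfolding form_def by (simp add: algebra_simps sum.distrib sum_distrib_left)
    then show ?thesis by (simp add: form_unitv N)
  qed
  have p: "Im (X n n + c * X n m + cnj c * X m n + cnj c * c * X m m) = 0"
     "0 \<le> Re (X n n + c * X n m + cnj c * X m n + cnj c * c * X m m)" for c
    using assms unfolding form_pos_def ex[symmetric] by blast+
  note d = form_pos_diag[OF assms]
  have herm: "X m n = cnj (X n m)"
    using p(1)[of 1] p(1)[of \<i>] d by (auto simp: complex_eq_iff)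
  show ?thesis
  proof (cases "X n m = 0")
    case True then show ?thesis using d(2)[of n] d(2)[of m] by simp
  next
    case False
    define c where "c = - cnj (sgn (X n m))"
    have xx: "X n m * cnj (X n m) = of_real (cmod (X n m)) * of_real (cmod (X n m))"
      using complex_norm_square[of "X n m"] by (simp add: power2_eq_square)
    have nz: "cmod (X n m) \<noteq> 0" using False by simp
    have c: "c = - cnj (X n m) / of_real (cmod (X n m))"
      by (simp add: c_def sgn_div_norm scaleR_conv_of_real divide_inverse mult.commute)
    have c1: "cnj c * c = 1" using nz xx by (simp add: c)
    have c2: "c * X n m = - of_real (cmod (X n m))"
      using nz xx by (simp add: c mult.commute)
    have "cnj c * X m n = cnj (c * X n m)" by (simp add: herm)
    then have "Re (X n n + c * X n m + cnj c * X m n + cnj c * c * X m m) = Re (X n n) - 2 * cmod (X n m) + Re (X m m)"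
      unfolding c1 c2 by simp
    then show ?thesis using p(2)[of c] norm_ge_zero[of "X n m"] by linarith
  qed
qed

section \<open>The Dyson series\<close>

lemma form_has_integral:
  assumes "\<And>n m. (F n m has_integral I n m) S"
  shows "((\<lambda>s. form N (\<lambda>n m. F n m s) v u) has_integral form N I v u) S"
  unfolding form_def
  by (intro has_integral_sum finite_lessThan has_integral_mult_left has_integral_mult_right assms)

text \<open>Moves \<open>t\<close> out of the convolution kernel, so that a convolution becomes a
  prefactor times an indefinite integral.\<close>

lemma exp_diff_split:
  "exp (of_real (t - s) * g) = exp (of_real t * g) * exp (- (of_real s * g))" for g :: complex
  by (simp add: algebra_simps flip: exp_add)

section \<open>Drift and jump parts of the generator on matrix entries\<close>

locale qparam =
  fixes r lam mu zp zm :: real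
  assumes lam: "0 < lam" and lm: "lam < mu" and r: "0 < r"
begin

abbreviation "om \<equiv> omega r"
abbreviation "gd \<equiv> gdiag r lam mu zp zm"
abbreviation "P \<equiv> Psg r lam mu zp zm"
abbreviation "L1 \<equiv> L1op r mu"
abbreviation "L2 \<equiv> L2op r lam"

text \<open>Since \<open>G\<close> is diagonal, the entry \<open>(n, m)\<close> of
  \<open>G' X + X G\<close>, with \<open>G'\<close> the adjoint, is this multiple of
  \<open>X n m\<close>; conjugation by \<open>P t\<close> multiplies it by
  \<open>exp (t * drift n m)\<close>.\<close>

definition drift :: mat where
  "drift n m = cnj (gd n) + gd m"

text \<open>The entries of the sum of \<open>L' X L\<close> over \<open>L1\<close> and
  \<open>L2\<close>, with \<open>L'\<close> the adjoint. At \<open>n = 0\<close> or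
  \<open>m = 0\<close> natural subtraction reads a meaningless entry, which the factor
  \<open>om 0 = 0\<close> removes.\<close>

definition jump :: "mat \<Rightarrow> mat" where
  "jump X n m = of_real (mu\<^sup>2 * sqrt (om n * om m)) * X (n - 1) (m - 1)
            + of_real (lam\<^sup>2 * sqrt (om (Suc n) * om (Suc m))) * X (Suc n) (Suc m)"

lemma mu: "0 < mu" using lam lm by simp

lemma om_0 [simp]: "om 0 = 0" by (simp add: omega_def)

lemma om_nonneg [simp]: "0 \<le> om n"
proof (cases n)
  case (Suc k) then show ?thesis using r by (simp add: omega_def)
qed simp

lemma om_Suc: "om (Suc n) = (real n + 1) * (real n + r)"
  by (simp add: omega_def algebra_simps)

lemma om_mono: "n \<le> m \<Longrightarrow> om n \<le> om m"
proof (cases n)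
  case (Suc k)
  moreover assume "n \<le> m"
  ultimately obtain l where "m = Suc l" "k \<le> l" by (cases m) auto
  then show ?thesis using r Suc unfolding om_Suc by (auto simp: om_Suc intro!: mult_mono)
qed simp

lemma Re_gd: "Re (gd n) = - (lam\<^sup>2 / 2 * om (Suc n) + mu\<^sup>2 / 2 * om n)"
  by (simp add: gdiag_def)

lemma Re_drift_le: "Re (drift n m) \<le> 0"
proof -
  have "0 \<le> lam\<^sup>2 / 2 * om (Suc k) + mu\<^sup>2 / 2 * om k" for k
    by (intro add_nonneg_nonneg mult_nonneg_nonneg) auto
  from this[of n] this[of m] show ?thesis unfolding drift_def plus_complex.simps cnj.simps Re_gd by linarith
qed

lemma drift_diag: "drift n n = of_real (- (lam\<^sup>2 * om (Suc n) + mu\<^sup>2 * om n))"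
  by (simp add: drift_def complex_eq_iff Re_gd)

lemma norm_exp_le: "0 \<le> t \<Longrightarrow> Re g \<le> 0 \<Longrightarrow> cmod (exp (of_real t * g)) \<le> 1"
  by (simp add: mult_nonneg_nonpos)

text \<open>Lowering the index shrinks the corner to \<open>N - 1\<close>, raising it enlarges the
  corner to \<open>Suc N\<close>. Positivity and domination are statements about all corners and all
  vectors, so this identity carries both through the jump part.\<close>

lemma form_jump: "form N (jump X) v u = form (N - 1) X (L1 v) (L1 u) + form (Suc N) X (L2 v) (L2 u)"
proof -
  let ?A = "\<lambda>n m. cnj (v n) * (of_real (mu\<^sup>2 * sqrt (om n * om m)) * X (n - 1) (m - 1)) * u m"
  let ?B = "\<lambda>n m. cnj (v n) * (of_real (lam\<^sup>2 * sqrt (om (Suc n) * om (Suc m))) * X (Suc n) (Suc m)) * u m"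
  have "form N (jump X) v u = (\<Sum>n<N. \<Sum>m<N. ?A n m) + (\<Sum>n<N. \<Sum>m<N. ?B n m)"
    unfolding form_def jump_def by (simp only: distrib_left distrib_right sum.distrib)
  moreover have "(\<Sum>n<N. \<Sum>m<N. ?A n m) = form (N - 1) X (L1 v) (L1 u)"
  proof (cases N)
    case (Suc K)
    have "(\<Sum>n<N. \<Sum>m<N. ?A n m) = (\<Sum>n<K. \<Sum>m<K. ?A (Suc n) (Suc m))"
      unfolding Suc by (simp only: sum.lessThan_Suc_shift) simp
    also have "\<dots> = form (N - 1) X (L1 v) (L1 u)"
      unfolding form_def Suc diff_Suc_1
      by (intro sum.cong refl)
        (simp add: L1op_def Bop_def real_sqrt_mult power2_eq_square mult_ac)
    finally show ?thesis .
  qed (simp add: form_def)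
  moreover have "(\<Sum>n<N. \<Sum>m<N. ?B n m) = form (Suc N) X (L2 v) (L2 u)"
  proof -
    have "form (Suc N) X (L2 v) (L2 u) = (\<Sum>n<N. \<Sum>m<N. cnj (L2 v (Suc n)) * X (Suc n) (Suc m) * L2 u (Suc m))"
      unfolding form_def by (simp only: sum.lessThan_Suc_shift) (simp add: L2op_def Bplus_def)
    also have "\<dots> = (\<Sum>n<N. \<Sum>m<N. ?B n m)"
      by (intro sum.cong refl)
        (simp add: L2op_def Bplus_def real_sqrt_mult power2_eq_square mult_ac)
    finally show ?thesis by (rule sym)
  qed
  ultimately show ?thesis by simp
qed

lemma form_P: "form N (\<lambda>n m. exp (of_real t * drift n m) * X n m) v u = form N X (P t v) (P t u)"
  unfolding form_def Psg_def drift_def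
  by (intro sum.cong refl)
    (simp add: distrib_left exp_add exp_cnj mult_ac)

lemma jump_sum: "jump (\<lambda>i j. \<Sum>k\<in>K. X k i j) n m = (\<Sum>k\<in>K. jump (X k) n m)"
  by (simp only: jump_def sum.distrib sum_distrib_left)

lemma form_pos_jump: "form_pos X \<Longrightarrow> form_pos (jump X)"
  unfolding form_pos_def form_jump by simp

section \<open>Terms of the series, their positivity and their domination\<close>

text \<open>Term \<open>k\<close> collects the contributions with exactly \<open>k\<close> jumps.
  The free evolution is diagonal, so each iteration is a scalar convolution on every entry.\<close>

primrec dyson_term :: "nat \<Rightarrow> mat \<Rightarrow> real \<Rightarrow> mat" where
  "dyson_term 0 x = (\<lambda>t n m. exp (of_real t * drift n m) * x n m)"
| "dyson_term (Suc k) x = (\<lambda>t n m. integral {0..t} (\<lambda>s. exp (of_real (t - s) * drift n m) * jump (dyson_term k x s) n m))"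

declare dyson_term.simps(2) [simp del]

lemma jump_continuous:
  assumes "\<And>n m. continuous_on A (\<lambda>t. y t n m)"
  shows "continuous_on A (\<lambda>t. jump (y t) n m)"
  unfolding jump_def by (intro continuous_intros assms)

lemma dyson_term_continuous: "continuous_on {0..b} (\<lambda>t. dyson_term k x t n m)"
proof (induction k arbitrary: n m)
  case 0 show ?case by (auto intro!: continuous_intros)
next
  case (Suc k)
  have "dyson_term (Suc k) x t n m = exp (of_real t * drift n m) *
      integral {0..t} (\<lambda>s. exp (- (of_real s * drift n m)) * jump (dyson_term k x s) n m)" for t
    by (simp only: dyson_term.simps exp_diff_split mult.assoc integral_mult_right)
  then show ?case
    by (simp only:) (intro continuous_intros indefinite_integral_continuous_1
        integrable_continuous_real jump_continuous Suc)
qed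

lemma dyson_term_Suc_has_integral:
  "((\<lambda>s. exp (of_real (t - s) * drift n m) * jump (dyson_term k x s) n m) has_integral dyson_term (Suc k) x t n m) {0..t}"
  unfolding dyson_term.simps
  by (intro integrable_integral integrable_continuous_real continuous_intros jump_continuous dyson_term_continuous)

lemma form_dyson_term_Suc:
  "((\<lambda>s. form N (jump (dyson_term k x s)) (P (t - s) v) (P (t - s) u)) has_integral form N (dyson_term (Suc k) x t) v u) {0..t}"
  using form_has_integral[of _ "dyson_term (Suc k) x t", OF dyson_term_Suc_has_integral] by (simp only: form_P)

lemma form_pos_dyson_term: "form_pos x \<Longrightarrow> 0 \<le> t \<Longrightarrow> form_pos (dyson_term k x t)"
proof (induction k arbitrary: t)
  case 0 then show ?case by (simp add: form_pos_def form_P)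
next
  case (Suc k)
  show ?case unfolding form_pos_def
  proof (intro allI conjI)
    fix N u
    note hi = form_dyson_term_Suc[of N k x t u u]
    have pos: "form_pos (jump (dyson_term k x s))" if "s \<in> {0..t}" for s
      using Suc that by (intro form_pos_jump) auto
    have "((\<lambda>s. Im (form N (jump (dyson_term k x s)) (P (t - s) u) (P (t - s) u))) has_integral
        Im (form N (dyson_term (Suc k) x t) u u)) {0..t}"
      using has_integral_linear[OF hi bounded_linear_Im] by (simp add: o_def)
    then have "((\<lambda>s. 0) has_integral Im (form N (dyson_term (Suc k) x t) u u)) {0..t}"
      by (rule has_integral_eq[rotated]) (use pos in \<open>simp add: form_pos_def\<close>)
    then show "Im (form N (dyson_term (Suc k) x t) u u) = 0"
      using has_integral_unique has_integral_0 by blast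
    have "((\<lambda>s. Re (form N (jump (dyson_term k x s)) (P (t - s) u) (P (t - s) u))) has_integral
        Re (form N (dyson_term (Suc k) x t) u u)) {0..t}"
      using has_integral_linear[OF hi bounded_linear_Re] by (simp add: o_def)
    then show "0 \<le> Re (form N (dyson_term (Suc k) x t) u u)"
      by (rule has_integral_nonneg) (use pos in \<open>simp add: form_pos_def\<close>)
  qed
qed

text \<open>Stands in for the Cauchy-Schwarz inequality of completely positive maps. The arithmetic
  mean on the right is additive in \<open>X\<close> and \<open>Y\<close>, hence passes through sums,
  through \<open>jump\<close> and through integrals over time.\<close>

definition dominated_by :: "real \<Rightarrow> mat \<Rightarrow> mat \<Rightarrow> bool" where
  "dominated_by C X Y \<longleftrightarrow>
     (\<forall>N v u. cmod (form N X v u) \<le> C / 2 * (Re (form N Y v v) + Re (form N Y u u)))"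

lemma dominated_by_jump: "dominated_by C X Y \<Longrightarrow> dominated_by C (jump X) (jump Y)"
  unfolding dominated_by_def
proof (intro allI)
  fix N v u
  assume *: "\<forall>N v u. cmod (form N X v u) \<le> C / 2 * (Re (form N Y v v) + Re (form N Y u u))"
  show "cmod (form N (jump X) v u) \<le> C / 2 * (Re (form N (jump Y) v v) + Re (form N (jump Y) u u))"
    unfolding form_jump
    using norm_triangle_ineq[of "form (N - 1) X (L1 v) (L1 u)" "form (Suc N) X (L2 v) (L2 u)"]
      *[rule_format, of "N - 1" "L1 v" "L1 u"] *[rule_format, of "Suc N" "L2 v" "L2 u"]
    by (simp add: algebra_simps)
qed

text \<open>Reduces the size of the series of an arbitrary bounded matrix to that of the identity,
  whose terms are diagonal with a probabilistic meaning.\<close>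

lemma dominated_by_dyson_term:
  assumes x: "form_bounded C x"
  shows "0 \<le> t \<Longrightarrow> dominated_by C (dyson_term k x t) (dyson_term k idm t)"
proof (induction k arbitrary: t)
  case 0
  show ?case
    using form_bounded_le[OF x] unfolding dominated_by_def dyson_term.simps form_P form_idm nrm_sq by simp
next
  case (Suc k)
  show ?case unfolding dominated_by_def
  proof (intro allI)
    fix N v u
    let ?f = "\<lambda>s. form N (jump (dyson_term k x s)) (P (t - s) v) (P (t - s) u)"
    let ?h = "\<lambda>w s. form N (jump (dyson_term k idm s)) (P (t - s) w) (P (t - s) w)"
    let ?g = "\<lambda>s. C / 2 * (Re (?h v s) + Re (?h u s))"
    have h: "((\<lambda>s. Re (?h w s)) has_integral Re (form N (dyson_term (Suc k) idm t) w w)) {0..t}" for w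
      using has_integral_linear[OF form_dyson_term_Suc[of N k idm t w w] bounded_linear_Re] by (simp add: o_def)
    have g: "(?g has_integral C / 2 * (Re (form N (dyson_term (Suc k) idm t) v v) + Re (form N (dyson_term (Suc k) idm t) u u))) {0..t}"
      by (intro has_integral_mult_right has_integral_add h)
    note f = form_dyson_term_Suc[of N k x t v u]
    have "norm (integral {0..t} ?f) \<le> integral {0..t} ?g"
    proof (rule integral_norm_bound_integral)
      show "?f integrable_on {0..t}" "?g integrable_on {0..t}" using f g by blast+
      fix s assume s: "s \<in> {0..t}"
      have "dominated_by C (jump (dyson_term k x s)) (jump (dyson_term k idm s))"
        using s by (intro dominated_by_jump Suc.IH) auto
      then show "norm (?f s) \<le> ?g s" unfolding dominated_by_def by blast
    qed
    then show "cmod (form N (dyson_term (Suc k) x t) v u) \<le> C / 2 * (Re (form N (dyson_term (Suc k) idm t) v v) + Re (form N (dyson_term (Suc k) idm t) u u))"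
      unfolding integral_unique[OF f] integral_unique[OF g] .
  qed
qed

lemma form_pos_idm: "form_pos idm"
  unfolding form_pos_def form_idm by (auto intro: sum_nonneg)

section \<open>The birth-death chain on the main diagonal\<close>

text \<open>The probability of exactly \<open>k\<close> jumps up to time \<open>t\<close> for the
  chain started at \<open>n\<close> with birth rate \<open>lam^2 * om (n + 1)\<close> and death rate
  \<open>mu^2 * om n\<close>.\<close>

definition surv :: "nat \<Rightarrow> real \<Rightarrow> nat \<Rightarrow> real" where
  "surv k t n = Re (dyson_term k idm t n n)"

lemma surv_nonneg: "0 \<le> t \<Longrightarrow> 0 \<le> surv k t n"
  unfolding surv_def using form_pos_diag(2)[OF form_pos_dyson_term[OF form_pos_idm]] .

lemma dyson_term_idm: "0 \<le> t \<Longrightarrow> dyson_term k idm t n m = (if n = m then of_real (surv k t n) else 0)"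
proof (cases "n = m")
  case True
  assume "0 \<le> t"
  then show ?thesis using True form_pos_diag(1)[OF form_pos_dyson_term[OF form_pos_idm]]
    by (simp add: surv_def complex_eq_iff)
next
  case False
  assume t: "0 \<le> t"
  have "n \<noteq> m \<Longrightarrow> 0 \<le> t \<Longrightarrow> dyson_term k idm t n m = 0" for n m t
  proof (induction k arbitrary: t n m)
    case 0 then show ?case by (simp add: idm_def)
  next
    case (Suc k)
    have "jump (dyson_term k idm s) n m = 0" if "s \<in> {0..t}" for s
    proof (cases "n = 0 \<or> m = 0")
      case True then show ?thesis using Suc.prems Suc.IH[of "Suc n" "Suc m" s] that by (auto simp: jump_def)
    next
      case False
      then have "n - 1 \<noteq> m - 1" using Suc.prems by auto
      then show ?thesis
        using Suc.prems Suc.IH[of "Suc n" "Suc m" s] Suc.IH[of "n - 1" "m - 1" s] that by (simp add: jump_def)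
    qed
    then have "integral {0..t} (\<lambda>s. exp (of_real (t - s) * drift n m) * jump (dyson_term k idm s) n m) = integral {0..t} (\<lambda>s. 0)"
      by (intro integral_cong) simp
    then show ?case by (simp add: dyson_term.simps)
  qed
  then show ?thesis using False t by simp
qed

lemma form_dyson_term_idm: "0 \<le> t \<Longrightarrow> Re (form N (dyson_term k idm t) v v) = (\<Sum>n<N. (cmod (v n))\<^sup>2 * surv k t n)"
proof -
  assume t: "0 \<le> t"
  have "form N (dyson_term k idm t) v v = (\<Sum>n<N. \<Sum>m<N. if m = n then of_real (surv k t n) * (v n * cnj (v n)) else 0)"
    unfolding form_def dyson_term_idm[OF t] by (intro sum.cong refl) (auto simp: mult_ac)
  also have "\<dots> = (\<Sum>n<N. of_real (surv k t n) * (v n * cnj (v n)))"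
    by (intro sum.cong refl) (simp add: sum.delta)
  also have "\<dots> = of_real (\<Sum>n<N. (cmod (v n))\<^sup>2 * surv k t n)"
    by (simp only: of_real_sum of_real_mult complex_norm_square mult.commute)
  finally show ?thesis by (simp only: Re_complex_of_real)
qed

lemma surv_0: "surv 0 t n = exp (- (t * (lam\<^sup>2 * om (Suc n) + mu\<^sup>2 * om n)))"
proof -
  have "dyson_term 0 idm t n n = of_real (exp (- (t * (lam\<^sup>2 * om (Suc n) + mu\<^sup>2 * om n))))"
    unfolding dyson_term.simps drift_diag of_real_mult[symmetric] exp_of_real by (simp add: idm_def algebra_simps)
  then show ?thesis unfolding surv_def by (simp only: Re_complex_of_real)
qed

lemma surv_Suc:
  "((\<lambda>s. exp (- ((t - s) * (lam\<^sup>2 * om (Suc n) + mu\<^sup>2 * om n))) *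
      (mu\<^sup>2 * om n * surv k s (n - 1) + lam\<^sup>2 * om (Suc n) * surv k s (Suc n))) has_integral surv (Suc k) t n) {0..t}"
proof -
  let ?c = "lam\<^sup>2 * om (Suc n) + mu\<^sup>2 * om n"
  have "((\<lambda>s. Re (exp (of_real (t - s) * drift n n) * jump (dyson_term k idm s) n n)) has_integral surv (Suc k) t n) {0..t}"
    unfolding surv_def
    using has_integral_linear[OF dyson_term_Suc_has_integral[of t n n k idm] bounded_linear_Re] by (simp add: o_def)
  then show ?thesis
  proof (rule has_integral_eq[rotated])
    fix s assume "s \<in> {0..t}"
    then have s: "0 \<le> s" by simp
    have 1: "exp (of_real (t - s) * drift n n) = of_real (exp (- ((t - s) * ?c)))"
      unfolding drift_diag of_real_mult[symmetric] exp_of_real by (simp add: algebra_simps)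
    have 2: "jump (dyson_term k idm s) n n = of_real (mu\<^sup>2 * om n * surv k s (n - 1) + lam\<^sup>2 * om (Suc n) * surv k s (Suc n))"
    proof -
      have sq: "sqrt (om i * om i) = om i" for i using om_nonneg[of i] by simp
      show ?thesis unfolding jump_def dyson_term_idm[OF s] sq by simp
    qed
    show "Re (exp (of_real (t - s) * drift n n) * jump (dyson_term k idm s) n n) =
       exp (- ((t - s) * ?c)) * (mu\<^sup>2 * om n * surv k s (n - 1) + lam\<^sup>2 * om (Suc n) * surv k s (Suc n))"
      unfolding 1 2 by (simp only: Re_complex_of_real of_real_mult[symmetric])
  qed
qed

lemma has_integral_exp_decay:
  fixes c :: real
  assumes "0 \<le> t"
  shows "((\<lambda>s. exp (- ((t - s) * c)) * c) has_integral 1 - exp (- (t * c))) {0..t}"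
proof -
  have "((\<lambda>s. exp (- ((t - s) * c)) * c) has_integral exp (- ((t - t) * c)) - exp (- ((t - 0) * c))) {0..t}"
    by (rule fundamental_theorem_of_calculus[OF assms])
      (auto intro!: derivative_eq_intros simp flip: has_real_derivative_iff_has_vector_derivative)
  then show ?thesis by simp
qed

text \<open>Conditioning on the first jump: no jump has probability \<open>exp (- t c)\<close> with
  \<open>c\<close> the total rate, and after a jump the remaining probabilities sum to at most 1 by
  induction, so the rest is at most the probability that a jump occurs.\<close>

lemma sum_surv_le: "0 \<le> t \<Longrightarrow> (\<Sum>k<K. surv k t n) \<le> 1"
proof (induction K arbitrary: t n)
  case 0 show ?case by simp
next
  case (Suc K)
  let ?c = "lam\<^sup>2 * om (Suc n) + mu\<^sup>2 * om n"
  let ?q = "\<lambda>s n. \<Sum>k<K. surv k s n"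
  have "((\<lambda>s. \<Sum>k<K. exp (- ((t - s) * ?c)) * (mu\<^sup>2 * om n * surv k s (n - 1) + lam\<^sup>2 * om (Suc n) * surv k s (Suc n)))
      has_integral (\<Sum>k<K. surv (Suc k) t n)) {0..t}"
    by (intro has_integral_sum finite_lessThan surv_Suc)
  then have "((\<lambda>s. exp (- ((t - s) * ?c)) * (mu\<^sup>2 * om n * ?q s (n - 1) + lam\<^sup>2 * om (Suc n) * ?q s (Suc n)))
      has_integral (\<Sum>k<K. surv (Suc k) t n)) {0..t}"
    by (simp only: sum_distrib_left sum.distrib distrib_left)
  then have "(\<Sum>k<K. surv (Suc k) t n) \<le> 1 - exp (- (t * ?c))"
  proof (rule has_integral_le[OF _ has_integral_exp_decay[OF Suc.prems]])
    fix s assume s: "s \<in> {0..t}"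
    have "mu\<^sup>2 * om n * ?q s (n - 1) \<le> mu\<^sup>2 * om n * 1" "lam\<^sup>2 * om (Suc n) * ?q s (Suc n) \<le> lam\<^sup>2 * om (Suc n) * 1"
      using s by (intro mult_left_mono Suc.IH; simp)+
    then show "exp (- ((t - s) * ?c)) * (mu\<^sup>2 * om n * ?q s (n - 1) + lam\<^sup>2 * om (Suc n) * ?q s (Suc n))
        \<le> exp (- ((t - s) * ?c)) * ?c"
      by (intro mult_left_mono) auto
  qed
  then show ?case unfolding sum.lessThan_Suc_shift surv_0 by simp
qed

lemma summable_surv: "0 \<le> t \<Longrightarrow> summable (\<lambda>k. surv k t n)"
  using summableI_nonneg_bounded[of "\<lambda>k. surv k t n", OF surv_nonneg sum_surv_le] by simp

lemma dyson_term_bound: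
  assumes x: "form_bounded C x" and t: "0 \<le> t"
  shows "cmod (dyson_term k x t n m) \<le> C / 2 * (surv k t n + surv k t m)"
proof -
  define N where "N = Suc (max n m)"
  have N: "n < N" "m < N" by (auto simp: N_def)
  show ?thesis
    using dominated_by_dyson_term[OF x t, of k] form_unitv[OF N] form_unitv[OF N(1) N(1)] form_unitv[OF N(2) N(2)]
    unfolding dominated_by_def surv_def by metis
qed

lemma summable_dyson_term:
  assumes x: "form_bounded C x" and t: "0 \<le> t"
  shows "summable (\<lambda>k. dyson_term k x t n m)"
  by (rule summable_comparison_test'[where N=0, OF _ dyson_term_bound[OF x t]])
    (intro summable_mult summable_add summable_surv t)

section \<open>The sum of the series\<close>

definition Dyson :: "real \<Rightarrow> mat \<Rightarrow> mat" where
  "Dyson t x = (\<lambda>n m. \<Sum>k. dyson_term k x t n m)"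

lemma Dyson_lim:
  assumes "form_bounded C x" "0 \<le> t"
  shows "(\<lambda>K. \<Sum>k<K. dyson_term k x t n m) \<longlonglongrightarrow> Dyson t x n m"
  unfolding Dyson_def by (intro summable_LIMSEQ summable_dyson_term[OF assms])

lemma partial_bound:
  assumes x: "form_bounded C x" and t: "0 \<le> t"
  shows "cmod (\<Sum>k<K. dyson_term k x t n m) \<le> C"
proof -
  have C: "0 \<le> C" using x by (simp add: form_bounded_def)
  have "cmod (\<Sum>k<K. dyson_term k x t n m) \<le> (\<Sum>k<K. C / 2 * (surv k t n + surv k t m))"
    by (intro sum_norm_le dyson_term_bound x t)
  also have "\<dots> = C / 2 * ((\<Sum>k<K. surv k t n) + (\<Sum>k<K. surv k t m))"
    by (simp only: sum_distrib_left[symmetric] sum.distrib)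
  also have "\<dots> \<le> C / 2 * (1 + 1)"
    using C by (intro mult_left_mono add_mono sum_surv_le t) auto
  finally show ?thesis by simp
qed

lemma form_lim:
  assumes "\<And>n m. (\<lambda>K. X K n m) \<longlonglongrightarrow> Y n m"
  shows "(\<lambda>K. form N (X K) v u) \<longlonglongrightarrow> form N Y v u"
  unfolding form_def by (intro tendsto_sum tendsto_mult tendsto_const assms)

lemma form_Dyson_lim:
  assumes "form_bounded C x" "0 \<le> t"
  shows "(\<lambda>K. \<Sum>k<K. form N (dyson_term k x t) v u) \<longlonglongrightarrow> form N (Dyson t x) v u"
  using form_lim[of "\<lambda>K n m. \<Sum>k<K. dyson_term k x t n m", OF Dyson_lim[OF assms]]
  by (simp only: form_sum)

text \<open>The constant does not grow, because the dominating form is diagonal with weights whose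
  partial sums stay below 1. This contractivity is what minimality later transfers to
  \<open>S\<close>.\<close>

lemma form_bounded_Dyson:
  assumes x: "form_bounded C x" and t: "0 \<le> t"
  shows "form_bounded C (Dyson t x)"
proof (rule form_boundedI)
  show C: "0 \<le> C" using x by (simp add: form_bounded_def)
  fix N v u
  have w: "(\<Sum>k<K. Re (form N (dyson_term k idm t) w w)) \<le> (nrm N w)\<^sup>2" for K w
  proof -
    have "(\<Sum>k<K. Re (form N (dyson_term k idm t) w w)) = (\<Sum>n<N. (cmod (w n))\<^sup>2 * (\<Sum>k<K. surv k t n))"
      unfolding form_dyson_term_idm[OF t] by (subst sum.swap) (simp only: sum_distrib_left)
    also have "\<dots> \<le> (\<Sum>n<N. (cmod (w n))\<^sup>2 * 1)"
      by (intro sum_mono mult_left_mono sum_surv_le t) auto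
    finally show ?thesis by (simp add: nrm_sq)
  qed
  have "cmod (\<Sum>k<K. form N (dyson_term k x t) v u) \<le> C / 2 * ((nrm N v)\<^sup>2 + (nrm N u)\<^sup>2)" for K
  proof -
    have "cmod (\<Sum>k<K. form N (dyson_term k x t) v u) \<le>
      (\<Sum>k<K. C / 2 * (Re (form N (dyson_term k idm t) v v) + Re (form N (dyson_term k idm t) u u)))"
      using dominated_by_dyson_term[OF x t] unfolding dominated_by_def by (intro sum_norm_le) blast
    also have "\<dots> = C / 2 * ((\<Sum>k<K. Re (form N (dyson_term k idm t) v v)) + (\<Sum>k<K. Re (form N (dyson_term k idm t) u u)))"
      by (simp only: sum_distrib_left[symmetric] sum.distrib)
    also have "\<dots> \<le> C / 2 * ((nrm N v)\<^sup>2 + (nrm N u)\<^sup>2)"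
      using C by (intro mult_left_mono add_mono w) auto
    finally show ?thesis .
  qed
  then show "cmod (form N (Dyson t x) v u) \<le> C / 2 * ((nrm N v)\<^sup>2 + (nrm N u)\<^sup>2)"
    using LIMSEQ_le_const2[OF tendsto_norm[OF form_Dyson_lim[OF x t]]] by blast
qed

lemma form_pos_Dyson:
  assumes x: "form_bounded C x" "form_pos x" and t: "0 \<le> t"
  shows "form_pos (Dyson t x)"
  unfolding form_pos_def
proof (intro allI conjI)
  fix N u
  note lim = form_Dyson_lim[OF x(1) t, of N u u]
  note pos = form_pos_dyson_term[OF x(2) t, unfolded form_pos_def]
  have "(\<lambda>K. 0) \<longlonglongrightarrow> Im (form N (Dyson t x) u u)"
    using tendsto_Im[OF lim] pos by simp
  then show "Im (form N (Dyson t x) u u) = 0"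
    using LIMSEQ_unique tendsto_const by blast
  show "0 \<le> Re (form N (Dyson t x) u u)"
    by (rule LIMSEQ_le_const[OF tendsto_Re[OF lim]]) (use pos in \<open>auto intro!: sum_nonneg\<close>)
qed

section \<open>The integral equation on matrix entries\<close>

text \<open>The equation of the semigroup tested on basis vectors: free of domains and of infinite
  sums. Together with bounded entries it is all that the energy estimates use about a
  solution.\<close>

definition entry_eq :: "(real \<Rightarrow> mat) \<Rightarrow> mat \<Rightarrow> bool" where
  "entry_eq y x \<longleftrightarrow> (\<forall>t\<ge>0. \<forall>n m. ((\<lambda>s. exp (of_real (t - s) * drift n m) * jump (y s) n m) has_integral
      (y t n m - exp (of_real t * drift n m) * x n m)) {0..t})"

text \<open>Multiplying by the inverse exponential undoes the convolution. The integrability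
  obtained here is the source of continuity of \<open>y\<close>, which the equation does not
  include.\<close>

lemma entry_eq_duhamel:
  assumes "entry_eq y x" and t: "0 \<le> t"
  shows "(\<lambda>s. exp (- (of_real s * drift n m)) * jump (y s) n m) integrable_on {0..t}" (is "?f integrable_on _")
    and "y t n m = exp (of_real t * drift n m) *
       (x n m + integral {0..t} (\<lambda>s. exp (- (of_real s * drift n m)) * jump (y s) n m))"
proof -
  have hi: "((\<lambda>s. exp (of_real t * drift n m) * ?f s) has_integral
      (y t n m - exp (of_real t * drift n m) * x n m)) {0..t}"
    using assms unfolding entry_eq_def exp_diff_split by (simp add: mult.assoc)
  have "((\<lambda>s. exp (- (of_real t * drift n m)) * (exp (of_real t * drift n m) * ?f s)) has_integral
      (exp (- (of_real t * drift n m)) * (y t n m - exp (of_real t * drift n m) * x n m))) {0..t}"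
    by (intro has_integral_mult_right hi)
  then have hf: "(?f has_integral (exp (- (of_real t * drift n m)) * y t n m - x n m)) {0..t}"
    by (simp add: right_diff_distrib exp_minus flip: mult.assoc)
  then show "?f integrable_on {0..t}" by blast
  show "y t n m = exp (of_real t * drift n m) * (x n m + integral {0..t} ?f)"
    using integral_unique[OF hf] by (simp add: exp_minus algebra_simps)
qed

lemma entry_eq_continuous:
  assumes "entry_eq y x"
  shows "continuous_on {0..b} (\<lambda>t. y t n m)"
proof (cases "0 \<le> b")
  case True
  have "continuous_on {0..b} (\<lambda>t. exp (of_real t * drift n m) *
      (x n m + integral {0..t} (\<lambda>s. exp (- (of_real s * drift n m)) * jump (y s) n m)))"
    by (intro continuous_intros indefinite_integral_continuous_1 entry_eq_duhamel(1)[OF assms True])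
  then show ?thesis by (rule continuous_on_eq) (simp add: entry_eq_duhamel(2)[OF assms])
qed simp

text \<open>Partial sums satisfy the equation up to an index shift. They are bounded by
  \<open>C\<close> uniformly in their length, so the constant \<open>h\<close> dominates the
  integrands and the limit may be taken inside.\<close>

lemma entry_eq_Dyson:
  assumes x: "form_bounded C x"
  shows "entry_eq (\<lambda>t. Dyson t x) x"
  unfolding entry_eq_def
proof (intro allI impI)
  fix t :: real and n m
  assume t: "0 \<le> t"
  let ?Y = "\<lambda>K s i j. \<Sum>k<K. dyson_term k x s i j"
  let ?f = "\<lambda>K s. exp (of_real (t - s) * drift n m) * jump (?Y K s) n m"
  let ?g = "\<lambda>s. exp (of_real (t - s) * drift n m) * jump (Dyson s x) n m"
  have C: "0 \<le> C" using x by (simp add: form_bounded_def)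
  have f: "(?f K has_integral (?Y (Suc K) t n m - exp (of_real t * drift n m) * x n m)) {0..t}" for K
  proof -
    have "((\<lambda>s. \<Sum>k<K. exp (of_real (t - s) * drift n m) * jump (dyson_term k x s) n m) has_integral
       (\<Sum>k<K. dyson_term (Suc k) x t n m)) {0..t}"
      by (intro has_integral_sum finite_lessThan dyson_term_Suc_has_integral)
    then show ?thesis unfolding sum.lessThan_Suc_shift jump_sum sum_distrib_left by simp
  qed
  have lim: "(\<lambda>K. integral {0..t} (?f K)) \<longlonglongrightarrow> Dyson t x n m - exp (of_real t * drift n m) * x n m"
    unfolding integral_unique[OF f]
    by (intro tendsto_diff tendsto_const LIMSEQ_Suc Dyson_lim[OF x t])
  define h where "h = mu\<^sup>2 * sqrt (om n * om m) * C + lam\<^sup>2 * sqrt (om (Suc n) * om (Suc m)) * C"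
  have dc: "?g integrable_on {0..t} \<and> (\<lambda>K. integral {0..t} (?f K)) \<longlonglongrightarrow> integral {0..t} ?g"
  proof (rule conjI)
    note dom = dominated_convergence[of ?f "{0..t}" "\<lambda>_. h" ?g]
    have 1: "?f K integrable_on {0..t}" for K using f by blast
    have 2: "(\<lambda>_. h) integrable_on {0..t}" by (rule integrable_const_ivl)
    have 3: "norm (?f K s) \<le> h" if "s \<in> {0..t}" for K s
    proof -
      have b: "cmod (?Y K s i j) \<le> C" for i j using that by (intro partial_bound[OF x]) auto
      have "norm (?f K s) \<le> 1 * cmod (jump (?Y K s) n m)"
        unfolding norm_mult using that by (intro mult_right_mono norm_exp_le Re_drift_le) auto
      also have "\<dots> \<le> cmod (of_real (mu\<^sup>2 * sqrt (om n * om m)) * ?Y K s (n - 1) (m - 1))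
         + cmod (of_real (lam\<^sup>2 * sqrt (om (Suc n) * om (Suc m))) * ?Y K s (Suc n) (Suc m))"
        unfolding jump_def by (simp only: mult_1) (rule norm_triangle_ineq)
      also have "\<dots> \<le> h"
        unfolding h_def norm_mult norm_of_real by (intro add_mono mult_mono b) (auto simp: abs_mult)
      finally show ?thesis .
    qed
    have 4: "(\<lambda>K. ?f K s) \<longlonglongrightarrow> ?g s" if "s \<in> {0..t}" for s
      unfolding jump_def using that by (intro tendsto_mult tendsto_add tendsto_const Dyson_lim[OF x]) auto
    show "?g integrable_on {0..t}" "(\<lambda>K. integral {0..t} (?f K)) \<longlonglongrightarrow> integral {0..t} ?g"
      using dom 1 2 3 4 by blast+
  qed
  then have "integral {0..t} ?g = Dyson t x n m - exp (of_real t * drift n m) * x n m"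
    using LIMSEQ_unique[OF _ lim] by blast
  with dc show "(?g has_integral (Dyson t x n m - exp (of_real t * drift n m) * x n m)) {0..t}"
    using integrable_integral[of ?g "{0..t}"] by simp
qed

end

section \<open>The Dyson series solves the quantum dynamical equation\<close>

context qparam begin

lemma dyson_term_add:
  "dyson_term k (\<lambda>i j. x i j + y i j) t n m = dyson_term k x t n m + dyson_term k y t n m"
proof (induction k arbitrary: t n m)
  case 0 show ?case by (simp add: distrib_left)
next
  case (Suc k)
  have "((\<lambda>s. exp (of_real (t - s) * drift n m) * jump (dyson_term k (\<lambda>i j. x i j + y i j) s) n m) has_integral
      (dyson_term (Suc k) x t n m + dyson_term (Suc k) y t n m)) {0..t}"
    using has_integral_add[OF dyson_term_Suc_has_integral[of t n m k x] dyson_term_Suc_has_integral[of t n m k y]]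
    by (simp add: jump_def Suc algebra_simps)
  then show ?case using dyson_term_Suc_has_integral has_integral_unique by blast
qed

lemma dyson_term_cmult: "dyson_term k (\<lambda>i j. c * x i j) t n m = c * dyson_term k x t n m"
proof (induction k arbitrary: t n m)
  case 0 show ?case by simp
next
  case (Suc k)
  have "((\<lambda>s. exp (of_real (t - s) * drift n m) * jump (dyson_term k (\<lambda>i j. c * x i j) s) n m) has_integral
      (c * dyson_term (Suc k) x t n m)) {0..t}"
    using has_integral_mult_right[OF dyson_term_Suc_has_integral[of t n m k x], of c]
    by (simp add: jump_def Suc algebra_simps)
  then show ?case using dyson_term_Suc_has_integral has_integral_unique by blast
qed

section \<open>From entries to vectors in the domain of \<open>G\<close>\<close>

text \<open>Membership in \<open>domG\<close> controls \<open>|u n|^2\<close> with the weights 1 and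
  \<open>n^4\<close>, so the quadratic \<open>omega\<close> is compared with
  \<open>1 + n^4\<close>.\<close>

lemma om_le: "om n \<le> 2 * (1 + r) * (1 + (real n) ^ 4)" "om (Suc n) \<le> 2 * (1 + r) * (1 + (real n) ^ 4)"
proof -
  have n24: "(real n)\<^sup>2 \<le> (real n) ^ 4"
  proof (cases n)
    case (Suc k) then show ?thesis by (intro power_increasing) auto
  qed simp
  have "0 \<le> real n * r" using r by simp
  moreover have "om (Suc n) \<le> (real n + 1) * ((1 + r) * (real n + 1))"
    unfolding om_Suc using r by (intro mult_left_mono) (auto simp: algebra_simps)
  moreover have "(real n + 1) * ((1 + r) * (real n + 1)) = (1 + r) * (real n + 1)\<^sup>2"
    by (simp add: power2_eq_square)
  moreover have "(1 + r) * (real n + 1)\<^sup>2 \<le> (1 + r) * (2 * (1 + (real n) ^ 4))"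
  proof (intro mult_left_mono)
    have "(real n + 1)\<^sup>2 = (real n)\<^sup>2 + 2 * real n + 1" by (simp add: power2_eq_square algebra_simps)
    moreover have "2 * real n \<le> (real n)\<^sup>2 + 1"
      using zero_le_power2[of "real n - 1"] by (simp add: power2_eq_square algebra_simps)
    moreover have "2 * (1 + (real n) ^ 4) = 2 + 2 * (real n) ^ 4" by simp
    ultimately show "(real n + 1)\<^sup>2 \<le> 2 * (1 + (real n) ^ 4)" using n24 by simp
  qed (use r in simp)
  ultimately have "om (Suc n) \<le> (1 + r) * (2 * (1 + (real n) ^ 4))" by linarith
  then show *: "om (Suc n) \<le> 2 * (1 + r) * (1 + (real n) ^ 4)" by (simp only: mult_ac)
  show "om n \<le> 2 * (1 + r) * (1 + (real n) ^ 4)"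
    using order_trans[OF om_mono *] by simp
qed

lemma domG_summable: "domG u \<Longrightarrow> summable (\<lambda>n. 2 * (1 + r) * (1 + (real n) ^ 4) * (cmod (u n))\<^sup>2)"
proof -
  assume u: "domG u"
  then have "summable (\<lambda>n. 2 * (1 + r) * ((cmod (u n))\<^sup>2 + (cmod (of_nat n ^ 2 * u n))\<^sup>2))"
    unfolding domG_def l2_def by (intro summable_mult summable_add) auto
  then show ?thesis
    by (simp add: norm_mult norm_power power_mult_distrib algebra_simps flip: power_mult)
qed

lemma l2_L1: "domG u \<Longrightarrow> l2 (L1 u)"
proof -
  assume u: "domG u"
  have "summable (\<lambda>n. om n * (cmod (u n))\<^sup>2)"
  proof (rule summable_comparison_test'[OF domG_summable[OF u], of 0])
    fix n
    have "norm (om n * (cmod (u n))\<^sup>2) = om n * (cmod (u n))\<^sup>2" by simp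
    also have "\<dots> \<le> 2 * (1 + r) * (1 + (real n) ^ 4) * (cmod (u n))\<^sup>2"
      by (intro mult_right_mono om_le) simp
    finally show "norm (om n * (cmod (u n))\<^sup>2) \<le> 2 * (1 + r) * (1 + (real n) ^ 4) * (cmod (u n))\<^sup>2" .
  qed
  then have "summable (\<lambda>n. mu\<^sup>2 * (om (Suc n) * (cmod (u (Suc n)))\<^sup>2))"
    by (intro summable_mult) (rule iffD2[OF summable_Suc_iff[of "\<lambda>n. om n * (cmod (u n))\<^sup>2"]])
  moreover have "(cmod (L1 u n))\<^sup>2 = mu\<^sup>2 * (om (Suc n) * (cmod (u (Suc n)))\<^sup>2)" for n
    by (simp add: L1op_def Bop_def norm_mult power_mult_distrib)
  ultimately show ?thesis unfolding l2_def by simp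
qed

lemma l2_L2: "domG u \<Longrightarrow> l2 (L2 u)"
proof -
  assume u: "domG u"
  have "summable (\<lambda>n. om (Suc n) * (cmod (u n))\<^sup>2)"
  proof (rule summable_comparison_test'[OF domG_summable[OF u], of 0])
    fix n
    have "norm (om (Suc n) * (cmod (u n))\<^sup>2) = om (Suc n) * (cmod (u n))\<^sup>2" by simp
    also have "\<dots> \<le> 2 * (1 + r) * (1 + (real n) ^ 4) * (cmod (u n))\<^sup>2"
      by (intro mult_right_mono om_le) simp
    finally show "norm (om (Suc n) * (cmod (u n))\<^sup>2) \<le> 2 * (1 + r) * (1 + (real n) ^ 4) * (cmod (u n))\<^sup>2" .
  qed
  then have "summable (\<lambda>n. lam\<^sup>2 * (om (Suc n) * (cmod (u n))\<^sup>2))"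
    by (intro summable_mult)
  moreover have "(cmod (L2 u (Suc n)))\<^sup>2 = lam\<^sup>2 * (om (Suc n) * (cmod (u n))\<^sup>2)" for n
    by (simp add: L2op_def Bplus_def norm_mult power_mult_distrib)
  ultimately have "summable (\<lambda>n. (cmod (L2 u (Suc n)))\<^sup>2)" by simp
  then show ?thesis unfolding l2_def by (rule iffD1[OF summable_Suc_iff])
qed

lemma norm_P_le: "0 \<le> t \<Longrightarrow> cmod (P t u n) \<le> cmod (u n)"
proof -
  assume t: "0 \<le> t"
  have "Re (gd n) \<le> 0"
  proof -
    have "0 \<le> lam\<^sup>2 / 2 * om (Suc n) + mu\<^sup>2 / 2 * om n"
      by (intro add_nonneg_nonneg mult_nonneg_nonneg) auto
    then show ?thesis unfolding Re_gd by linarith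
  qed
  then have "cmod (P t u n) \<le> 1 * cmod (u n)"
    unfolding Psg_def norm_mult by (intro mult_right_mono norm_exp_le t) auto
  then show ?thesis by simp
qed

lemma l2_mono: "l2 u \<Longrightarrow> (\<And>n. cmod (v n) \<le> cmod (u n)) \<Longrightarrow> l2 v"
  unfolding l2_def by (erule summable_comparison_test'[of _ 0]) (auto intro: power_mono)

lemma domG_P: "0 \<le> t \<Longrightarrow> domG u \<Longrightarrow> domG (P t u)"
  unfolding domG_def
  by (auto intro!: l2_mono[of u "P t u"] l2_mono[of "\<lambda>n. of_nat n ^ 2 * u n" "\<lambda>n. of_nat n ^ 2 * P t u n"]
      norm_P_le mult_left_mono simp: norm_mult)

lemma norm_L1_P_le: "0 \<le> t \<Longrightarrow> cmod (L1 (P t u) n) \<le> cmod (L1 u n)"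
  unfolding L1op_def Bop_def norm_mult by (intro mult_left_mono norm_P_le) auto

lemma norm_L2_P_le: "0 \<le> t \<Longrightarrow> cmod (L2 (P t u) n) \<le> cmod (L2 u n)"
  unfolding L2op_def Bplus_def by (auto simp: norm_mult intro!: mult_left_mono norm_P_le)

lemma P_continuous: "continuous_on A (\<lambda>s. P (t - s) u n)"
  unfolding Psg_def by (intro continuous_intros)

lemma form_continuous:
  assumes "\<And>n m. continuous_on A (\<lambda>s. y s n m)" "\<And>n. continuous_on A (\<lambda>s. v s n)" "\<And>n. continuous_on A (\<lambda>s. u s n)"
  shows "continuous_on A (\<lambda>s. form N (y s) (v s) (u s))"
  unfolding form_def by (intro continuous_intros assms)

lemma L1_P_continuous: "continuous_on A (\<lambda>s. L1 (P (t - s) u) n)"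
  unfolding L1op_def Bop_def by (intro continuous_intros P_continuous)

lemma L2_P_continuous: "continuous_on A (\<lambda>s. L2 (P (t - s) u) n)"
  unfolding L2op_def Bplus_def by (cases "n = 0") (auto intro!: continuous_intros P_continuous)

text \<open>The fixed vectors \<open>V0\<close> and \<open>U0\<close> dominate the moving ones entry
  by entry, which bounds all corner forms by one constant and allows the corner to grow under the
  time integral.\<close>

lemma form_limit_integral:
  fixes V U :: "real \<Rightarrow> vec"
  assumes y: "\<And>s. s \<in> {0..t} \<Longrightarrow> form_bounded C (y s)"
    and cont: "\<And>n m. continuous_on {0..t} (\<lambda>s. y s n m)"
    and cV: "\<And>n. continuous_on {0..t} (\<lambda>s. V s n)" and cU: "\<And>n. continuous_on {0..t} (\<lambda>s. U s n)"
    and V: "l2 V0" "\<And>s n. s \<in> {0..t} \<Longrightarrow> cmod (V s n) \<le> cmod (V0 n)"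
    and U: "l2 U0" "\<And>s n. s \<in> {0..t} \<Longrightarrow> cmod (U s n) \<le> cmod (U0 n)"
    and C: "0 \<le> C"
  shows "(\<lambda>s. ip (V s) (mat_app (y s) (U s))) integrable_on {0..t}"
    "(\<lambda>N. integral {0..t} (\<lambda>s. form N (y s) (V s) (U s))) \<longlonglongrightarrow>
       integral {0..t} (\<lambda>s. ip (V s) (mat_app (y s) (U s)))"
proof -
  let ?f = "\<lambda>N s. form N (y s) (V s) (U s)"
  let ?g = "\<lambda>s. ip (V s) (mat_app (y s) (U s))"
  note dom = dominated_convergence[of ?f "{0..t}" "\<lambda>_. C * vnorm V0 * vnorm U0" ?g]
  have 1: "?f N integrable_on {0..t}" for N
    by (intro integrable_continuous_real form_continuous cont cV cU)
  have 2: "(\<lambda>_. C * vnorm V0 * vnorm U0) integrable_on {0..t}" by (rule integrable_const_ivl)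
  have 3: "norm (?f N s) \<le> C * vnorm V0 * vnorm U0" if s: "s \<in> {0..t}" for N s
  proof -
    have "norm (?f N s) \<le> C * nrm N (V s) * nrm N (U s)" by (rule form_boundedD[OF y[OF s]])
    also have "\<dots> \<le> C * vnorm V0 * vnorm U0"
    proof (intro mult_mono order_refl)
      have "nrm N (V s) \<le> nrm N V0" by (intro L2_set_mono V(2) s) auto
      then show "nrm N (V s) \<le> vnorm V0" using nrm_le_vnorm[OF V(1), of N] by simp
      have "nrm N (U s) \<le> nrm N U0" by (intro L2_set_mono U(2) s) auto
      then show "nrm N (U s) \<le> vnorm U0" using nrm_le_vnorm[OF U(1), of N] by simp
    qed (auto intro!: mult_nonneg_nonneg C vnorm_nonneg V(1))
    finally show ?thesis .
  qed
  have 4: "(\<lambda>N. ?f N s) \<longlonglongrightarrow> ?g s" if s: "s \<in> {0..t}" for s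
    by (intro form_tendsto form_bounded_mat(4)[OF y[OF s]] l2_mono[OF V(1)] l2_mono[OF U(1)] V(2) U(2) s)
  show "?g integrable_on {0..t}" "(\<lambda>N. integral {0..t} (?f N)) \<longlonglongrightarrow> integral {0..t} ?g"
    using dom 1 2 3 4 by blast+
qed

lemma entry_eq_form:
  assumes y: "entry_eq y x" and t: "0 \<le> t"
  shows "form N (y t) v u = form N x (P t v) (P t u)
     + integral {0..t} (\<lambda>s. form (N - 1) (y s) (L1 (P (t - s) v)) (L1 (P (t - s) u)))
     + integral {0..t} (\<lambda>s. form (Suc N) (y s) (L2 (P (t - s) v)) (L2 (P (t - s) u)))"
proof -
  have "((\<lambda>s. form N (jump (y s)) (P (t - s) v) (P (t - s) u)) has_integral
      form N (\<lambda>n m. y t n m - exp (of_real t * drift n m) * x n m) v u) {0..t}"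
    using form_has_integral[of "\<lambda>n m s. exp (of_real (t - s) * drift n m) * jump (y s) n m"
        "\<lambda>n m. y t n m - exp (of_real t * drift n m) * x n m" "{0..t}" N v u] y t
    unfolding entry_eq_def form_P by blast
  moreover have "form N (\<lambda>n m. y t n m - exp (of_real t * drift n m) * x n m) v u =
     form N (y t) v u - form N x (P t v) (P t u)"
    unfolding form_P[symmetric] by (simp only: form_def left_diff_distrib right_diff_distrib sum_subtractf)
  ultimately have "form N (y t) v u - form N x (P t v) (P t u) =
      integral {0..t} (\<lambda>s. form N (jump (y s)) (P (t - s) v) (P (t - s) u))"
    by (simp add: integral_unique)
  also have "\<dots> = integral {0..t} (\<lambda>s. form (N - 1) (y s) (L1 (P (t - s) v)) (L1 (P (t - s) u)))
     + integral {0..t} (\<lambda>s. form (Suc N) (y s) (L2 (P (t - s) v)) (L2 (P (t - s) u)))"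
    unfolding form_jump
    by (intro integral_add integrable_continuous_real form_continuous entry_eq_continuous[OF y]
        L1_P_continuous L2_P_continuous)
  finally show ?thesis by (simp add: algebra_simps)
qed

text \<open>For a corner of size \<open>N\<close> the two jump terms live on corners of sizes
  \<open>N - 1\<close> and \<open>N + 1\<close>; the mismatch disappears when all three
  grow.\<close>

lemma qds_integral_eq:
  assumes y: "entry_eq y x" and yb: "\<And>s. 0 \<le> s \<Longrightarrow> form_bounded C (y s)" and x: "bounded_mat x"
    and t: "0 \<le> t" and u: "domG u" and v: "domG v"
  defines "f1 \<equiv> \<lambda>s. ip (L1 (P (t - s) v)) (mat_app (y s) (L1 (P (t - s) u)))"
    and "f2 \<equiv> \<lambda>s. ip (L2 (P (t - s) v)) (mat_app (y s) (L2 (P (t - s) u)))"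
  shows "f1 integrable_on {0..t}" "f2 integrable_on {0..t}"
    "ip v (mat_app (y t) u) = ip (P t v) (mat_app x (P t u)) + integral {0..t} f1 + integral {0..t} f2"
proof -
  have C: "0 \<le> C" using yb[of 0] by (simp add: form_bounded_def)
  have yb': "form_bounded C (y s)" if "s \<in> {0..t}" for s using yb that by auto
  have n1: "cmod (L1 (P (t - s) w) n) \<le> cmod (L1 w n)" if "s \<in> {0..t}" for s w n
    using that by (intro norm_L1_P_le) auto
  have n2: "cmod (L2 (P (t - s) w) n) \<le> cmod (L2 w n)" if "s \<in> {0..t}" for s w n
    using that by (intro norm_L2_P_le) auto
  note lim1 = form_limit_integral[OF yb' entry_eq_continuous[OF y] L1_P_continuous L1_P_continuous
      l2_L1[OF v] n1 l2_L1[OF u] n1 C]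
  note lim2 = form_limit_integral[OF yb' entry_eq_continuous[OF y] L2_P_continuous L2_P_continuous
      l2_L2[OF v] n2 l2_L2[OF u] n2 C]
  show "f1 integrable_on {0..t}" "f2 integrable_on {0..t}"
    unfolding f1_def f2_def using lim1(1) lim2(1) by blast+
  have lu: "l2 u" "l2 v" "l2 (P t u)" "l2 (P t v)"
    using u v domG_P[OF t u] domG_P[OF t v] by (auto simp: domG_def)
  have "(\<lambda>N. form N (y t) v u) \<longlonglongrightarrow> ip v (mat_app (y t) u)"
    by (intro form_tendsto form_bounded_mat(4)[OF yb] t lu)
  then have a: "(\<lambda>N. form (Suc N) (y t) v u) \<longlonglongrightarrow> ip v (mat_app (y t) u)"
    by (rule LIMSEQ_Suc)
  have "(\<lambda>N. form (Suc N) x (P t v) (P t u) +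
      integral {0..t} (\<lambda>s. form (Suc N - 1) (y s) (L1 (P (t - s) v)) (L1 (P (t - s) u)))
     + integral {0..t} (\<lambda>s. form (Suc (Suc N)) (y s) (L2 (P (t - s) v)) (L2 (P (t - s) u))))
    \<longlonglongrightarrow> ip (P t v) (mat_app x (P t u)) + integral {0..t} f1 + integral {0..t} f2"
  proof (intro tendsto_add)
    show "(\<lambda>N. form (Suc N) x (P t v) (P t u)) \<longlonglongrightarrow> ip (P t v) (mat_app x (P t u))"
      by (intro LIMSEQ_Suc form_tendsto x lu)
    show "(\<lambda>N. integral {0..t} (\<lambda>s. form (Suc N - 1) (y s) (L1 (P (t - s) v)) (L1 (P (t - s) u)))) \<longlonglongrightarrow> integral {0..t} f1"
      unfolding f1_def diff_Suc_1 by (rule lim1(2))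
    show "(\<lambda>N. integral {0..t} (\<lambda>s. form (Suc (Suc N)) (y s) (L2 (P (t - s) v)) (L2 (P (t - s) u)))) \<longlonglongrightarrow> integral {0..t} f2"
      unfolding f2_def using LIMSEQ_Suc[OF LIMSEQ_Suc[OF lim2(2)]] .
  qed
  then show "ip v (mat_app (y t) u) = ip (P t v) (mat_app x (P t u)) + integral {0..t} f1 + integral {0..t} f2"
    unfolding entry_eq_form[OF y t, of "Suc _" v u, symmetric] by (rule LIMSEQ_unique[OF a])
qed

text \<open>Makes the series an admissible competitor in the minimality condition.\<close>

lemma Dyson_qds: "qds_solution r lam mu zp zm Dyson"
  unfolding qds_solution_def Let_def
proof (intro conjI allI impI)
  fix t :: real and x assume t: "0 \<le> t" and x: "bounded_mat x"
  obtain C where C: "form_bounded C x" using bounded_mat_imp_form_bounded[OF x] .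
  show b: "bounded_mat (Dyson t x)" using form_bounded_mat(4)[OF form_bounded_Dyson[OF C t]] .
  show "Dyson t (\<lambda>i j. c * x i j) = (\<lambda>i j. c * Dyson t x i j)" for c
    unfolding Dyson_def dyson_term_cmult using suminf_mult[OF summable_dyson_term[OF C t]] by blast
  show "Dyson t (\<lambda>i j. x i j + y i j) = (\<lambda>i j. Dyson t x i j + Dyson t y i j)" if y: "bounded_mat y" for y
  proof -
    obtain C' where C': "form_bounded C' y" using bounded_mat_imp_form_bounded[OF y] .
    show ?thesis
      unfolding Dyson_def dyson_term_add using suminf_add[OF summable_dyson_term[OF C t] summable_dyson_term[OF C' t]] by simp
  qed
  show "positive_mat (Dyson t x)" if "positive_mat x"
    using that unfolding positive_mat_iff[OF x] positive_mat_iff[OF b] by (rule form_pos_Dyson[OF C _ t])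
  fix u v assume uv: "domG u" "domG v"
  note q = qds_integral_eq[OF entry_eq_Dyson[OF C] form_bounded_Dyson[OF C] x t uv]
  show "(\<lambda>s. ip (L1 (P (t - s) v)) (mat_app (Dyson s x) (L1 (P (t - s) u)))) integrable_on {0..t}"
    "(\<lambda>s. ip (L2 (P (t - s) v)) (mat_app (Dyson s x) (L2 (P (t - s) u)))) integrable_on {0..t}"
    "ip v (mat_app (Dyson t x) u) = ip (P t v) (mat_app x (P t u))
      + integral {0..t} (\<lambda>s. ip (L1 (P (t - s) v)) (mat_app (Dyson s x) (L1 (P (t - s) u))))
      + integral {0..t} (\<lambda>s. ip (L2 (P (t - s) v)) (mat_app (Dyson s x) (L2 (P (t - s) u))))"
    using q by blast+
qed

lemma form_bounded_idm: "form_bounded 1 idm"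
proof (rule form_boundedI)
  fix N v u
  have "form N idm v u = (\<Sum>n<N. cnj (v n) * u n)"
  proof -
    have "form N idm v u = (\<Sum>n<N. \<Sum>m<N. if n = m then cnj (v n) * u n else 0)"
      unfolding form_def idm_def by (intro sum.cong refl) auto
    then show ?thesis by (simp add: sum.delta')
  qed
  then have "cmod (form N idm v u) \<le> nrm N v * nrm N u" using sum_cs by simp
  also have "\<dots> \<le> 1 / 2 * ((nrm N v)\<^sup>2 + (nrm N u)\<^sup>2)"
    using sum_squares_bound[of "nrm N v" "nrm N u"] by simp
  finally show "cmod (form N idm v u) \<le> 1 / 2 * ((nrm N v)\<^sup>2 + (nrm N u)\<^sup>2)" .
qed simp

lemma Dyson_idm_le: "0 \<le> t \<Longrightarrow> Re (Dyson t idm n n) \<le> 1"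
proof -
  assume t: "0 \<le> t"
  have "cmod (\<Sum>k<K. dyson_term k idm t n n) \<le> 1" for K by (rule partial_bound[OF form_bounded_idm t])
  then have "cmod (Dyson t idm n n) \<le> 1"
    using LIMSEQ_le_const2[OF tendsto_norm[OF Dyson_lim[OF form_bounded_idm t]]] by blast
  then show ?thesis using complex_Re_le_cmod order_trans by blast
qed

lemma unitv_domG: "domG (unitv k)"
  unfolding domG_def by (auto intro!: l2_unitv l2_finite[of "Suc k"] simp: unitv_def)

lemma P_unitv: "P t (unitv m) = (\<lambda>j. exp (of_real t * gd m) * unitv m j)"
  by (auto simp: Psg_def unitv_def)

lemma L1_P_unitv:
  "L1 (P t (unitv m)) = (\<lambda>j. (of_real (mu * sqrt (om m)) * exp (of_real t * gd m)) * unitv (m - 1) j)"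
  unfolding P_unitv L1op_def Bop_def by (cases m) (auto simp: unitv_def fun_eq_iff)

lemma L2_P_unitv:
  "L2 (P t (unitv m)) = (\<lambda>j. (of_real (lam * sqrt (om (Suc m))) * exp (of_real t * gd m)) * unitv (Suc m) j)"
  unfolding P_unitv L2op_def Bplus_def by (auto simp: unitv_def fun_eq_iff)

text \<open>Basis vectors lie in the domain, and \<open>P t\<close>, \<open>L1\<close>,
  \<open>L2\<close> map each of them to a multiple of a basis vector, so every inner product
  collapses to a single entry. This applies to any solution, in particular to
  \<open>S\<close>.\<close>

lemma qds_entry_eq:
  assumes S: "qds_solution r lam mu zp zm S" and x: "bounded_mat x"
  shows "entry_eq (\<lambda>t. S t x) x"
  unfolding entry_eq_def
proof (intro allI impI)
  fix t :: real and n m assume t: "0 \<le> t"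
  let ?f1 = "\<lambda>s. ip (L1 (P (t - s) (unitv n))) (mat_app (S s x) (L1 (P (t - s) (unitv m))))"
  let ?f2 = "\<lambda>s. ip (L2 (P (t - s) (unitv n))) (mat_app (S s x) (L2 (P (t - s) (unitv m))))"
  have q: "?f1 integrable_on {0..t}" "?f2 integrable_on {0..t}"
    "ip (unitv n) (mat_app (S t x) (unitv m)) =
      ip (P t (unitv n)) (mat_app x (P t (unitv m))) + integral {0..t} ?f1 + integral {0..t} ?f2"
    using S x t unitv_domG[of n] unitv_domG[of m] unfolding qds_solution_def Let_def by blast+
  have "((\<lambda>s. ?f1 s + ?f2 s) has_integral (integral {0..t} ?f1 + integral {0..t} ?f2)) {0..t}"
    by (intro has_integral_add integrable_integral q)
  moreover have "?f1 s + ?f2 s = exp (of_real (t - s) * drift n m) * jump (S s x) n m" for s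
    unfolding L1_P_unitv L2_P_unitv ip_unitv jump_def drift_def distrib_left exp_add
    by (simp add: exp_cnj real_sqrt_mult power2_eq_square mult_ac)
  moreover have "integral {0..t} ?f1 + integral {0..t} ?f2 = S t x n m - exp (of_real t * drift n m) * x n m"
  proof -
    have "ip (unitv n) (mat_app (S t x) (unitv m)) = S t x n m"
      using ip_unitv[of 1 n "S t x" 1 m] by simp
    moreover have "ip (P t (unitv n)) (mat_app x (P t (unitv m))) = exp (of_real t * drift n m) * x n m"
      unfolding P_unitv ip_unitv drift_def distrib_left exp_add by (simp add: exp_cnj mult_ac)
    ultimately show ?thesis using q(3) unfolding eq_diff_eq by (simp add: add_ac)
  qed
  ultimately show "((\<lambda>s. exp (of_real (t - s) * drift n m) * jump (S s x) n m) has_integral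
      (S t x n m - exp (of_real t * drift n m) * x n m)) {0..t}" by simp
qed

end

section \<open>A Poincare inequality for the geometric weight\<close>

lemma sum_by_parts:
  fixes f F :: "nat \<Rightarrow> real"
  shows "(\<Sum>k\<le>N. F k * (f (Suc k) - f k)) =
     F N * f (Suc N) - F 0 * f 0 - (\<Sum>k<N. (F (Suc k) - F k) * f (Suc k))"
  by (induction N) (simp_all add: algebra_simps)

text \<open>A Hardy inequality with ground state \<open>U\<close>; the boundary term, the first one on the left, is what
makes the induction close.\<close>
lemma hardy_step:
  fixes F s \<phi> :: "nat \<Rightarrow> real"
  assumes q: "0 < q" and \<phi>: "\<And>m. 0 < \<phi> m" "\<And>m. \<phi> m = 1 / (real m + r) + q * \<phi> (Suc m)"
    and r: "0 < r" and s: "\<And>k. s k = (\<Sum>m\<le>k. \<phi> m)"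
  defines "U \<equiv> \<lambda>k. q ^ Suc k * s k"
  shows "(F N)\<^sup>2 * (U (Suc N) / U N - 1) / q ^ Suc N + (\<Sum>k\<le>N. (F k)\<^sup>2 / ((real k + r) * U k))
     \<le> (F 0)\<^sup>2 + (\<Sum>k<N. (F (Suc k) - F k)\<^sup>2 / q ^ Suc k)"
proof (induction N)
  case 0
  have "1 / (r * (q * \<phi> 0)) = 1 - (q * (\<phi> 0 + \<phi> 1) / \<phi> 0 - 1) / q"
  proof -
    have "1 - (q * (\<phi> 0 + \<phi> 1) / \<phi> 0 - 1) / q = (\<phi> 0 - q * \<phi> 1) / (q * \<phi> 0)"
      using \<phi>(1)[of 0] q by (simp add: field_simps)
    also have "\<phi> 0 - q * \<phi> 1 = 1 / r" using \<phi>(2)[of 0] by simp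
    finally show ?thesis by simp
  qed
  moreover have "U (Suc 0) / U 0 = q * (\<phi> 0 + \<phi> 1) / \<phi> 0"
    using q by (simp add: U_def s)
  moreover have "U 0 = q * \<phi> 0" by (simp add: U_def s)
  ultimately have "(U (Suc 0) / U 0 - 1) / q + 1 / (r * U 0) = 1" by simp
  moreover have "(F 0)\<^sup>2 * (U (Suc 0) / U 0 - 1) / q ^ Suc 0 + (\<Sum>k\<le>0. (F k)\<^sup>2 / ((real k + r) * U k)) =
      (F 0)\<^sup>2 * ((U (Suc 0) / U 0 - 1) / q + 1 / (r * U 0))"
    by (simp add: distrib_left)
  ultimately show ?case by simp
next
  case (Suc N)
  have spos: "0 < s k" for k unfolding s by (intro sum_pos) (auto simp: \<phi>(1))
  have Upos: "0 < U k" for k unfolding U_def using q spos by simp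
  \<comment> \<open>The difference equation of the ground state: the scaled increments of
    \<open>U\<close> drop by \<open>\<phi> (N + 1) - q * \<phi> (N + 2)\<close>, which the recursion
    for \<open>\<phi>\<close> evaluates.\<close>
  have w: "1 / (real (Suc N) + r) = (U (Suc N) - U N) / q ^ Suc N - (U (Suc (Suc N)) - U (Suc N)) / q ^ Suc (Suc N)"
  proof -
    have "(U (Suc N) - U N) / q ^ Suc N = q * s (Suc N) - s N" using q by (simp add: U_def field_simps)
    moreover have "(U (Suc (Suc N)) - U (Suc N)) / q ^ Suc (Suc N) = q * s (Suc (Suc N)) - s (Suc N)"
      using q by (simp add: U_def field_simps)
    moreover have "s (Suc N) = s N + \<phi> (Suc N)" "s (Suc (Suc N)) = s (Suc N) + \<phi> (Suc (Suc N))"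
      by (simp_all add: s)
    moreover have "q * s (Suc (Suc N)) = q * s (Suc N) + q * \<phi> (Suc (Suc N))"
      using calculation(4) by (simp add: algebra_simps)
    ultimately show ?thesis using \<phi>(2)[of "Suc N"] by (simp add: algebra_simps)
  qed
  let ?a = "F N" and ?b = "F (Suc N)" and ?Q = "q ^ Suc N"
  have Q: "0 < ?Q" using q by simp
  \<comment> \<open>Ground state substitution: the square vanishes exactly when the two values of
    \<open>F\<close> are proportional to those of \<open>U\<close>.\<close>
  have "0 \<le> (?a * U (Suc N) - ?b * U N)\<^sup>2 / (U N * U (Suc N))"
    using Upos by (simp add: less_imp_le)
  also have "(?a * U (Suc N) - ?b * U N)\<^sup>2 / (U N * U (Suc N)) =
      ?a\<^sup>2 * (U (Suc N) / U N) + ?b\<^sup>2 * (U N / U (Suc N)) - 2 * ?a * ?b"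
    using Upos[of N] Upos[of "Suc N"] by (simp add: field_simps power2_eq_square)
  finally have A: "0 \<le> (?a\<^sup>2 * (U (Suc N) / U N) + ?b\<^sup>2 * (U N / U (Suc N)) - 2 * ?a * ?b) / ?Q"
    using Q by simp
  have "?b\<^sup>2 / ((real (Suc N) + r) * U (Suc N)) = ?b\<^sup>2 * (1 / (real (Suc N) + r)) / U (Suc N)" by simp
  also have "\<dots> = ?b\<^sup>2 * ((U (Suc N) - U N) / ?Q / U (Suc N) - (U (Suc (Suc N)) - U (Suc N)) / q ^ Suc (Suc N) / U (Suc N))"
    unfolding w by (simp only: diff_divide_distrib right_diff_distrib times_divide_eq_right)
  also have "(U (Suc N) - U N) / ?Q / U (Suc N) = (1 - U N / U (Suc N)) / ?Q"
    using Upos[of "Suc N"] Q by (simp add: field_simps)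
  also have "(U (Suc (Suc N)) - U (Suc N)) / q ^ Suc (Suc N) / U (Suc N) = (U (Suc (Suc N)) / U (Suc N) - 1) / q ^ Suc (Suc N)"
    using Upos[of "Suc N"] q by (simp add: field_simps)
  finally have B: "?b\<^sup>2 / ((real (Suc N) + r) * U (Suc N)) =
      ?b\<^sup>2 * (1 - U N / U (Suc N)) / ?Q - ?b\<^sup>2 * (U (Suc (Suc N)) / U (Suc N) - 1) / q ^ Suc (Suc N)"
    by (simp only: right_diff_distrib times_divide_eq_right)
  have "(?a\<^sup>2 * (U (Suc N) / U N) + ?b\<^sup>2 * (U N / U (Suc N)) - 2 * ?a * ?b) / ?Q =
      (?b - ?a)\<^sup>2 / ?Q + ?a\<^sup>2 * (U (Suc N) / U N - 1) / ?Q - ?b\<^sup>2 * (1 - U N / U (Suc N)) / ?Q"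
    unfolding add_divide_distrib[symmetric] diff_divide_distrib[symmetric]
    by (simp add: algebra_simps power2_eq_square)
  with A have "?b\<^sup>2 * (1 - U N / U (Suc N)) / ?Q \<le> (?b - ?a)\<^sup>2 / ?Q + ?a\<^sup>2 * (U (Suc N) / U N - 1) / ?Q"
    by linarith
  then show ?case
    unfolding sum.atMost_Suc sum.lessThan_Suc B using Suc.IH by linarith
qed

text \<open>A duality argument. With \<open>F\<close> the negative cumulative sums of the centred
  function, the variance \<open>V\<close> equals the pairing of \<open>F\<close> with the increments
  of \<open>f\<close>, while the Hardy inequality bounds the sum of \<open>F^2 / \<theta>\<close> by
  the same \<open>V\<close>. The arithmetic-geometric inequality then leaves only the weighted
  increments.\<close>

lemma poincare_real:
  fixes f \<phi> s \<theta> :: "nat \<Rightarrow> real"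
  assumes q: "0 < q" "q < 1"
    and \<phi>: "\<And>m. 0 < \<phi> m" "\<And>m. \<phi> m = 1 / (real m + r) + q * \<phi> (Suc m)"
    and r: "0 < r" and s: "\<And>k. s k = (\<Sum>m\<le>k. \<phi> m)"
    and \<theta>: "\<And>k. (real k + r) * (q ^ Suc k * s k) \<le> \<theta> k"
    and f: "f (Suc N) = 0"
  shows "(\<Sum>k\<le>N. q ^ k * (f k)\<^sup>2) - (1 - q) * (\<Sum>k\<le>N. q ^ k * f k)\<^sup>2
     \<le> (\<Sum>k\<le>N. \<theta> k * (f (Suc k) - f k)\<^sup>2)"
proof -
  \<comment> \<open>The mean for the geometric law \<open>(1 - q) q^k\<close>, with \<open>f\<close>
    read as 0 beyond \<open>N\<close>.\<close>
  define m where "m = (1 - q) * (\<Sum>k\<le>N. q ^ k * f k)"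
  define F where "F k = - (\<Sum>j\<le>k. q ^ j * (f j - m))" for k
  let ?U = "\<lambda>k. q ^ Suc k * s k"
  have spos: "0 < s k" for k unfolding s by (intro sum_pos) (auto simp: \<phi>(1))
  have Upos: "0 < ?U k" for k using q spos by simp
  have wpos: "0 < (real k + r) * ?U k" for k
    using r q spos[of k] by (intro mult_pos_pos add_nonneg_pos) auto
  have tpos: "0 < \<theta> k" for k using wpos[of k] \<theta>[of k] by linarith
  have geo: "(\<Sum>j\<le>k. q ^ j) * (1 - q) = 1 - q ^ Suc k" for k
    using sum_gp_basic[of q k] by (simp add: mult.commute)
  have FN: "F N * (1 - q) = - (m * q ^ Suc N)"
  proof -
    have "F N * (1 - q) = m * ((\<Sum>j\<le>N. q ^ j) * (1 - q)) - (1 - q) * (\<Sum>k\<le>N. q ^ k * f k)"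
    proof -
      have "F N = m * (\<Sum>j\<le>N. q ^ j) - (\<Sum>k\<le>N. q ^ k * f k)"
        by (simp add: F_def right_diff_distrib sum_subtractf sum_distrib_left mult.commute)
      moreover have "(m * G - H) * (1 - q) = m * (G * (1 - q)) - (1 - q) * H" for G H :: real
        by (simp add: algebra_simps)
      ultimately show ?thesis by simp
    qed
    then show ?thesis unfolding geo m_def[symmetric] by (simp add: algebra_simps)
  qed
  have dF: "F (Suc k) - F k = - (q ^ Suc k * (f (Suc k) - m))" for k by (simp add: F_def)
  \<comment> \<open>The last summand is the contribution of all indices beyond \<open>N\<close>,
    where the centred function is \<open>- m\<close>.\<close>
  define V where "V = (\<Sum>k\<le>N. q ^ k * (f k - m)\<^sup>2) + m\<^sup>2 * q ^ Suc N / (1 - q)"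
  have V1: "V = (\<Sum>k\<le>N. q ^ k * (f k)\<^sup>2) - (1 - q) * (\<Sum>k\<le>N. q ^ k * f k)\<^sup>2"
  proof -
    have "(\<Sum>k\<le>N. q ^ k * (f k - m)\<^sup>2) =
       (\<Sum>k\<le>N. q ^ k * (f k)\<^sup>2) - 2 * m * (\<Sum>k\<le>N. q ^ k * f k) + m\<^sup>2 * (\<Sum>k\<le>N. q ^ k)"
      by (simp add: sum_distrib_left sum.distrib[symmetric] sum_subtractf[symmetric] power2_eq_square algebra_simps)
    moreover have "m\<^sup>2 * (\<Sum>k\<le>N. q ^ k) + m\<^sup>2 * q ^ Suc N / (1 - q) = m * (\<Sum>k\<le>N. q ^ k * f k)"
    proof -
      have "(\<Sum>k\<le>N. q ^ k) = (1 - q ^ Suc N) / (1 - q)" using geo[of N] q by (simp add: field_simps)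
      then have "m\<^sup>2 * (\<Sum>k\<le>N. q ^ k) + m\<^sup>2 * q ^ Suc N / (1 - q) = m\<^sup>2 / (1 - q)"
        by (simp only: times_divide_eq_right add_divide_distrib[symmetric]) (simp add: right_diff_distrib)
      also have "\<dots> = m * (m / (1 - q))" by (simp add: power2_eq_square)
      also have "m / (1 - q) = (\<Sum>k\<le>N. q ^ k * f k)" using q by (simp add: m_def)
      finally show ?thesis .
    qed
    moreover have "(1 - q) * (\<Sum>k\<le>N. q ^ k * f k)\<^sup>2 = m * (\<Sum>k\<le>N. q ^ k * f k)"
      by (simp add: m_def power2_eq_square)
    ultimately show ?thesis unfolding V_def by linarith
  qed
  have V2: "V = (\<Sum>k\<le>N. F k * (f (Suc k) - f k))"
  proof -
    have "(\<Sum>k\<le>N. F k * (f (Suc k) - f k)) = (\<Sum>k\<le>N. F k * ((f (Suc k) - m) - (f k - m)))" by simp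
    also have "\<dots> = F N * (f (Suc N) - m) - F 0 * (f 0 - m) - (\<Sum>k<N. (F (Suc k) - F k) * (f (Suc k) - m))"
      by (rule sum_by_parts)
    also have "\<dots> = - m * F N + ((f 0 - m)\<^sup>2 + (\<Sum>k<N. q ^ Suc k * (f (Suc k) - m)\<^sup>2))"
    proof -
      have "F 0 * (f 0 - m) = - ((f 0 - m)\<^sup>2)" by (simp add: F_def power2_eq_square algebra_simps)
      then show ?thesis unfolding dF f by (simp add: power2_eq_square sum_negf mult.assoc)
    qed
    also have "(f 0 - m)\<^sup>2 + (\<Sum>k<N. q ^ Suc k * (f (Suc k) - m)\<^sup>2) = (\<Sum>k\<le>N. q ^ k * (f k - m)\<^sup>2)"
      unfolding lessThan_Suc_atMost[symmetric] sum.lessThan_Suc_shift by simp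
    also have "- m * F N = m\<^sup>2 * q ^ Suc N / (1 - q)"
    proof -
      have "F N = - (m * q ^ Suc N) / (1 - q)" using FN q by (simp add: field_simps)
      then show ?thesis by (simp add: power2_eq_square)
    qed
    finally show ?thesis unfolding V_def by simp
  qed
  have H: "(\<Sum>k\<le>N. (F k)\<^sup>2 / \<theta> k) \<le> V"
  proof -
    have "(\<Sum>k\<le>N. (F k)\<^sup>2 / \<theta> k) \<le> (\<Sum>k\<le>N. (F k)\<^sup>2 / ((real k + r) * ?U k))"
      by (intro sum_mono divide_left_mono \<theta> mult_pos_pos tpos wpos) auto
    also have "\<dots> \<le> (F 0)\<^sup>2 + (\<Sum>k<N. (F (Suc k) - F k)\<^sup>2 / q ^ Suc k) - (F N)\<^sup>2 * (?U (Suc N) / ?U N - 1) / q ^ Suc N"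
      using hardy_step[OF q(1) \<phi> r s, of F N] by linarith
    \<comment> \<open>Since \<open>s\<close> increases, \<open>U (N + 1) / U N\<close> is at least
      \<open>q\<close>; the boundary term of the Hardy inequality therefore costs no more than the
      tail summand of \<open>V\<close>.\<close>
    also have "\<dots> \<le> (F 0)\<^sup>2 + (\<Sum>k<N. (F (Suc k) - F k)\<^sup>2 / q ^ Suc k) + (F N)\<^sup>2 * (1 - q) / q ^ Suc N"
    proof -
      have "?U (Suc N) / ?U N = q * (s (Suc N) / s N)" using q by simp
      moreover have "1 \<le> s (Suc N) / s N" using spos[of N] \<phi>(1)[of "Suc N"] by (simp add: s)
      ultimately have "- (?U (Suc N) / ?U N - 1) \<le> 1 - q"
        using q mult_left_mono[of 1 "s (Suc N) / s N" q] by simp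
      then have "(F N)\<^sup>2 * (- (?U (Suc N) / ?U N - 1)) / q ^ Suc N \<le> (F N)\<^sup>2 * (1 - q) / q ^ Suc N"
        using q by (intro divide_right_mono mult_left_mono) auto
      then show ?thesis by (simp only: mult_minus_right minus_divide_left[symmetric])
    qed
    also have "\<dots> = V"
    proof -
      have "(F N)\<^sup>2 * (1 - q) / q ^ Suc N = m\<^sup>2 * q ^ Suc N / (1 - q)"
      proof -
        have "F N = - (m * q ^ Suc N) / (1 - q)" using FN q by (simp add: field_simps)
        then show ?thesis using q by (simp add: power2_eq_square)
      qed
      moreover have "(F (Suc k) - F k)\<^sup>2 / q ^ Suc k = q ^ Suc k * (f (Suc k) - m)\<^sup>2" for k
        unfolding dF using q by (simp add: power2_eq_square)
      moreover have "(F 0)\<^sup>2 = q ^ 0 * (f 0 - m)\<^sup>2" by (simp add: F_def power2_commute)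
      ultimately show ?thesis
        unfolding V_def lessThan_Suc_atMost[symmetric] sum.lessThan_Suc_shift by simp
    qed
    finally show ?thesis .
  qed
  have "V \<le> (\<Sum>k\<le>N. ((F k)\<^sup>2 / \<theta> k + \<theta> k * (f (Suc k) - f k)\<^sup>2) / 2)"
    unfolding V2
  proof (intro sum_mono)
    fix k
    let ?d = "f (Suc k) - f k"
    have "0 \<le> (F k - \<theta> k * ?d)\<^sup>2 / \<theta> k" using tpos[of k] by simp
    also have "\<dots> = (F k)\<^sup>2 / \<theta> k + \<theta> k * ?d\<^sup>2 - 2 * (F k * ?d)"
      using tpos[of k] by (simp add: field_simps power2_eq_square)
    finally show "F k * ?d \<le> ((F k)\<^sup>2 / \<theta> k + \<theta> k * ?d\<^sup>2) / 2" by simp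
  qed
  also have "\<dots> = ((\<Sum>k\<le>N. (F k)\<^sup>2 / \<theta> k) + (\<Sum>k\<le>N. \<theta> k * (f (Suc k) - f k)\<^sup>2)) / 2"
    by (simp only: sum_divide_distrib sum.distrib add_divide_distrib)
  finally have V: "V \<le> ((\<Sum>k\<le>N. (F k)\<^sup>2 / \<theta> k) + (\<Sum>k\<le>N. \<theta> k * (f (Suc k) - f k)\<^sup>2)) / 2" .
  have "V \<le> (A + B) / 2 \<Longrightarrow> A \<le> V \<Longrightarrow> V \<le> B" for A B :: real by simp
  from this[OF V H] have "V \<le> (\<Sum>k\<le>N. \<theta> k * (f (Suc k) - f k)\<^sup>2)" .
  then show ?thesis unfolding V1 .
qed

section \<open>The Lerch function\<close>

lemma summable_lerch:
  fixes q a :: real assumes "0 < q" "q < 1" "0 < a"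
  shows "summable (\<lambda>k. q ^ k / (real k + a))"
proof (rule summable_comparison_test'[of "\<lambda>k. q ^ k / a" 0])
  show "summable (\<lambda>k. q ^ k / a)" using assms by (intro summable_divide summable_geometric) auto
  show "norm (q ^ k / (real k + a)) \<le> q ^ k / a" for k
    using assms by (simp add: divide_left_mono)
qed

text \<open>The recursion and the monotonicity feed the Hardy inequality. The last bound replaces
  every denominator \<open>k + a\<close> by \<open>a\<close>; it turns the lower bound on
  \<open>r\<close> in the second claim into the hypothesis of the first.\<close>

lemma lerch_phi_props:
  fixes q a :: real assumes q: "0 < q" "q < 1" and a: "0 < a"
  shows "0 < lerch_phi q a" "lerch_phi q a = 1 / a + q * lerch_phi q (a + 1)"
    "lerch_phi q (a + 1) \<le> lerch_phi q a" "(1 - q) * a * lerch_phi q a \<le> 1"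
proof -
  note s = summable_lerch[OF q a] and s1 = summable_lerch[OF q, of "a + 1"]
  show "0 < lerch_phi q a" unfolding lerch_phi_def
    using q a by (intro suminf_pos s) (auto intro!: divide_pos_pos)
  have "lerch_phi q a = q ^ 0 / (real 0 + a) + (\<Sum>k. q ^ Suc k / (real (Suc k) + a))"
    unfolding lerch_phi_def using suminf_split_head[OF s] by simp
  also have "(\<Sum>k. q ^ Suc k / (real (Suc k) + a)) = (\<Sum>k. q * (q ^ k / (real k + (a + 1))))"
    by (intro suminf_cong) (simp add: add_ac)
  also have "\<dots> = q * lerch_phi q (a + 1)" unfolding lerch_phi_def
    using a by (intro suminf_mult s1) simp
  finally show "lerch_phi q a = 1 / a + q * lerch_phi q (a + 1)" by simp
  show "lerch_phi q (a + 1) \<le> lerch_phi q a" unfolding lerch_phi_def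
    using q a by (intro suminf_le s s1 divide_left_mono) auto
  have "lerch_phi q a \<le> (\<Sum>k. q ^ k / a)" unfolding lerch_phi_def
    using q a by (intro suminf_le s divide_left_mono summable_divide summable_geometric) auto
  also have "\<dots> = 1 / (1 - q) / a"
    using q by (simp add: suminf_divide[OF summable_geometric] suminf_geometric)
  finally have "lerch_phi q a \<le> 1 / ((1 - q) * a)" by simp
  then show "(1 - q) * a * lerch_phi q a \<le> 1" using q a by (simp add: pos_le_divide_eq mult.commute)
qed

section \<open>Coercivity of the Dirichlet form\<close>

context qparam begin

abbreviation nu :: real where "nu \<equiv> lam / mu"

text \<open>The claimed gap. It is the excess of the diagonal coefficient computed in
  \<open>diagonal_excess_aux\<close> for \<open>d = 1\<close>.\<close>

definition kap :: real where "kap = mu\<^sup>2 / 2 * (2 * nu\<^sup>2 + r * (1 - nu\<^sup>2))"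

lemma nu: "0 < nu" "nu < 1" using lam lm by auto

lemma nu2: "0 < nu\<^sup>2" "nu\<^sup>2 < 1" 
proof -
  show "0 < nu\<^sup>2" using nu(1) by (rule zero_less_power)
  show "nu\<^sup>2 < 1" using mult_strict_mono'[of nu 1 nu 1] nu unfolding power2_eq_square by linarith
qed

lemma kap_eq: "kap = lam\<^sup>2 + r * (mu\<^sup>2 - lam\<^sup>2) / 2"
  using mu by (simp add: kap_def field_simps power2_eq_square)

lemma kap_pos: "0 < kap"
proof -
  have "0 < 2 * nu\<^sup>2 + r * (1 - nu\<^sup>2)" using nu2 r by (intro add_pos_pos mult_pos_pos) auto
  then show ?thesis unfolding kap_def using mu by simp
qed

section \<open>Conjugation with powers of the invariant state\<close>

text \<open>The eigenvalues of the square root of \<open>rho\<close>; those of the fourth root are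
  \<open>c\<close>.\<close>

definition w :: "nat \<Rightarrow> real" where "w n = sqrt (1 - nu\<^sup>2) * nu ^ n"

abbreviation c :: "nat \<Rightarrow> real" where "c \<equiv> rho4 lam mu"

lemma c_pos: "0 < c n"
  unfolding rho4_def using nu2 nu by simp

lemma c_sq: "c n * c n = w n"
proof -
  have "c n * c n = ((1 - nu\<^sup>2) * nu ^ (2 * n)) powr (1 / 2)"
    unfolding rho4_def powr_add[symmetric] by simp
  also have "\<dots> = sqrt ((1 - nu\<^sup>2) * (nu ^ n)\<^sup>2)"
    using nu2 nu by (subst powr_half_sqrt) (auto simp: power_even_eq)
  also have "\<dots> = w n" unfolding w_def real_sqrt_mult using nu by simp
  finally show ?thesis .
qed

lemma c_eq: "c n = sqrt (w n)"
  using c_sq[of n] c_pos[of n] by (metis less_imp_le real_sqrt_unique power2_eq_square)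

lemma w_pos: "0 < w n" unfolding w_def using nu2 nu by simp

lemma w_Suc: "w (Suc n) = nu * w n" by (simp add: w_def)

lemma w_le: "w n \<le> nu ^ n"
proof -
  have "sqrt (1 - nu\<^sup>2) \<le> 1" using nu2 by simp
  then show ?thesis unfolding w_def using mult_right_mono[of _ 1 "nu ^ n"] nu by simp
qed

lemma c_Suc: "c (Suc n) = sqrt nu * c n"
  unfolding c_eq w_Suc real_sqrt_mult ..

lemma sum_w_sq: "(\<Sum>n<N. (w n)\<^sup>2) = 1 - nu ^ (2 * N)"
proof (induction N)
  case (Suc N)
  have "(w N)\<^sup>2 = (1 - nu\<^sup>2) * nu ^ (2 * N)"
    unfolding w_def power_mult_distrib using nu2 by (simp add: power_even_eq)
  then show ?case using Suc by (simp add: algebra_simps power2_eq_square)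
qed simp

lemma sum_w_sq_le: "(\<Sum>n<N. (w n)\<^sup>2) \<le> 1"
  unfolding sum_w_sq using nu by simp

text \<open>The generator after conjugation. Shifting both indices by one changes
  \<open>c n * c m\<close> by the factor \<open>nu = lam / mu\<close>, so the jump rates
  \<open>mu^2\<close> and \<open>lam^2\<close> both become \<open>lam * mu\<close> and the hopping
  part is symmetric.\<close>

definition gen_mat :: "mat \<Rightarrow> mat" where
  "gen_mat z n m = drift n m * z n m + of_real (lam * mu) *
     (of_real (sqrt (om n * om m)) * z (n - 1) (m - 1) + of_real (sqrt (om (Suc n) * om (Suc m))) * z (Suc n) (Suc m))"

lemma c_mult_Suc: "c (Suc n) * c (Suc m) = nu * (c n * c m)"
proof -
  have "c (Suc n) * c (Suc m) = (sqrt nu * sqrt nu) * (c n * c m)" unfolding c_Suc by (simp only: mult_ac)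
  then show ?thesis by (simp only: real_sqrt_mult_self abs_of_pos[OF nu(1)])
qed

lemma iota_gen_mat:
  "of_real (c n) * (drift n m * y n m + jump y n m) * of_real (c m) = gen_mat (iota lam mu y) n m"
proof -
  have 1: "of_real (c n) * (of_real (mu\<^sup>2 * sqrt (om n * om m)) * y (n - 1) (m - 1)) * of_real (c m) =
     of_real (lam * mu) * (of_real (sqrt (om n * om m)) * iota lam mu y (n - 1) (m - 1))"
  proof (cases "n = 0 \<or> m = 0")
    case True then show ?thesis by auto
  next
    case False
    then obtain i j where ij: "n = Suc i" "m = Suc j" by (meson not0_implies_Suc)
    have "mu\<^sup>2 * (c (Suc i) * c (Suc j)) = lam * mu * (c i * c j)"
      unfolding c_mult_Suc using mu by (simp add: power2_eq_square)
    then have "of_real (mu\<^sup>2 * (c (Suc i) * c (Suc j))) * (of_real (sqrt (om n * om m)) * y i j) =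
       of_real (lam * mu * (c i * c j)) * (complex_of_real (sqrt (om n * om m)) * y i j)" by (rule arg_cong)
    then show ?thesis unfolding ij iota_def diff_Suc_1 of_real_mult by (simp only: mult_ac)
  qed
  have "lam\<^sup>2 * (c n * c m) = lam * mu * (c (Suc n) * c (Suc m))"
    unfolding c_mult_Suc using mu by (simp add: power2_eq_square)
  then have "of_real (lam\<^sup>2 * (c n * c m)) * (of_real (sqrt (om (Suc n) * om (Suc m))) * y (Suc n) (Suc m)) =
     of_real (lam * mu * (c (Suc n) * c (Suc m))) * (complex_of_real (sqrt (om (Suc n) * om (Suc m))) * y (Suc n) (Suc m))"
    by (rule arg_cong)
  then have 2: "of_real (c n) * (of_real (lam\<^sup>2 * sqrt (om (Suc n) * om (Suc m))) * y (Suc n) (Suc m)) * of_real (c m) =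
     of_real (lam * mu) * (of_real (sqrt (om (Suc n) * om (Suc m))) * iota lam mu y (Suc n) (Suc m))"
    unfolding iota_def of_real_mult by (simp only: mult_ac)
  show ?thesis unfolding gen_mat_def jump_def distrib_left distrib_right 1 2
    by (simp add: iota_def)
qed

text \<open>The coupling across the bond from \<open>(n - 1, m - 1)\<close> to
  \<open>(n, m)\<close>, labelled by its upper end. It vanishes on the edges \<open>n = 0\<close>
  and \<open>m = 0\<close>, where there is no bond.\<close>

definition hop :: "mat \<Rightarrow> nat \<Rightarrow> nat \<Rightarrow> real" where
  "hop X n m = sqrt (om n * om m) * Re (cnj (X n m) * X (n - 1) (m - 1))"

lemma Re_cnj_commute: "Re (cnj a * b) = Re (cnj b * a)" by (simp add: mult.commute)

lemma Re_cnj_gen_mat: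
  "Re (cnj (X n m) * gen_mat X n m) = Re (drift n m) * (cmod (X n m))\<^sup>2 + lam * mu * (hop X n m + hop X (Suc n) (Suc m))"
proof -
  have g: "cnj a * (g * a) = g * of_real ((cmod a)\<^sup>2)" for a g :: complex
    unfolding complex_norm_square by (simp add: mult_ac)
  have "cnj (X n m) * gen_mat X n m = drift n m * of_real ((cmod (X n m))\<^sup>2) + of_real (lam * mu) *
     (of_real (sqrt (om n * om m)) * (cnj (X n m) * X (n - 1) (m - 1)) +
      of_real (sqrt (om (Suc n) * om (Suc m))) * (cnj (X n m) * X (Suc n) (Suc m)))"
    unfolding gen_mat_def distrib_left g by (simp only: mult_ac)
  then have "Re (cnj (X n m) * gen_mat X n m) = Re (drift n m) * (cmod (X n m))\<^sup>2 + lam * mu *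
     (sqrt (om n * om m) * Re (cnj (X n m) * X (n - 1) (m - 1)) +
      sqrt (om (Suc n) * om (Suc m)) * Re (cnj (X n m) * X (Suc n) (Suc m)))"
    by simp
  then show ?thesis unfolding hop_def Re_cnj_commute[of "X n m" "X (Suc n) (Suc m)"] diff_Suc_1 .
qed

section \<open>Coercivity off the main diagonal\<close>

text \<open>\<open>al\<close> and \<open>be\<close> regroup the linear factors of
  \<open>omega\<close> so that their product along a bond is the squared coupling. Pairing
  \<open>max + 1\<close> with \<open>min + r\<close> leaves an excess that depends on the distance
  to the main diagonal but not on the position along it.\<close>

definition al :: "nat \<Rightarrow> nat \<Rightarrow> real" where
  "al n m = lam\<^sup>2 * ((real (max n m) + 1) * (real (min n m) + r))"

definition be :: "nat \<Rightarrow> nat \<Rightarrow> real" where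
  "be n m = mu\<^sup>2 * (real (min n m) * (real (max n m) + r - 1))"

lemma al_be_mult:
  "al n m * be (Suc n) (Suc m) = (lam * mu * sqrt (om (Suc n) * om (Suc m)))\<^sup>2"
proof -
  have "(lam * mu * sqrt (om (Suc n) * om (Suc m)))\<^sup>2 = (lam * mu)\<^sup>2 * (om (Suc n) * om (Suc m))"
    using mult_nonneg_nonneg[OF om_nonneg om_nonneg, of "Suc n" "Suc m"] by (simp add: power_mult_distrib)
  also have "\<dots> = al n m * be (Suc n) (Suc m)"
  proof (cases "n \<le> m")
    case True
    then have "max n m = m" "min n m = n" "max (Suc n) (Suc m) = Suc m" "min (Suc n) (Suc m) = Suc n" by auto
    then show ?thesis unfolding al_def be_def om_Suc by (simp add: power_mult_distrib algebra_simps)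
  next
    case False
    then have "max n m = n" "min n m = m" "max (Suc n) (Suc m) = Suc n" "min (Suc n) (Suc m) = Suc m" by auto
    then show ?thesis unfolding al_def be_def om_Suc by (simp add: power_mult_distrib algebra_simps)
  qed
  finally show ?thesis by (rule sym)
qed

lemma Re_drift: "Re (drift n m) = - (lam\<^sup>2 / 2 * (om (Suc n) + om (Suc m)) + mu\<^sup>2 / 2 * (om n + om m))"
  unfolding drift_def plus_complex.simps cnj.simps Re_gd by (simp add: algebra_simps add_divide_distrib)

lemma al_nonneg: "0 \<le> al n m" unfolding al_def using r by (intro mult_nonneg_nonneg) auto

lemma be_nonneg: "0 \<le> be n m"
proof (cases "min n m = 0")
  case False
  then have "1 \<le> real (max n m)" by linarith
  then show ?thesis unfolding be_def using r by (intro mult_nonneg_nonneg) auto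
qed (simp add: be_def)

text \<open>The excess on diagonal \<open>d\<close> is
  \<open>d / 2 * (lam^2 * (d + 1 - r) + mu^2 * (d + r - 1))\<close>. At \<open>d = 1\<close> this is
  \<open>kap\<close>, so the difference contains the factor \<open>d - 1\<close>, and the cofactor
  is shown to be nonnegative.\<close>

lemma diagonal_excess_aux:
  fixes n d :: nat assumes "1 \<le> d"
  shows "al n (n + d) + be n (n + d) + kap \<le> - Re (drift n (n + d))"
proof -
  define D where "D = real d"
  have D: "1 \<le> D" using assms by (simp add: D_def)
  have mm: "max n (n + d) = n + d" "min n (n + d) = n" by auto
  have "- Re (drift n (n + d)) - (al n (n + d) + be n (n + d)) =
      D / 2 * (lam\<^sup>2 * (D + 1 - r) + mu\<^sup>2 * (D + r - 1))"
    unfolding Re_drift al_def be_def mm om_Suc by (simp add: omega_def D_def[symmetric] field_simps)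
  moreover have "D / 2 * (lam\<^sup>2 * (D + 1 - r) + mu\<^sup>2 * (D + r - 1)) - kap =
      (D - 1) / 2 * ((D + 1) * lam\<^sup>2 + D * mu\<^sup>2 + lam\<^sup>2 * (1 - r) + mu\<^sup>2 * r)"
    unfolding kap_eq by (simp add: field_simps)
  moreover have "0 \<le> (D - 1) / 2 * ((D + 1) * lam\<^sup>2 + D * mu\<^sup>2 + lam\<^sup>2 * (1 - r) + mu\<^sup>2 * r)"
  proof (intro mult_nonneg_nonneg)
    \<comment> \<open>The one negative contribution \<open>- lam^2 * r\<close> is absorbed by
      \<open>mu^2 * r\<close>, as \<open>lam < mu\<close>.\<close>
    have "lam\<^sup>2 * r \<le> mu\<^sup>2 * r" using lam lm r by (intro mult_right_mono power_mono) auto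
    moreover have "0 \<le> (D + 1) * lam\<^sup>2" "0 \<le> D * mu\<^sup>2" "0 \<le> lam\<^sup>2" using D by auto
    moreover have "lam\<^sup>2 * (1 - r) = lam\<^sup>2 - lam\<^sup>2 * r" by (simp add: right_diff_distrib)
    ultimately show "0 \<le> (D + 1) * lam\<^sup>2 + D * mu\<^sup>2 + lam\<^sup>2 * (1 - r) + mu\<^sup>2 * r"
      by linarith
  qed (use D in auto)
  ultimately show ?thesis by linarith
qed

lemma diagonal_excess:
  assumes "n \<noteq> m" shows "al n m + be n m + kap \<le> - Re (drift n m)"
proof (cases "n < m")
  case True
  then show ?thesis using diagonal_excess_aux[of "m - n" n] by simp
next
  case False
  then have "al m n + be m n + kap \<le> - Re (drift m n)"
    using assms diagonal_excess_aux[of "n - m" m] by simp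
  moreover have "al m n = al n m" "be m n = be n m" "Re (drift m n) = Re (drift n m)"
    by (simp_all add: al_def be_def Re_drift max.commute min.commute add.commute)
  ultimately show ?thesis by simp
qed

lemma hop_le:
  "2 * (lam * mu) * hop X (Suc n) (Suc m) \<le> al n m * (cmod (X n m))\<^sup>2 + be (Suc n) (Suc m) * (cmod (X (Suc n) (Suc m)))\<^sup>2"
proof -
  let ?a = "al n m" and ?b = "be (Suc n) (Suc m)" and ?x = "cmod (X n m)" and ?y = "cmod (X (Suc n) (Suc m))"
  have ab: "sqrt ?a * sqrt ?b = lam * mu * sqrt (om (Suc n) * om (Suc m))"
    using al_be_mult[of n m] lam mu
    unfolding real_sqrt_mult[symmetric]
    by (simp add: mult_nonneg_nonneg)
  have "Re (cnj (X (Suc n) (Suc m)) * X n m) \<le> ?x * ?y"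
    using complex_Re_le_cmod[of "cnj (X (Suc n) (Suc m)) * X n m"] by (simp add: norm_mult mult.commute)
  then have "2 * (lam * mu) * hop X (Suc n) (Suc m) \<le> 2 * (lam * mu) * (sqrt (om (Suc n) * om (Suc m)) * (?x * ?y))"
    unfolding hop_def diff_Suc_1 using lam mu by (intro mult_left_mono) auto
  also have "\<dots> = 2 * (sqrt ?a * ?x) * (sqrt ?b * ?y)"
  proof -
    have "2 * (lam * mu) * (sqrt (om (Suc n) * om (Suc m)) * (?x * ?y)) =
        2 * ((lam * mu * sqrt (om (Suc n) * om (Suc m))) * (?x * ?y))" by simp
    also have "\<dots> = 2 * ((sqrt ?a * sqrt ?b) * (?x * ?y))" unfolding ab ..
    also have "\<dots> = 2 * (sqrt ?a * ?x) * (sqrt ?b * ?y)" by simp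
    finally show ?thesis .
  qed
  also have "\<dots> \<le> (sqrt ?a * ?x)\<^sup>2 + (sqrt ?b * ?y)\<^sup>2" by (rule sum_squares_bound)
  also have "\<dots> = ?a * ?x\<^sup>2 + ?b * ?y\<^sup>2"
    using al_nonneg be_nonneg by (simp add: power_mult_distrib)
  finally show ?thesis .
qed

lemma hop_0 [simp]: "hop X 0 m = 0" "hop X n 0 = 0"
  by (simp_all add: hop_def)

end

section \<open>Coercivity on the main diagonal and on boxes\<close>

text \<open>The assumption is the hypothesis of the first claim multiplied by
  \<open>mu^2 / 2\<close>.\<close>

locale qgap = qparam +
  assumes gap_cond: "kap * lerch_phi ((lam / mu)\<^sup>2) r \<le> mu\<^sup>2"
begin

text \<open>Writing \<open>x k = nu^k * f k\<close> turns the form into weighted squared increments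
  of \<open>f\<close>, which vanish for the invariant vector. The hypothesis on the Lerch function
  enters as \<open>kap * \<phi> 0 \<le> mu^2\<close>.\<close>

lemma poincare_chain:
  fixes x :: "nat \<Rightarrow> real"
  shows "kap * ((\<Sum>k<N. (x k)\<^sup>2) - (\<Sum>k<N. w k * x k)\<^sup>2) \<le>
    (\<Sum>k<N. (lam\<^sup>2 * om (Suc k) + mu\<^sup>2 * om k) * (x k)\<^sup>2 - 2 * (lam * mu) * (om k * (x k * x (k - 1))))"
proof (cases N)
  case (Suc M)
  define q where "q = nu\<^sup>2"
  have q: "0 < q" "q < 1" using nu2 by (auto simp: q_def)
  define \<phi> where "\<phi> m = lerch_phi q (real m + r)" for m
  define s where "s k = (\<Sum>m\<le>k. \<phi> m)" for k
  \<comment> \<open>Cutting off at \<open>N\<close> supplies the boundary value 0 required by the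
    Poincare inequality.\<close>
  define y where "y k = (if k < N then x k else 0)" for k
  define f where "f k = y k / nu ^ k" for k
  define \<theta> where "\<theta> k = lam\<^sup>2 * om (Suc k) * q ^ k / kap" for k
  note lp = lerch_phi_props[OF q, of "real _ + r"]
  have pos: "0 < real m + r" for m using r by linarith
  have \<phi>: "0 < \<phi> m" "\<phi> m = 1 / (real m + r) + q * \<phi> (Suc m)" "\<phi> (Suc m) \<le> \<phi> m" for m
    using lp(1,2,3)[OF pos[of m]] by (simp_all add: \<phi>_def add_ac)
  have \<phi>0: "\<phi> m \<le> \<phi> 0" for m
    using lift_Suc_antimono_le[of \<phi> 0 m] \<phi>(3) by simp
  have cond: "kap * \<phi> 0 \<le> mu\<^sup>2" using gap_cond by (simp add: \<phi>_def q_def)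
  \<comment> \<open>As \<open>\<phi>\<close> decreases, \<open>s k\<close> is at most
    \<open>(k + 1) * \<phi> 0\<close>. The factor \<open>k + 1\<close> combines with
    \<open>k + r\<close> to \<open>om (k + 1)\<close>, and \<open>q * mu^2 = lam^2\<close>.\<close>
  have \<theta>: "(real k + r) * (q ^ Suc k * s k) \<le> \<theta> k" for k
  proof -
    have "s k \<le> (\<Sum>m\<le>k. \<phi> 0)" unfolding s_def by (intro sum_mono \<phi>0)
    then have "s k \<le> (real k + 1) * \<phi> 0" by (simp add: add.commute)
    then have "kap * s k \<le> kap * ((real k + 1) * \<phi> 0)"
      using less_imp_le[OF kap_pos] by (rule mult_left_mono)
    also have "\<dots> = (real k + 1) * (kap * \<phi> 0)" by simp
    also have "\<dots> \<le> (real k + 1) * mu\<^sup>2" by (intro mult_left_mono cond) auto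
    finally have A: "q ^ k * ((real k + r) * (q * (kap * s k))) \<le> q ^ k * ((real k + r) * (q * ((real k + 1) * mu\<^sup>2)))"
      using q pos[of k] by (intro mult_left_mono) auto
    have "q * mu\<^sup>2 = lam\<^sup>2" using mu by (simp add: q_def power_divide)
    then have B: "q ^ k * ((real k + r) * (q * ((real k + 1) * mu\<^sup>2))) = lam\<^sup>2 * om (Suc k) * q ^ k"
    proof -
      have "q ^ k * ((real k + r) * (q * ((real k + 1) * mu\<^sup>2))) = q ^ k * ((real k + r) * ((real k + 1) * (q * mu\<^sup>2)))"
        by simp
      also have "\<dots> = q ^ k * ((real k + r) * ((real k + 1) * lam\<^sup>2))" using \<open>q * mu\<^sup>2 = lam\<^sup>2\<close> by simp
      finally show ?thesis unfolding om_Suc by simp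
    qed
    from A[unfolded B] have "kap * ((real k + r) * (q ^ Suc k * s k)) \<le> lam\<^sup>2 * om (Suc k) * q ^ k"
      by (simp only: power_Suc mult_ac)
    then show ?thesis unfolding \<theta>_def using kap_pos by (simp add: pos_le_divide_eq mult.commute)
  qed
  have fN: "f (Suc M) = 0" by (simp add: f_def y_def Suc)
  note P = poincare_real[where q=q and \<phi>=\<phi> and r=r and s=s and \<theta>=\<theta> and f=f and N=M,
      OF q \<phi>(1,2) r s_def \<theta> fN]
  have nf: "nu ^ k * f k = y k" for k
  proof -
    have "0 < nu ^ k" using nu(1) by (rule zero_less_power)
    then show ?thesis unfolding f_def times_divide_eq_right by (intro nonzero_mult_div_cancel_left) linarith
  qed
  have a: "(\<Sum>k\<le>M. q ^ k * (f k)\<^sup>2) = (\<Sum>k<N. (x k)\<^sup>2)"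
    unfolding Suc lessThan_Suc_atMost
  proof (intro sum.cong refl)
    fix k assume "k \<in> {..M}"
    have "q ^ k * (f k)\<^sup>2 = (nu ^ k * f k)\<^sup>2"
      by (simp add: q_def power_mult_distrib power_even_eq[symmetric] power_mult[symmetric] mult.commute)
    then show "q ^ k * (f k)\<^sup>2 = (x k)\<^sup>2" using \<open>k \<in> {..M}\<close> unfolding nf by (simp add: y_def Suc)
  qed
  have b: "(1 - q) * (\<Sum>k\<le>M. q ^ k * f k)\<^sup>2 = (\<Sum>k<N. w k * x k)\<^sup>2"
  proof -
    have "(\<Sum>k<N. w k * x k) = sqrt (1 - q) * (\<Sum>k\<le>M. q ^ k * f k)"
      unfolding Suc lessThan_Suc_atMost sum_distrib_left
    proof (intro sum.cong refl)
      fix k assume k: "k \<in> {..M}"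
      have "q ^ k * f k = nu ^ k * (nu ^ k * f k)"
        by (simp add: q_def power_mult[symmetric] mult_2 power_add)
      then show "w k * x k = sqrt (1 - q) * (q ^ k * f k)"
        using k unfolding nf by (simp add: w_def q_def y_def Suc)
    qed
    then show ?thesis using q by (simp add: power_mult_distrib)
  qed
  have d: "kap * (\<theta> k * (f (Suc k) - f k)\<^sup>2) = om (Suc k) * (mu * y (Suc k) - lam * y k)\<^sup>2" for k
  proof -
    have "lam * nu ^ k * f (Suc k) = mu * (nu ^ Suc k * f (Suc k))" using mu by simp
    then have e: "lam * nu ^ k * (f (Suc k) - f k) = mu * y (Suc k) - lam * y k"
      unfolding nf by (simp add: right_diff_distrib mult.assoc nf)
    have "kap * (\<theta> k * (f (Suc k) - f k)\<^sup>2) = om (Suc k) * (lam * nu ^ k * (f (Suc k) - f k))\<^sup>2"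
      using kap_pos by (simp add: \<theta>_def q_def power_mult_distrib mult_ac power_mult[symmetric])
    then show ?thesis unfolding e .
  qed
  have shift: "(\<Sum>k<N. g (Suc k)) = (\<Sum>k<N. g k)" if "g 0 = 0" "g N = 0" for g :: "nat \<Rightarrow> real"
    using that sum.lessThan_Suc_shift[of g N] by simp
  have "kap * ((\<Sum>k<N. (x k)\<^sup>2) - (\<Sum>k<N. w k * x k)\<^sup>2) \<le> kap * (\<Sum>k\<le>M. \<theta> k * (f (Suc k) - f k)\<^sup>2)"
    using P kap_pos unfolding a b by (intro mult_left_mono) auto
  also have "\<dots> = (\<Sum>k<N. om (Suc k) * (mu * y (Suc k) - lam * y k)\<^sup>2)"
    unfolding sum_distrib_left d Suc lessThan_Suc_atMost ..
  also have "\<dots> = (\<Sum>k<N. lam\<^sup>2 * om (Suc k) * (y k)\<^sup>2) +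
      (\<Sum>k<N. om (Suc k) * (mu\<^sup>2 * (y (Suc k))\<^sup>2 - 2 * (lam * mu) * (y (Suc k) * y k)))"
    unfolding sum.distrib[symmetric] by (intro sum.cong refl) (simp add: power2_eq_square algebra_simps)
  also have "(\<Sum>k<N. om (Suc k) * (mu\<^sup>2 * (y (Suc k))\<^sup>2 - 2 * (lam * mu) * (y (Suc k) * y k))) =
      (\<Sum>k<N. om k * (mu\<^sup>2 * (y k)\<^sup>2 - 2 * (lam * mu) * (y k * y (k - 1))))"
    using shift[of "\<lambda>k. om k * (mu\<^sup>2 * (y k)\<^sup>2 - 2 * (lam * mu) * (y k * y (k - 1)))"]
    by (simp add: y_def)
  also have "(\<Sum>k<N. lam\<^sup>2 * om (Suc k) * (y k)\<^sup>2) + \<dots> =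
    (\<Sum>k<N. (lam\<^sup>2 * om (Suc k) + mu\<^sup>2 * om k) * (x k)\<^sup>2 - 2 * (lam * mu) * (om k * (x k * x (k - 1))))"
    unfolding sum.distrib[symmetric] by (intro sum.cong refl) (auto simp: y_def algebra_simps)
  finally show ?thesis .
qed simp

text \<open>The truncated inner product with the square root of \<open>rho\<close>. On a finite box
  the weights have norm below 1, so subtracting its squared modulus removes slightly less than the
  full component.\<close>

definition state_part :: "nat \<Rightarrow> mat \<Rightarrow> complex" where
  "state_part N X = (\<Sum>n<N. of_real (w n) * X n n)"

definition gap_form :: "nat \<Rightarrow> mat \<Rightarrow> real" where
  "gap_form N X = (\<Sum>n<N. \<Sum>m<N. (cmod (X n m))\<^sup>2) - (cmod (state_part N X))\<^sup>2"

lemma poincare_diag: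
  "kap * ((\<Sum>n<N. (cmod (X n n))\<^sup>2) - (cmod (state_part N X))\<^sup>2) \<le>
     (\<Sum>n<N. - Re (drift n n) * (cmod (X n n))\<^sup>2 - 2 * (lam * mu) * hop X n n)"
proof -
  let ?R = "\<lambda>n. Re (X n n)" and ?I = "\<lambda>n. Im (X n n)"
  have hop: "hop X n n = om n * (?R n * ?R (n - 1)) + om n * (?I n * ?I (n - 1))" for n
    unfolding hop_def using om_nonneg[of n] by (simp add: algebra_simps)
  have drift: "- Re (drift n n) = lam\<^sup>2 * om (Suc n) + mu\<^sup>2 * om n" for n unfolding Re_drift by simp
  have W: "(cmod (state_part N X))\<^sup>2 = (\<Sum>n<N. w n * ?R n)\<^sup>2 + (\<Sum>n<N. w n * ?I n)\<^sup>2"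
    unfolding cmod_power2 state_part_def by simp
  have "kap * ((\<Sum>n<N. (cmod (X n n))\<^sup>2) - (cmod (state_part N X))\<^sup>2) =
      kap * ((\<Sum>k<N. (?R k)\<^sup>2) - (\<Sum>k<N. w k * ?R k)\<^sup>2) + kap * ((\<Sum>k<N. (?I k)\<^sup>2) - (\<Sum>k<N. w k * ?I k)\<^sup>2)"
    unfolding W unfolding cmod_power2 sum.distrib by (simp add: algebra_simps)
  also have "\<dots> \<le> (\<Sum>k<N. (lam\<^sup>2 * om (Suc k) + mu\<^sup>2 * om k) * (?R k)\<^sup>2 - 2 * (lam * mu) * (om k * (?R k * ?R (k - 1)))) +
     (\<Sum>k<N. (lam\<^sup>2 * om (Suc k) + mu\<^sup>2 * om k) * (?I k)\<^sup>2 - 2 * (lam * mu) * (om k * (?I k * ?I (k - 1))))"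
    by (intro add_mono poincare_chain)
  also have "\<dots> = (\<Sum>n<N. - Re (drift n n) * (cmod (X n n))\<^sup>2 - 2 * (lam * mu) * hop X n n)"
    unfolding sum.distrib[symmetric] drift hop cmod_power2 by (intro sum.cong refl) (simp add: algebra_simps)
  finally show ?thesis .
qed

text \<open>Bonds preserve the difference of the indices, so the main diagonal decouples and is left
  to the Poincare inequality. On other diagonals \<open>al\<close> is charged to the lower end of a
  bond and \<open>be\<close> to its upper end; after a shift of the index only \<open>al\<close>
  terms at the rim remain, with the favourable sign.\<close>

lemma coercive:
  "kap * gap_form N X \<le> (\<Sum>n<N. \<Sum>m<N. - Re (drift n m) * (cmod (X n m))\<^sup>2 - 2 * (lam * mu) * hop X n m)"
proof -
  let ?x = "\<lambda>n m. (cmod (X n m))\<^sup>2"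
  let ?E = "\<lambda>n m. - Re (drift n m) * ?x n m - 2 * (lam * mu) * hop X n m"
  define a where "a n m = (if n = m then 0 else al n m * ?x n m)" for n m
  define a' where "a' n m = (if n = 0 \<or> m = 0 then 0 else a (n - 1) (m - 1))" for n m
  have ann: "0 \<le> a n m" for n m unfolding a_def using al_nonneg by auto
  have le: "(if n = m then ?E n n - kap * ?x n n else 0) + kap * ?x n m + (a n m - a' n m) \<le> ?E n m" for n m
  proof (cases "n = m")
    case True then show ?thesis by (simp add: a'_def a_def)
  next
    case False
    have "(al n m + be n m + kap) * ?x n m \<le> - Re (drift n m) * ?x n m"
      by (intro mult_right_mono diagonal_excess False) auto
    moreover have "2 * (lam * mu) * hop X n m \<le> a' n m + be n m * ?x n m"
    proof (cases "n = 0 \<or> m = 0")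
      case True
      then show ?thesis using be_nonneg by (auto simp: a'_def)
    next
      case nm: False
      then obtain i j where ij: "n = Suc i" "m = Suc j" by (meson not0_implies_Suc)
      then show ?thesis using hop_le[of X i j] False by (simp add: a'_def a_def)
    qed
    ultimately show ?thesis using False by (simp add: a_def algebra_simps)
  qed
  have shift: "(\<Sum>n<N. \<Sum>m<N. a' n m) \<le> (\<Sum>n<N. \<Sum>m<N. a n m)"
  proof (cases N)
    case (Suc K)
    have "(\<Sum>n<Suc K. \<Sum>m<Suc K. a' n m) = (\<Sum>n<K. \<Sum>m<K. a n m)"
      by (simp only: sum.lessThan_Suc_shift) (simp add: a'_def)
    also have "\<dots> \<le> (\<Sum>n<Suc K. \<Sum>m<Suc K. a n m)"
      by (simp add: sum.distrib add_nonneg_nonneg sum_nonneg ann)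
    finally show ?thesis unfolding Suc .
  qed simp
  have diag: "(\<Sum>n<N. \<Sum>m<N. (if n = m then g n else 0)) = (\<Sum>n<N. g n)" for g :: "nat \<Rightarrow> real"
    by (intro sum.cong refl) (simp add: sum.delta')
  have "kap * gap_form N X = kap * ((\<Sum>n<N. ?x n n) - (cmod (state_part N X))\<^sup>2) - kap * (\<Sum>n<N. ?x n n) + kap * (\<Sum>n<N. \<Sum>m<N. ?x n m)"
    unfolding gap_form_def by (simp add: algebra_simps)
  also have "\<dots> \<le> (\<Sum>n<N. ?E n n) - kap * (\<Sum>n<N. ?x n n) + kap * (\<Sum>n<N. \<Sum>m<N. ?x n m)"
    using poincare_diag[where N=N and X=X] by linarith
  also have "\<dots> = (\<Sum>n<N. \<Sum>m<N. (if n = m then ?E n n - kap * ?x n n else 0)) + (\<Sum>n<N. \<Sum>m<N. kap * ?x n m)"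
    unfolding diag sum_subtractf[of _ "\<lambda>n. kap * ?x n n"] sum_distrib_left ..
  also have "\<dots> \<le> (\<Sum>n<N. \<Sum>m<N. (if n = m then ?E n n - kap * ?x n n else 0)) + (\<Sum>n<N. \<Sum>m<N. kap * ?x n m)
     + ((\<Sum>n<N. \<Sum>m<N. a n m) - (\<Sum>n<N. \<Sum>m<N. a' n m))"
    using shift by linarith
  also have "\<dots> = (\<Sum>n<N. \<Sum>m<N. (if n = m then ?E n n - kap * ?x n n else 0) + kap * ?x n m + (a n m - a' n m))"
    by (simp only: sum.distrib sum_subtractf)
  also have "\<dots> \<le> (\<Sum>n<N. \<Sum>m<N. ?E n m)" by (intro sum_mono le)
  finally show ?thesis .
qed

end

section \<open>Energy estimates for bounded evolutions\<close>

lemma gronwall: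
  fixes g g' :: "real \<Rightarrow> real"
  assumes g: "\<And>s. 0 \<le> s \<Longrightarrow> (g has_real_derivative g' s) (at s within {0..})"
    and le: "\<And>s. 0 \<le> s \<Longrightarrow> g' s \<le> - k * g s + e"
    and k: "0 \<le> k" and e: "0 \<le> e" and t: "0 \<le> t"
  shows "g t \<le> exp (- (k * t)) * g 0 + t * e"
proof -
  \<comment> \<open>The error is weighted by \<open>exp (k * t)\<close> instead of
    \<open>exp (k * s)\<close>, which makes it linear in time. This is enough because
    \<open>e\<close> is later sent to 0.\<close>
  define h where "h s = exp (k * s) * g s - s * (e * exp (k * t))" for s
  have "h 0 \<ge> h t"
  proof (rule DERIV_nonpos_imp_decreasing_open[OF t])
    fix s :: real assume s: "0 < s" "s < t"
    have "(g has_real_derivative g' s) (at s within {0<..})"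
      by (rule DERIV_subset[OF g]) (use s in auto)
    then have "(g has_real_derivative g' s) (at s)"
      using s at_within_open[of s "{0<..}"] by simp
    then have "(h has_real_derivative (exp (k * s) * g' s + k * exp (k * s) * g s - e * exp (k * t))) (at s)"
      unfolding h_def by (auto intro!: derivative_eq_intros)
    moreover have "exp (k * s) * g' s + k * exp (k * s) * g s - e * exp (k * t) \<le> 0"
    proof -
      have "exp (k * s) * (g' s + k * g s) \<le> exp (k * s) * e"
        using le[of s] s by (intro mult_left_mono) auto
      also have "\<dots> \<le> exp (k * t) * e" using s k e by (intro mult_right_mono) (auto intro: mult_left_mono)
      finally show ?thesis by (simp add: algebra_simps)
    qed
    ultimately show "\<exists>y. (h has_real_derivative y) (at s) \<and> y \<le> 0" by blast
  next
    have "continuous_on {0..} g"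
      using g DERIV_continuous_on by (metis atLeast_iff)
    then have "continuous_on {0..t} g" by (rule continuous_on_subset) auto
    then show "continuous_on {0..t} h" unfolding h_def by (intro continuous_intros)
  qed
  then have "exp (k * t) * g t \<le> g 0 + t * (e * exp (k * t))" by (simp add: h_def)
  then have "exp (- (k * t)) * (exp (k * t) * g t) \<le> exp (- (k * t)) * (g 0 + t * (e * exp (k * t)))"
    by (rule mult_left_mono) simp
  then show ?thesis by (simp add: exp_minus field_simps)
qed

lemma cmod_sq_has_derivative:
  assumes "(f has_vector_derivative f') (at t within S)"
  shows "((\<lambda>t. (cmod (f t))\<^sup>2) has_real_derivative 2 * Re (cnj (f t) * f')) (at t within S)"
proof -
  have "((\<lambda>t. Re (f t)) has_real_derivative Re f') (at t within S)"
    "((\<lambda>t. Im (f t)) has_real_derivative Im f') (at t within S)"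
    using bounded_linear.has_vector_derivative[OF bounded_linear_Re assms]
      bounded_linear.has_vector_derivative[OF bounded_linear_Im assms]
    by (simp_all add: has_real_derivative_iff_has_vector_derivative)
  then show ?thesis
    using DERIV_add[OF DERIV_power[of "\<lambda>t. Re (f t)" _ _ _ 2] DERIV_power[of "\<lambda>t. Im (f t)" _ _ _ 2]]
    unfolding cmod_power2 by (fastforce simp: algebra_simps)
qed

context qgap begin

text \<open>A solution of the conjugated equation on entries, with the bound inherited from entries
  bounded before conjugation. The decay of \<open>c n * c m\<close> is what controls the rim of a
  box.\<close>

definition evol :: "real \<Rightarrow> (real \<Rightarrow> mat) \<Rightarrow> bool" where
  "evol K z \<longleftrightarrow> (\<forall>t\<ge>0. \<forall>n m. ((\<lambda>t. z t n m) has_vector_derivative gen_mat (z t) n m) (at t within {0..})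
      \<and> cmod (z t n m) \<le> K * (c n * c m))"

lemma entry_eq_derivative:
  assumes y: "entry_eq y x" and t: "0 \<le> t"
  shows "((\<lambda>t. y t n m) has_vector_derivative (drift n m * y t n m + jump (y t) n m)) (at t within {0..})"
proof -
  let ?f = "\<lambda>s. exp (- (of_real s * drift n m)) * jump (y s) n m"
  let ?E = "\<lambda>t. exp (of_real t * drift n m)"
  \<comment> \<open>Continuity is available on compact intervals; reaching past \<open>t\<close>
    makes the derivative within this interval agree with the one within \<open>{0..}\<close>, also
    at time 0.\<close>
  let ?A = "{0..t + 1}"
  have "continuous_on ?A ?f"
    by (intro continuous_intros jump_continuous entry_eq_continuous[OF y])
  then have I: "((\<lambda>u. x n m + integral {0..u} ?f) has_vector_derivative (0 + ?f t)) (at t within ?A)"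
    using t by (intro has_vector_derivative_add has_vector_derivative_const integral_has_vector_derivative) auto
  have E: "(?E has_vector_derivative ?E t * drift n m) (at t within ?A)"
    using exp_scaleR_has_vector_derivative_right[of "drift n m" t ?A] by (simp add: scaleR_conv_of_real)
  have "((\<lambda>u. ?E u * (x n m + integral {0..u} ?f)) has_vector_derivative
      (?E t * (0 + ?f t) + ?E t * drift n m * (x n m + integral {0..t} ?f))) (at t within ?A)"
    by (rule has_vector_derivative_mult[OF E I])
  moreover have "?E t * (0 + ?f t) + ?E t * drift n m * (x n m + integral {0..t} ?f) = drift n m * y t n m + jump (y t) n m"
    unfolding entry_eq_duhamel(2)[OF y t] by (simp add: exp_minus algebra_simps)
  ultimately have "((\<lambda>u. ?E u * (x n m + integral {0..u} ?f)) has_vector_derivative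
      (drift n m * y t n m + jump (y t) n m)) (at t within ?A)" by simp
  then have "((\<lambda>u. y u n m) has_vector_derivative (drift n m * y t n m + jump (y t) n m)) (at t within ?A)"
    by (rule has_vector_derivative_transform[rotated 2]) (use t entry_eq_duhamel(2)[OF y] in auto)
  moreover have "at t within ?A = at t within {0..}"
    by (rule at_within_nhd[of t "{..<t + 1}"]) auto
  ultimately show ?thesis by simp
qed

lemma evol_iota:
  assumes y: "entry_eq y x" and K: "\<And>t n m. 0 \<le> t \<Longrightarrow> cmod (y t n m) \<le> K"
  shows "evol K (\<lambda>t. iota lam mu (y t))"
  unfolding evol_def
proof (intro allI impI conjI)
  fix t :: real and n m assume t: "0 \<le> t"
  show "((\<lambda>t. iota lam mu (y t) n m) has_vector_derivative gen_mat (iota lam mu (y t)) n m) (at t within {0..})"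
    unfolding iota_gen_mat[symmetric] unfolding iota_def
    by (intro has_vector_derivative_mult_left has_vector_derivative_mult_right entry_eq_derivative[OF y t])
  have "cmod (y t n m) * (c n * c m) \<le> K * (c n * c m)"
    using c_pos[of n] c_pos[of m] by (intro mult_right_mono K t) auto
  then show "cmod (iota lam mu (y t) n m) \<le> K * (c n * c m)"
    unfolding iota_def norm_mult norm_of_real using c_pos[of n] c_pos[of m] by (simp add: mult_ac)
qed

section \<open>Flux through the rim of a box\<close>

text \<open>The bonds that leave the box; the corner \<open>(N, N)\<close> is counted once, in the
  second sum.\<close>

definition hop_boundary :: "nat \<Rightarrow> mat \<Rightarrow> real" where
  "hop_boundary N X = (\<Sum>m<N. hop X N m) + (\<Sum>n<Suc N. hop X n N)"

text \<open>A bond enters the energy from each of its ends: twice if both ends lie in the box, once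
  if it crosses the rim. The single counts are the defect.\<close>

lemma energy_identity:
  "(\<Sum>n<N. \<Sum>m<N. 2 * Re (cnj (X n m) * gen_mat X n m)) =
     - 2 * (\<Sum>n<N. \<Sum>m<N. - Re (drift n m) * (cmod (X n m))\<^sup>2 - 2 * (lam * mu) * hop X n m) + 2 * (lam * mu) * hop_boundary N X"
proof -
  have "(\<Sum>n<N. \<Sum>m<N. hop X (Suc n) (Suc m)) = (\<Sum>n<Suc N. \<Sum>m<Suc N. hop X n m)"
    by (simp only: sum.lessThan_Suc_shift) simp
  also have "\<dots> = (\<Sum>n<N. \<Sum>m<N. hop X n m) + hop_boundary N X"
    by (simp add: hop_boundary_def sum.distrib)
  finally have s: "(\<Sum>n<N. \<Sum>m<N. hop X (Suc n) (Suc m)) = (\<Sum>n<N. \<Sum>m<N. hop X n m) + hop_boundary N X" .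
  have "(\<Sum>n<N. \<Sum>m<N. 2 * Re (cnj (X n m) * gen_mat X n m)) =
      (\<Sum>n<N. \<Sum>m<N. 2 * (Re (drift n m) * (cmod (X n m))\<^sup>2)) +
      2 * (lam * mu) * ((\<Sum>n<N. \<Sum>m<N. hop X n m) + (\<Sum>n<N. \<Sum>m<N. hop X (Suc n) (Suc m)))"
    unfolding Re_cnj_gen_mat sum_distrib_left sum.distrib[symmetric]
    by (intro sum.cong refl) (simp add: algebra_simps)
  also have "\<dots> = (\<Sum>n<N. \<Sum>m<N. 2 * (Re (drift n m) * (cmod (X n m))\<^sup>2)) +
      4 * (lam * mu) * (\<Sum>n<N. \<Sum>m<N. hop X n m) + 2 * (lam * mu) * hop_boundary N X"
    unfolding s by (simp add: algebra_simps)
  also have "(\<Sum>n<N. \<Sum>m<N. 2 * (Re (drift n m) * (cmod (X n m))\<^sup>2)) + 4 * (lam * mu) * (\<Sum>n<N. \<Sum>m<N. hop X n m) =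
      - 2 * (\<Sum>n<N. \<Sum>m<N. - Re (drift n m) * (cmod (X n m))\<^sup>2 - 2 * (lam * mu) * hop X n m)"
    unfolding sum_distrib_left sum.distrib[symmetric]
    by (intro sum.cong refl) (simp add: algebra_simps)
  finally show ?thesis .
qed

text \<open>The four weights multiply to \<open>nu\<close> times two values of \<open>w\<close>, one
  of them at index \<open>M\<close>; this leaves \<open>nu^M\<close>, against a coupling of at most
  \<open>om (M + 1)\<close>.\<close>

lemma hop_bound:
  assumes X: "\<And>n m. cmod (X n m) \<le> K * (c n * c m)" and K: "0 \<le> K"
    and nm: "n \<le> Suc M" "m \<le> Suc M" "n = Suc M \<or> m = Suc M"
  shows "hop X n m \<le> K\<^sup>2 * (om (Suc M) * nu ^ M)"
proof (cases "n = 0 \<or> m = 0")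
  case True
  then show ?thesis using nu by auto
next
  case False
  then obtain i j where ij: "n = Suc i" "m = Suc j" by (meson not0_implies_Suc)
  have "Re (cnj (X n m) * X i j) \<le> cmod (X n m) * cmod (X i j)"
    using complex_Re_le_cmod[of "cnj (X n m) * X i j"] by (simp add: norm_mult)
  also have "\<dots> \<le> (K * (c n * c m)) * (K * (c i * c j))"
    using K c_pos[of n] c_pos[of m] by (intro mult_mono X) auto
  also have "\<dots> = K\<^sup>2 * (nu * ((c i * c i) * (c j * c j)))"
    unfolding ij c_mult_Suc by (simp add: power2_eq_square)
  also have "\<dots> \<le> K\<^sup>2 * (1 * (nu ^ i * nu ^ j))"
    unfolding c_sq using nu w_le w_pos
    by (intro mult_left_mono mult_mono) (auto intro: less_imp_le mult_pos_pos)
  also have "\<dots> \<le> K\<^sup>2 * nu ^ M"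
    unfolding mult_1 power_add[symmetric] using nu nm ij
    by (intro mult_left_mono power_decreasing) auto
  finally have R: "Re (cnj (X n m) * X i j) \<le> K\<^sup>2 * nu ^ M" .
  have S: "sqrt (om n * om m) \<le> om (Suc M)"
  proof -
    have "om n * om m \<le> om (Suc M) * om (Suc M)" using nm by (intro mult_mono om_mono) auto
    then have "sqrt (om n * om m) \<le> sqrt (om (Suc M) * om (Suc M))" by (rule real_sqrt_le_mono)
    then show ?thesis using om_nonneg[of "Suc M"] by (simp add: real_sqrt_mult_self)
  qed
  have "hop X n m \<le> sqrt (om n * om m) * (K\<^sup>2 * nu ^ M)"
    unfolding hop_def ij diff_Suc_1 using R ij by (intro mult_left_mono) auto
  also have "\<dots> \<le> om (Suc M) * (K\<^sup>2 * nu ^ M)" using S nu by (intro mult_right_mono) auto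
  finally show ?thesis by (simp add: mult_ac)
qed

lemma hop_boundary_bound:
  assumes X: "\<And>n m. cmod (X n m) \<le> K * (c n * c m)" and K: "0 \<le> K"
  shows "hop_boundary (Suc M) X \<le> (2 * real M + 3) * (K\<^sup>2 * (om (Suc M) * nu ^ M))"
proof -
  have "hop_boundary (Suc M) X \<le> (\<Sum>m<Suc M. K\<^sup>2 * (om (Suc M) * nu ^ M)) + (\<Sum>n<Suc (Suc M). K\<^sup>2 * (om (Suc M) * nu ^ M))"
    unfolding hop_boundary_def by (intro add_mono sum_mono hop_bound[OF X K]) auto
  also have "\<dots> = (2 * real M + 3) * (K\<^sup>2 * (om (Suc M) * nu ^ M))"
    unfolding sum_constant card_lessThan by (simp only: distrib_right[symmetric]) simp
  finally show ?thesis .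
qed

text \<open>Invariance of \<open>rho\<close> on a box: since
  \<open>lam * mu * w n = mu^2 * w (n + 1)\<close>, gain and loss between neighbours cancel, the sum
  telescopes, and only the exchange across the rim is left.\<close>

lemma W_derivative:
  "(\<Sum>n<N. of_real (w n) * gen_mat X n n) =
     of_real (mu\<^sup>2 * om N * w N) * X N N - of_real (lam\<^sup>2 * om N * w (N - 1)) * X (N - 1) (N - 1)"
proof (induction N)
  case (Suc N)
  have sq: "sqrt (om i * om i) = om i" for i using om_nonneg[of i] by simp
  have 1: "lam * mu * w N = mu\<^sup>2 * w (Suc N)" using mu by (simp add: w_Suc power2_eq_square)
  have 2: "of_real (lam * mu * om N * w N) * X (N - 1) (N - 1) = of_real (lam\<^sup>2 * om N * w (N - 1)) * X (N - 1) (N - 1)"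
  proof (cases N)
    case (Suc k)
    have "lam * mu * w N = lam\<^sup>2 * w (N - 1)" unfolding Suc using mu by (simp add: w_Suc power2_eq_square)
    then have "lam * mu * om N * w N = lam\<^sup>2 * om N * w (N - 1)" by (metis mult.assoc mult.commute)
    then show ?thesis by (simp only:)
  qed simp
  have "of_real (w N) * gen_mat X N N = - of_real (lam\<^sup>2 * om (Suc N) * w N) * X N N - of_real (mu\<^sup>2 * om N * w N) * X N N
     + of_real (lam * mu * om N * w N) * X (N - 1) (N - 1) + of_real ((lam * mu * w N) * om (Suc N)) * X (Suc N) (Suc N)"
    unfolding gen_mat_def drift_diag sq by (simp add: algebra_simps)
  then show ?case unfolding sum.lessThan_Suc Suc 2 1 by (simp add: algebra_simps)
qed simp

definition eps1 :: "real \<Rightarrow> nat \<Rightarrow> real" where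
  "eps1 K M = (mu\<^sup>2 + lam\<^sup>2) * (K * (om (Suc M) * nu ^ M))"

text \<open>The first summand bounds the flux through the rim, the second the derivative of the
  squared modulus of \<open>state_part\<close>.\<close>

definition eps :: "real \<Rightarrow> nat \<Rightarrow> real" where
  "eps K M = 2 * (lam * mu) * ((2 * real M + 3) * (K\<^sup>2 * (om (Suc M) * nu ^ M))) + 2 * (K * eps1 K M)"

lemma W_derivative_bound:
  assumes X: "\<And>n m. cmod (X n m) \<le> K * (c n * c m)" and K: "0 \<le> K"
  shows "cmod (\<Sum>n<Suc M. of_real (w n) * gen_mat X n n) \<le> eps1 K M"
proof -
  have w1: "w n \<le> 1" for n using w_le[of n] nu power_le_one[of nu n] by linarith
  have Xn: "cmod (X n n) \<le> K * w n" for n using X[of n n] by (simp add: c_sq)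
  have XK: "cmod (X n n) \<le> K" for n using Xn[of n] mult_left_mono[OF w1[of n] K] by simp
  have wS: "w (Suc M) \<le> nu ^ M"
    unfolding w_Suc using w_le[of M] w_pos[of M] nu mult_right_mono[of nu 1 "w M"] by simp
  have "cmod (\<Sum>n<Suc M. of_real (w n) * gen_mat X n n) \<le>
     cmod (of_real (mu\<^sup>2 * om (Suc M) * w (Suc M)) * X (Suc M) (Suc M)) + cmod (of_real (lam\<^sup>2 * om (Suc M) * w M) * X M M)"
    unfolding W_derivative diff_Suc_1 by (rule norm_triangle_ineq4)
  also have "\<dots> = mu\<^sup>2 * om (Suc M) * w (Suc M) * cmod (X (Suc M) (Suc M)) + lam\<^sup>2 * om (Suc M) * w M * cmod (X M M)"
    unfolding norm_mult norm_of_real using w_pos[of "Suc M"] w_pos[of M] by (simp add: abs_mult)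
  also have "\<dots> \<le> mu\<^sup>2 * om (Suc M) * nu ^ M * K + lam\<^sup>2 * om (Suc M) * nu ^ M * K"
    using nu w_pos[of M] w_pos[of "Suc M"] by (intro add_mono mult_mono wS w_le XK order_refl mult_nonneg_nonneg) auto
  also have "\<dots> = eps1 K M" by (simp add: eps1_def algebra_simps)
  finally show ?thesis .
qed

lemma state_part_bound:
  assumes X: "\<And>n m. cmod (X n m) \<le> K * (c n * c m)" and K: "0 \<le> K"
  shows "cmod (state_part N X) \<le> K"
proof -
  have "cmod (state_part N X) \<le> (\<Sum>n<N. K * (w n)\<^sup>2)"
    unfolding state_part_def
  proof (rule sum_norm_le)
    fix n
    have "w n * cmod (X n n) \<le> w n * (K * w n)" using X[of n n] w_pos[of n] by (intro mult_left_mono) (auto simp: c_sq)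
    then show "cmod (of_real (w n) * X n n) \<le> K * (w n)\<^sup>2"
      unfolding norm_mult norm_of_real using w_pos[of n] by (simp add: power2_eq_square mult_ac)
  qed
  also have "\<dots> \<le> K * 1" unfolding sum_distrib_left[symmetric] by (intro mult_left_mono sum_w_sq_le K)
  finally show ?thesis by simp
qed

lemma evolD:
  assumes "evol K z" "0 \<le> t"
  shows "((\<lambda>t. z t n m) has_vector_derivative gen_mat (z t) n m) (at t within {0..})"
    "cmod (z t n m) \<le> K * (c n * c m)" "0 \<le> K"
proof -
  show 2: "((\<lambda>t. z t n m) has_vector_derivative gen_mat (z t) n m) (at t within {0..})"
    "cmod (z t n m) \<le> K * (c n * c m)"
    using assms unfolding evol_def by blast+
  have "0 \<le> K * (c n * c m)" using 2(2) norm_ge_zero order_trans by blast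
  then show "0 \<le> K" using mult_pos_pos[OF c_pos[of n] c_pos[of m]] by (simp add: zero_le_mult_iff)
qed

lemma state_part_has_derivative:
  assumes z: "evol K z" and t: "0 \<le> t"
  shows "((\<lambda>t. state_part N (z t)) has_vector_derivative (\<Sum>n<N. of_real (w n) * gen_mat (z t) n n)) (at t within {0..})"
  unfolding state_part_def
  by (intro has_vector_derivative_sum has_vector_derivative_mult_right evolD(1)[OF z t])

lemma eps_nonneg: "0 \<le> K \<Longrightarrow> 0 \<le> eps1 K M" "0 \<le> K \<Longrightarrow> 0 \<le> eps K M"
proof -
  show *: "0 \<le> K \<Longrightarrow> 0 \<le> eps1 K M"
    unfolding eps1_def using nu by (intro mult_nonneg_nonneg add_nonneg_nonneg) auto
  show "0 \<le> K \<Longrightarrow> 0 \<le> eps K M"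
    unfolding eps_def using nu lam mu * by (intro mult_nonneg_nonneg add_nonneg_nonneg) auto
qed

text \<open>Coercivity holds on the box up to the flux, and \<open>state_part\<close> is conserved
  up to the exchange across the rim. Both errors are constant in time, so Gronwall applies with rate
  \<open>2 * kap\<close>.\<close>

lemma evol_energy:
  assumes z: "evol K z" and t: "0 \<le> t"
  shows "gap_form (Suc M) (z t) \<le> exp (- (2 * kap * t)) * gap_form (Suc M) (z 0) + t * eps K M"
proof (rule gronwall[where g = "\<lambda>t. gap_form (Suc M) (z t)" and g' = "\<lambda>s.
      (\<Sum>n<Suc M. \<Sum>m<Suc M. 2 * Re (cnj (z s n m) * gen_mat (z s) n m))
      - 2 * Re (cnj (state_part (Suc M) (z s)) * (\<Sum>n<Suc M. of_real (w n) * gen_mat (z s) n n))"])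
  fix s :: real assume s: "0 \<le> s"
  show "((\<lambda>t. gap_form (Suc M) (z t)) has_real_derivative
      (\<Sum>n<Suc M. \<Sum>m<Suc M. 2 * Re (cnj (z s n m) * gen_mat (z s) n m))
      - 2 * Re (cnj (state_part (Suc M) (z s)) * (\<Sum>n<Suc M. of_real (w n) * gen_mat (z s) n n))) (at s within {0..})"
    unfolding gap_form_def
    by (intro DERIV_diff DERIV_sum cmod_sq_has_derivative evolD(1)[OF z s] state_part_has_derivative[OF z s])
  note X = evolD(2)[OF z s] and K = evolD(3)[OF z s]
  let ?W = "state_part (Suc M) (z s)" and ?W' = "\<Sum>n<Suc M. of_real (w n) * gen_mat (z s) n n"
  have "- Re (cnj ?W * ?W') \<le> cmod ?W * cmod ?W'"
    using complex_Re_le_cmod[of "- (cnj ?W * ?W')"] by (simp add: norm_mult)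
  also have "\<dots> \<le> K * eps1 K M"
    by (intro mult_mono state_part_bound[OF X K] W_derivative_bound[OF X K] K norm_ge_zero)
  finally have W: "- Re (cnj ?W * ?W') \<le> K * eps1 K M" .
  have B: "2 * (lam * mu) * hop_boundary (Suc M) (z s) \<le> 2 * (lam * mu) * ((2 * real M + 3) * (K\<^sup>2 * (om (Suc M) * nu ^ M)))"
    using lam mu by (intro mult_left_mono hop_boundary_bound[OF X K]) auto
  show "(\<Sum>n<Suc M. \<Sum>m<Suc M. 2 * Re (cnj (z s n m) * gen_mat (z s) n m)) - 2 * Re (cnj ?W * ?W')
     \<le> - (2 * kap) * gap_form (Suc M) (z s) + eps K M"
    unfolding energy_identity eps_def
    using W B coercive[of "Suc M" "z s"] by linarith
qed (use kap_pos t eps_nonneg evolD(3)[OF z t] in auto)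

lemma evol_W:
  assumes z: "evol K z" and t: "0 \<le> t"
  shows "cmod (state_part (Suc M) (z t) - state_part (Suc M) (z 0)) \<le> t * eps1 K M"
proof -
  have K: "0 \<le> K" using evolD(3)[OF z t] .
  have "((\<lambda>s. \<Sum>n<Suc M. of_real (w n) * gen_mat (z s) n n) has_integral (state_part (Suc M) (z t) - state_part (Suc M) (z 0))) {0..t}"
    by (rule fundamental_theorem_of_calculus[OF t])
      (rule has_vector_derivative_within_subset[OF state_part_has_derivative[OF z]], auto)
  from has_integral_bound_real[OF eps_nonneg(1)[OF K] _ this, of "{}" M]
  have "cmod (state_part (Suc M) (z t) - state_part (Suc M) (z 0)) \<le> eps1 K M * measure lborel {0..t}"
    using W_derivative_bound[OF evolD(2)[OF z] K] by auto
  then show ?thesis using t by (simp add: mult.commute)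
qed

end

section \<open>The minimal semigroup\<close>

text \<open>Passing to the \<open>k\<close>-th root of \<open>x\<close> reduces the polynomial
  factor to a linear one.\<close>

lemma polynomial_geometric_tendsto_0:
  fixes x :: real assumes "0 < x" "x < 1"
  shows "(\<lambda>n. (real n + 1) ^ k * x ^ n) \<longlonglongrightarrow> 0"
proof (cases "k = 0")
  case True then show ?thesis using assms by (simp add: LIMSEQ_realpow_zero)
next
  case False
  define s where "s = root k x"
  have s: "0 < s" "s < 1" "s ^ k = x"
    using assms False by (auto simp: s_def real_root_lt_1_iff real_root_pow_pos2)
  have "(\<lambda>n. real n * s ^ n + s ^ n) \<longlonglongrightarrow> 0 + 0"
    using s by (intro tendsto_add powser_times_n_limit_0 LIMSEQ_realpow_zero) auto
  then have "(\<lambda>n. (real n * s ^ n + s ^ n) ^ k) \<longlonglongrightarrow> 0 ^ k" by (intro tendsto_power) simp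
  moreover have "(real n * s ^ n + s ^ n) ^ k = (real n + 1) ^ k * x ^ n" for n
  proof -
    have "real n * s ^ n + s ^ n = (real n + 1) * s ^ n" by (simp add: algebra_simps)
    then show ?thesis by (simp add: power_mult_distrib s(3)[symmetric] power_mult[symmetric] mult.commute)
  qed
  ultimately show ?thesis using False by (simp add: zero_power)
qed

text \<open>Half of the decay, \<open>y = sqrt x\<close>, absorbs the polynomial; the other half is
  a geometric series.\<close>

lemma polynomial_geometric_summable:
  fixes x :: real assumes "0 < x" "x < 1"
  shows "summable (\<lambda>n. (real n + 1) ^ k * x ^ n)"
proof -
  define y where "y = sqrt x"
  have y: "0 < y" "y < 1" "y * y = x" using assms by (auto simp: y_def)
  obtain B where B: "\<And>n. norm ((real n + 1) ^ k * y ^ n) \<le> B"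
    using convergent_imp_Bseq[OF convergentI[OF polynomial_geometric_tendsto_0[OF y(1,2), of k]]]
    unfolding Bseq_def by blast
  show ?thesis
  proof (rule summable_comparison_test'[of "\<lambda>n. B * y ^ n" 0])
    show "summable (\<lambda>n. B * y ^ n)" using y by (intro summable_mult summable_geometric) auto
    fix n
    have "norm ((real n + 1) ^ k * x ^ n) = norm ((real n + 1) ^ k * y ^ n) * y ^ n"
      using y by (simp add: power_mult_distrib y(3)[symmetric])
    also have "\<dots> \<le> B * y ^ n" using y by (intro mult_right_mono B) auto
    finally show "norm ((real n + 1) ^ k * x ^ n) \<le> B * y ^ n" .
  qed
qed

definition box_sq :: "nat \<Rightarrow> mat \<Rightarrow> real" where
  "box_sq N X = (\<Sum>n<N. \<Sum>m<N. (cmod (X n m))\<^sup>2)"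

lemma box_sq_mono: "N \<le> M \<Longrightarrow> box_sq N X \<le> box_sq M X"
  unfolding box_sq_def
proof -
  assume NM: "N \<le> M"
  have "(\<Sum>n<N. \<Sum>m<N. (cmod (X n m))\<^sup>2) \<le> (\<Sum>n<N. \<Sum>m<M. (cmod (X n m))\<^sup>2)"
    using NM by (intro sum_mono sum_mono2) auto
  also have "\<dots> \<le> (\<Sum>n<M. \<Sum>m<M. (cmod (X n m))\<^sup>2)"
    using NM by (intro sum_mono2 sum_nonneg) auto
  finally show "(\<Sum>n<N. \<Sum>m<N. (cmod (X n m))\<^sup>2) \<le> (\<Sum>n<M. \<Sum>m<M. (cmod (X n m))\<^sup>2)" .
qed

lemma entry_le_box_sq: "n < N \<Longrightarrow> m < N \<Longrightarrow> (cmod (X n m))\<^sup>2 \<le> box_sq N X"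
proof -
  assume n: "n < N" and m: "m < N"
  have "(cmod (X n m))\<^sup>2 \<le> (\<Sum>m<N. (cmod (X n m))\<^sup>2)"
    using m by (intro member_le_sum) auto
  also have "\<dots> \<le> box_sq N X" unfolding box_sq_def
    using n by (intro member_le_sum[of n "{..<N}" "\<lambda>n. \<Sum>m<N. (cmod (X n m))\<^sup>2"] sum_nonneg) auto
  finally show ?thesis .
qed

context qgap begin

lemma om_Suc_le: "om (Suc n) \<le> (1 + r) * (real n + 1)\<^sup>2"
proof -
  have "om (Suc n) \<le> (real n + 1) * ((1 + r) * (real n + 1))"
    unfolding om_Suc using r by (intro mult_left_mono) (auto simp: algebra_simps)
  then show ?thesis by (simp add: power2_eq_square mult_ac)
qed

lemma eps_tendsto: "(\<lambda>M. eps1 K M) \<longlonglongrightarrow> 0" "(\<lambda>M. eps K M) \<longlonglongrightarrow> 0"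
proof -
  have b: "(2 * real M + 3) * (om (Suc M) * nu ^ M) \<le> 3 * (1 + r) * ((real M + 1) ^ 3 * nu ^ M)" for M
  proof -
    have "(2 * real M + 3) * om (Suc M) \<le> (3 * (real M + 1)) * ((1 + r) * (real M + 1)\<^sup>2)"
      by (intro mult_mono om_Suc_le) auto
    then have "(2 * real M + 3) * om (Suc M) * nu ^ M \<le> (3 * (real M + 1)) * ((1 + r) * (real M + 1)\<^sup>2) * nu ^ M"
      using nu by (intro mult_right_mono) auto
    moreover have "(3 * A) * ((1 + r) * A\<^sup>2) * B = 3 * (1 + r) * (A ^ 3 * B)" for A B :: real
      by (simp add: power3_eq_cube power2_eq_square)
    ultimately show ?thesis by (simp only: mult.assoc)
  qed
  have pos: "0 \<le> om (Suc M) * nu ^ M" for M using nu by (intro mult_nonneg_nonneg) auto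
  have le3: "om (Suc M) * nu ^ M \<le> (2 * real M + 3) * (om (Suc M) * nu ^ M)" for M
    using mult_right_mono[OF _ pos[of M], of 1 "2 * real M + 3"] by simp
  have z: "(\<lambda>M. 3 * (1 + r) * ((real M + 1) ^ 3 * nu ^ M)) \<longlonglongrightarrow> 0"
    using tendsto_mult[OF tendsto_const polynomial_geometric_tendsto_0[OF nu], of "3 * (1 + r)" 3] by simp
  have t3: "(\<lambda>M. (2 * real M + 3) * (om (Suc M) * nu ^ M)) \<longlonglongrightarrow> 0"
    by (rule tendsto_sandwich[OF _ _ tendsto_const z]) (use pos b in \<open>auto intro!: always_eventually mult_nonneg_nonneg[OF _ pos]\<close>)
  have t1: "(\<lambda>M. om (Suc M) * nu ^ M) \<longlonglongrightarrow> 0"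
    by (rule tendsto_sandwich[OF _ _ tendsto_const t3]) (use pos le3 in \<open>auto intro!: always_eventually\<close>)
  show e1: "(\<lambda>M. eps1 K M) \<longlonglongrightarrow> 0"
    unfolding eps1_def using tendsto_mult[OF tendsto_const t1, of "(mu\<^sup>2 + lam\<^sup>2) * K"] by (simp add: mult.assoc)
  have "(\<lambda>M. 2 * (lam * mu) * K\<^sup>2 * ((2 * real M + 3) * (om (Suc M) * nu ^ M)) + 2 * K * eps1 K M) \<longlonglongrightarrow>
      2 * (lam * mu) * K\<^sup>2 * 0 + 2 * K * 0"
    by (intro tendsto_add tendsto_mult tendsto_const t3 e1)
  moreover have "2 * (lam * mu) * K\<^sup>2 * ((2 * real M + 3) * (om (Suc M) * nu ^ M)) + 2 * K * eps1 K M = eps K M" for M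
    unfolding eps_def by (simp only: mult_ac)
  ultimately show "(\<lambda>M. eps K M) \<longlonglongrightarrow> 0" by simp
qed

lemma gap_form_box_sq: "gap_form N X = box_sq N X - (cmod (state_part N X))\<^sup>2"
  by (simp add: gap_form_def box_sq_def)

text \<open>The observed box \<open>N\<close> stays fixed while the energy estimate runs on boxes of
  size \<open>M + 1\<close> with \<open>M\<close> growing. Both errors vanish, and adding back the
  conserved component turns the energy into a norm. With initial value 0 this is a uniqueness
  statement.\<close>

lemma evol_box_bound:
  assumes z: "evol K z" and t: "0 \<le> t"
    and \<sigma>: "(\<lambda>N. box_sq N (z 0)) \<longlonglongrightarrow> \<sigma>" and \<omega>: "(\<lambda>N. state_part N (z 0)) \<longlonglongrightarrow> \<omega>"
  shows "box_sq N (z t) \<le> (cmod \<omega>)\<^sup>2 + exp (- (2 * kap * t)) * (\<sigma> - (cmod \<omega>)\<^sup>2)"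
proof (rule LIMSEQ_le_const)
  let ?b = "\<lambda>M. exp (- (2 * kap * t)) * (box_sq (Suc M) (z 0) - (cmod (state_part (Suc M) (z 0)))\<^sup>2) + t * eps K M
     + (cmod (state_part (Suc M) (z 0)) + t * eps1 K M)\<^sup>2"
  have "?b \<longlonglongrightarrow> exp (- (2 * kap * t)) * (\<sigma> - (cmod \<omega>)\<^sup>2) + t * 0 + (cmod \<omega> + t * 0)\<^sup>2"
    by (intro tendsto_add tendsto_mult tendsto_const tendsto_diff tendsto_power tendsto_norm eps_tendsto
        LIMSEQ_Suc[OF \<sigma>] LIMSEQ_Suc[OF \<omega>])
  then show "?b \<longlonglongrightarrow> (cmod \<omega>)\<^sup>2 + exp (- (2 * kap * t)) * (\<sigma> - (cmod \<omega>)\<^sup>2)"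
    by (simp add: add.commute)
  show "\<exists>M0. \<forall>M\<ge>M0. box_sq N (z t) \<le> ?b M"
  proof (intro exI allI impI)
    fix M assume "N \<le> M"
    then have "box_sq N (z t) \<le> box_sq (Suc M) (z t)" by (intro box_sq_mono) auto
    also have "\<dots> = gap_form (Suc M) (z t) + (cmod (state_part (Suc M) (z t)))\<^sup>2" by (simp add: gap_form_box_sq)
    also have "\<dots> \<le> (exp (- (2 * kap * t)) * gap_form (Suc M) (z 0) + t * eps K M) + (cmod (state_part (Suc M) (z 0)) + t * eps1 K M)\<^sup>2"
    proof (intro add_mono evol_energy[OF z t] power_mono)
      show "cmod (state_part (Suc M) (z t)) \<le> cmod (state_part (Suc M) (z 0)) + t * eps1 K M"
        using evol_W[OF z t, of M] norm_triangle_sub[of "state_part (Suc M) (z t)" "state_part (Suc M) (z 0)"] by linarith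
    qed simp
    finally show "box_sq N (z t) \<le> ?b M" by (simp add: gap_form_box_sq)
  qed
qed

lemma gen_mat_diff: "gen_mat (\<lambda>i j. X i j - Y i j) n m = gen_mat X n m - gen_mat Y n m"
  unfolding gen_mat_def by (simp add: algebra_simps)

lemma evol_diff:
  assumes "evol K z" "evol K' z'"
  shows "evol (K + K') (\<lambda>t i j. z t i j - z' t i j)"
  unfolding evol_def gen_mat_diff
proof (intro allI impI conjI)
  fix t :: real and n m assume t: "0 \<le> t"
  show "((\<lambda>t. z t n m - z' t n m) has_vector_derivative gen_mat (z t) n m - gen_mat (z' t) n m) (at t within {0..})"
    by (intro has_vector_derivative_diff evolD(1)[OF assms(1) t] evolD(1)[OF assms(2) t])
  show "cmod (z t n m - z' t n m) \<le> (K + K') * (c n * c m)"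
    using norm_triangle_ineq4[of "z t n m" "z' t n m"] evolD(2)[OF assms(1) t, of n m] evolD(2)[OF assms(2) t, of n m]
    by (simp add: algebra_simps)
qed

text \<open>On the diagonal the total gain rate equals the total loss rate, so the identity is a
  stationary solution before conjugation.\<close>

lemma jump_idm: "drift n m * idm n m + jump idm n m = 0"
proof (cases "n = m")
  case True
  have sq: "sqrt (om i * om i) = om i" for i using om_nonneg[of i] by simp
  show ?thesis unfolding True jump_def drift_diag sq by (simp add: idm_def)
next
  case False
  show ?thesis
  proof (cases "n = 0 \<or> m = 0")
    case True then show ?thesis using False by (auto simp: jump_def idm_def)
  next
    case nm: False
    then have "n - 1 \<noteq> m - 1" using False by auto
    then show ?thesis using False by (simp add: jump_def idm_def)
  qed
qed

lemma evol_idm: "evol 1 (\<lambda>t. iota lam mu idm)"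
  unfolding evol_def iota_gen_mat[symmetric] jump_idm
proof (intro allI impI conjI)
  fix n m
  show "cmod (iota lam mu idm n m) \<le> 1 * (c n * c m)"
    unfolding iota_def idm_def using c_pos[of n] c_pos[of m] by (simp add: norm_mult)
qed simp

lemma entry_eq_0: "entry_eq y x \<Longrightarrow> y 0 = x"
  using entry_eq_duhamel(2)[of y x 0] by (intro ext) simp

end

lemma bounded_mat_add:
  assumes "bounded_mat x" "bounded_mat y" shows "bounded_mat (\<lambda>i j. x i j + y i j)"
proof -
  obtain C where C: "form_bounded C x" using bounded_mat_imp_form_bounded[OF assms(1)] .
  obtain C' where C': "form_bounded C' y" using bounded_mat_imp_form_bounded[OF assms(2)] .
  have "form_bounded (C + C') (\<lambda>i j. x i j + y i j)"
    unfolding form_bounded_def form_add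
  proof (intro conjI allI)
    show "0 \<le> C + C'" using C C' by (simp add: form_bounded_def)
    fix N v u
    show "cmod (form N x v u + form N y v u) \<le> (C + C') * nrm N v * nrm N u"
      using norm_triangle_ineq[of "form N x v u" "form N y v u"] form_boundedD[OF C, of N v u] form_boundedD[OF C', of N v u]
      by (simp add: algebra_simps)
  qed
  then show ?thesis by (rule form_bounded_mat(4))
qed

lemma bounded_mat_cmult:
  assumes "bounded_mat x" shows "bounded_mat (\<lambda>i j. a * x i j)"
proof -
  obtain C where C: "form_bounded C x" using bounded_mat_imp_form_bounded[OF assms] .
  have "form_bounded (cmod a * C) (\<lambda>i j. a * x i j)"
    unfolding form_bounded_def form_cmult
  proof (intro conjI allI)
    show "0 \<le> cmod a * C" using C by (simp add: form_bounded_def)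
    fix N v u
    show "cmod (a * form N x v u) \<le> cmod a * C * nrm N v * nrm N u"
      using mult_left_mono[OF form_boundedD[OF C, of N v u], of "cmod a"] by (simp add: norm_mult mult_ac)
  qed
  then show ?thesis by (rule form_bounded_mat(4))
qed

lemma form_adjoint: "form N (\<lambda>i j. cnj (x j i)) v u = cnj (form N x u v)"
  unfolding form_def by (subst sum.swap) (simp add: mult_ac)

lemma form_bounded_adjoint: "form_bounded C x \<Longrightarrow> form_bounded C (\<lambda>i j. cnj (x j i))"
  unfolding form_bounded_def form_adjoint complex_mod_cnj
proof (intro conjI allI)
  assume x: "0 \<le> C \<and> (\<forall>N v u. cmod (form N x v u) \<le> C * nrm N v * nrm N u)"
  then show "0 \<le> C" by simp
  fix N v u
  show "cmod (form N x u v) \<le> C * nrm N v * nrm N u"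
    using x[THEN conjunct2, rule_format, of N u v] by (simp only: mult_ac)
qed

lemma form_bounded_pos:
  assumes X: "form_bounded C X" and herm: "\<And>i j. X j i = cnj (X i j)"
  shows "form_pos (\<lambda>i j. of_real C * idm i j + X i j)"
  unfolding form_pos_def form_add form_cmult form_idm
proof (intro allI conjI)
  fix N u
  have "(\<lambda>i j. cnj (X j i)) = X" by (intro ext) (rule herm[symmetric])
  then have "form N X u u = cnj (form N X u u)" using form_adjoint[of N X u u] by simp
  then have "Im (form N X u u) = 0" by (simp add: complex_eq_iff)
  then show "Im (of_real C * of_real (\<Sum>n<N. (cmod (u n))\<^sup>2) + form N X u u) = 0" by simp
  have "cmod (form N X u u) \<le> C * (\<Sum>n<N. (cmod (u n))\<^sup>2)"
    using form_boundedD[OF X, of N u u] nrm_sq[where N=N and u=u] by (simp add: power2_eq_square mult.assoc)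
  then show "0 \<le> Re (of_real C * of_real (\<Sum>n<N. (cmod (u n))\<^sup>2) + form N X u u)"
    using abs_Re_le_cmod[of "form N X u u"] by simp
qed

section \<open>Entry bounds and conservativity of the minimal semigroup\<close>

locale qmin = qgap +
  fixes S :: "real \<Rightarrow> mat \<Rightarrow> mat"
  assumes minimal: "minimal_qds r lam mu zp zm S"
begin

lemma qds: "qds_solution r lam mu zp zm S"
  using minimal by (simp add: minimal_qds_def)

lemmas qds_parts = qds[unfolded qds_solution_def]

lemma S_add:
  assumes "0 \<le> t" "bounded_mat x" "bounded_mat y"
  shows "S t (\<lambda>i j. x i j + y i j) n m = S t x n m + S t y n m"
  by (simp only: qds_parts[THEN conjunct2, THEN conjunct1, rule_format, OF assms])

lemma S_cmult:
  assumes "0 \<le> t" "bounded_mat x"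
  shows "S t (\<lambda>i j. a * x i j) n m = a * S t x n m"
  by (simp only: qds_parts[THEN conjunct2, THEN conjunct2, THEN conjunct1, rule_format, OF assms])

lemma S_pos:
  assumes "0 \<le> t" "bounded_mat x" "form_pos x"
  shows "form_pos (S t x)"
proof (rule positive_mat_form_pos)
  have x: "positive_mat x" using positive_mat_iff assms by blast
  show "positive_mat (S t x)"
    by (rule qds_parts[THEN conjunct2, THEN conjunct2, THEN conjunct2, THEN conjunct1, rule_format, OF assms(1,2) x])
qed

lemma bounded_idm: "bounded_mat idm"
  using form_bounded_mat(4)[OF form_bounded_idm] .

text \<open>Only here is minimality used: it compares \<open>S\<close> with the contractive Dyson solution.\<close>
lemma S_idm_le: "0 \<le> t \<Longrightarrow> Re (S t idm n n) \<le> 1"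
proof -
  assume t: "0 \<le> t"
  have "positive_mat idm" using positive_mat_iff[OF bounded_idm] form_pos_idm by simp
  then have "positive_mat (\<lambda>i j. Dyson t idm i j - S t idm i j)"
    by (rule minimal[unfolded minimal_qds_def, THEN conjunct2, rule_format, OF Dyson_qds t bounded_idm])
  from form_pos_diag(2)[OF positive_mat_form_pos[OF this], of n] Dyson_idm_le[OF t, of n]
  show ?thesis by simp
qed

lemma S_idm_entry: "0 \<le> t \<Longrightarrow> cmod (S t idm n m) \<le> 2"
  using form_pos_offdiag[OF S_pos[OF _ bounded_idm form_pos_idm], of t n m] S_idm_le[of t n] S_idm_le[of t m]
  by simp

text \<open>Both \<open>C * 1 + X\<close> and \<open>C * 1 - X\<close> stay positive under
  \<open>S t\<close>. The second bounds the diagonal of the image of the first by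
  \<open>2 * C\<close>, the off-diagonal estimate gives \<open>4 * C\<close>, and removing
  \<open>C * S t idm\<close> costs another \<open>2 * C\<close>.\<close>

lemma S_hermitian_entry:
  assumes X: "form_bounded C X" and herm: "\<And>i j. X j i = cnj (X i j)" and t: "0 \<le> t"
  shows "cmod (S t X n m) \<le> 6 * C"
proof -
  have C: "0 \<le> C" using X by (simp add: form_bounded_def)
  have bX: "bounded_mat X" using form_bounded_mat(4)[OF X] .
  define Y where "Y = (\<lambda>i j. (-1) * X i j)"
  have bY: "bounded_mat Y" unfolding Y_def by (rule bounded_mat_cmult[OF bX])
  have Y: "form_bounded C Y" unfolding Y_def
    using X unfolding form_bounded_def form_cmult by (simp add: norm_mult)
  have hermY: "Y j i = cnj (Y i j)" for i j unfolding Y_def using herm[of i j] by simp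
  have bC: "bounded_mat (\<lambda>i j. of_real C * idm i j)" by (rule bounded_mat_cmult[OF bounded_idm])
  have SA: "S t (\<lambda>i j. of_real C * idm i j + X i j) i j = of_real C * S t idm i j + S t X i j" for i j
    using S_add[OF t bC bX] S_cmult[OF t bounded_idm] by simp
  have SB: "S t (\<lambda>i j. of_real C * idm i j + Y i j) i j = of_real C * S t idm i j - S t X i j" for i j
    using S_add[OF t bC bY] S_cmult[OF t bounded_idm] S_cmult[OF t bX, of "-1"] by (simp add: Y_def)
  have A: "form_pos (S t (\<lambda>i j. of_real C * idm i j + X i j))"
    by (intro S_pos t bounded_mat_add bC bX form_bounded_pos[OF X herm])
  have B: "form_pos (S t (\<lambda>i j. of_real C * idm i j + Y i j))"
    by (intro S_pos t bounded_mat_add bC bY form_bounded_pos[OF Y hermY])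
  have d: "Re (S t (\<lambda>i j. of_real C * idm i j + X i j) k k) \<le> 2 * C" for k
  proof -
    have "0 \<le> Re (of_real C * S t idm k k - S t X k k)" using form_pos_diag(2)[OF B, of k] unfolding SB .
    moreover have "C * Re (S t idm k k) \<le> C * 1" using C by (intro mult_left_mono S_idm_le t)
    ultimately show ?thesis unfolding SA by simp
  qed
  have "cmod (of_real C * S t idm n m + S t X n m) \<le> 4 * C"
    using form_pos_offdiag[OF A, of n m] d[of n] d[of m] unfolding SA by simp
  moreover have "cmod (of_real C * S t idm n m) \<le> C * 2"
    unfolding norm_mult norm_of_real using C by (intro mult_mono S_idm_entry t) auto
  ultimately show ?thesis
    using norm_triangle_ineq4[of "of_real C * S t idm n m + S t X n m" "of_real C * S t idm n m"] by simp
qed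

text \<open>The Cartesian decomposition \<open>x = h + i k\<close> into hermitian parts reduces this
  to the previous bound, used twice. The essential point is independence of
  \<open>t\<close>.\<close>

lemma S_entry_bound:
  assumes "bounded_mat x"
  obtains K where "\<And>t n m. 0 \<le> t \<Longrightarrow> cmod (S t x n m) \<le> K"
proof -
  obtain C where C: "form_bounded C x" using bounded_mat_imp_form_bounded[OF assms] .
  define a where "a = (\<lambda>i j. cnj (x j i))"
  have a: "form_bounded C a" unfolding a_def by (rule form_bounded_adjoint[OF C])
  define h where "h = (\<lambda>i j. (1/2) * x i j + (1/2) * a i j)"
  define k where "k = (\<lambda>i j. (-\<i>/2) * x i j + (\<i>/2) * a i j)"
  have fb: "form_bounded C (\<lambda>i j. \<alpha> * x i j + \<beta> * a i j)" if "cmod \<alpha> = 1/2" "cmod \<beta> = 1/2" for \<alpha> \<beta>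
    unfolding form_bounded_def form_add form_cmult
  proof (intro conjI allI)
    show "0 \<le> C" using C by (simp add: form_bounded_def)
    fix N v u
    have "cmod (\<alpha> * form N x v u + \<beta> * form N a v u) \<le> 1/2 * cmod (form N x v u) + 1/2 * cmod (form N a v u)"
      using norm_triangle_ineq[of "\<alpha> * form N x v u" "\<beta> * form N a v u"] unfolding norm_mult that .
    then show "cmod (\<alpha> * form N x v u + \<beta> * form N a v u) \<le> C * nrm N v * nrm N u"
      using form_boundedD[OF C, of N v u] form_boundedD[OF a, of N v u] by simp
  qed
  have h: "form_bounded C h" unfolding h_def by (rule fb) auto
  have k: "form_bounded C k" unfolding k_def by (rule fb) (auto simp: norm_divide)
  have hop: "h j i = cnj (h i j)" "k j i = cnj (k i j)" for i j
    unfolding h_def k_def a_def by (simp_all add: algebra_simps)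
  have bh: "bounded_mat h" and bk: "bounded_mat k"
    using form_bounded_mat(4)[OF h] form_bounded_mat(4)[OF k] .
  have x: "x = (\<lambda>i j. h i j + \<i> * k i j)"
    unfolding h_def k_def by (intro ext) (simp add: algebra_simps)
  have "cmod (S t x n m) \<le> 12 * C" if t: "0 \<le> t" for t n m
  proof -
    have "S t x n m = S t h n m + \<i> * S t k n m"
      by (subst x) (simp only: S_add[OF t bh bounded_mat_cmult[OF bk]] S_cmult[OF t bk])
    then have "cmod (S t x n m) \<le> cmod (S t h n m) + cmod (S t k n m)"
      using norm_triangle_ineq[of "S t h n m" "\<i> * S t k n m"] by (simp add: norm_mult)
    then show ?thesis
      using S_hermitian_entry[OF h hop(1) t, of n m] S_hermitian_entry[OF k hop(2) t, of n m] by simp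
  qed
  then show thesis by (rule that)
qed

lemma S_evol:
  assumes x: "bounded_mat x"
  obtains K where "evol K (\<lambda>t. iota lam mu (S t x))" "\<And>t n m. 0 \<le> t \<Longrightarrow> cmod (S t x n m) \<le> K"
proof -
  obtain K where K: "\<And>t n m. 0 \<le> t \<Longrightarrow> cmod (S t x n m) \<le> K" by (rule S_entry_bound[OF x]) blast
  have "evol K (\<lambda>t. iota lam mu (S t x))"
    by (rule evol_iota[OF qds_entry_eq[OF qds x]]) (rule K)
  then show thesis using K by (rule that)
qed

lemma S_0: "bounded_mat x \<Longrightarrow> S 0 x = x"
  using entry_eq_0[OF qds_entry_eq[OF qds]] .

lemma iota_inj: "iota lam mu x n m = iota lam mu y n m \<Longrightarrow> x n m = y n m"
  using c_pos[of n] c_pos[of m] by (simp add: iota_def)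

text \<open>The difference to the stationary solution \<open>idm\<close> is an evolution with
  initial value 0, which the energy estimate annihilates. Conservativity is thus derived from the
  decay of the weights.\<close>

lemma S_idm: "0 \<le> t \<Longrightarrow> S t idm = idm"
proof (intro ext)
  fix n m assume t: "0 \<le> t"
  obtain K where K: "evol K (\<lambda>t. iota lam mu (S t idm))" using S_evol[OF bounded_idm] .
  define z where "z = (\<lambda>t i j. iota lam mu (S t idm) i j - iota lam mu idm i j)"
  have z: "evol (K + 1) z" unfolding z_def by (rule evol_diff[OF K evol_idm])
  have z0: "z 0 = (\<lambda>i j. 0)" unfolding z_def S_0[OF bounded_idm] by simp
  have "box_sq (Suc (max n m)) (z t) \<le> (cmod 0)\<^sup>2 + exp (- (2 * kap * t)) * (0 - (cmod 0)\<^sup>2)"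
    by (rule evol_box_bound[OF z t]) (simp_all add: z0 box_sq_def state_part_def)
  then have "box_sq (Suc (max n m)) (z t) \<le> 0" by simp
  moreover have "(cmod (z t n m))\<^sup>2 \<le> box_sq (Suc (max n m)) (z t)" by (rule entry_le_box_sq) auto
  ultimately have "(cmod (z t n m))\<^sup>2 \<le> 0" by linarith
  then have "z t n m = 0" by simp
  then show "S t idm n m = idm n m" unfolding z_def
    using iota_inj[of "S t idm" n m idm] by simp
qed

end

section \<open>Hilbert-Schmidt matrices\<close>

text \<open>Squares are cofinal among the finite sets of index pairs; this turns unordered sums over
  pairs into limits of box sums.\<close>

lemma box_filterlim:
  "filterlim (\<lambda>N::nat. {..<N} \<times> {..<N}) (finite_subsets_at_top UNIV) sequentially"
  unfolding filterlim_finite_subsets_at_top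
proof (intro allI impI)
  fix X :: "(nat \<times> nat) set" assume X: "finite X \<and> X \<subseteq> UNIV"
  define B where "B = Suc (Max (insert 0 (fst ` X \<union> snd ` X)))"
  have "X \<subseteq> {..<N} \<times> {..<N}" if "B \<le> N" for N
  proof
    fix p assume p: "p \<in> X"
    have "fst p \<le> Max (insert 0 (fst ` X \<union> snd ` X))" "snd p \<le> Max (insert 0 (fst ` X \<union> snd ` X))"
      using p X by (intro Max_ge; auto)+
    then show "p \<in> {..<N} \<times> {..<N}" using that unfolding B_def by (cases p) auto
  qed
  then show "\<forall>\<^sub>F N in sequentially. finite ({..<N} \<times> {..<N}) \<and> X \<subseteq> {..<N} \<times> {..<N} \<and> {..<N} \<times> {..<N} \<subseteq> UNIV"
    by (intro eventually_sequentiallyI[of B]) auto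
qed

lemma box_tendsto:
  fixes f :: "nat \<times> nat \<Rightarrow> 'a::{comm_monoid_add,t2_space}"
  assumes "f summable_on UNIV"
  shows "(\<lambda>N. \<Sum>n<N. \<Sum>m<N. f (n, m)) \<longlonglongrightarrow> infsum f UNIV"
proof -
  have "(sum f \<longlongrightarrow> infsum f UNIV) (finite_subsets_at_top UNIV)"
    using has_sum_infsum[OF assms] by (simp add: has_sum_def)
  from filterlim_compose[OF this box_filterlim] show ?thesis
    by (simp add: sum.cartesian_product)
qed

lemma box_sq_eq: "box_sq N X = sum (\<lambda>(i, j). (cmod (X i j))\<^sup>2) ({..<N} \<times> {..<N})"
  by (simp add: box_sq_def sum.cartesian_product)

lemma hs_iff: "hs X \<longleftrightarrow> (\<exists>B. \<forall>N. box_sq N X \<le> B)"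
proof
  assume "hs X"
  then have s: "(\<lambda>(i, j). (cmod (X i j))\<^sup>2) summable_on UNIV" by (simp add: hs_def)
  have "box_sq N X \<le> infsum (\<lambda>(i, j). (cmod (X i j))\<^sup>2) UNIV" for N
    unfolding box_sq_eq by (rule finite_sum_le_infsum[OF s]) auto
  then show "\<exists>B. \<forall>N. box_sq N X \<le> B" by blast
next
  assume "\<exists>B. \<forall>N. box_sq N X \<le> B"
  then obtain B where B: "\<And>N. box_sq N X \<le> B" by blast
  show "hs X" unfolding hs_def
  proof (rule nonneg_bdd_above_summable_on)
    show "bdd_above (sum (\<lambda>(i, j). (cmod (X i j))\<^sup>2) ` {F. F \<subseteq> UNIV \<and> finite F})"
    proof (rule bdd_aboveI2)
      fix F :: "(nat \<times> nat) set" assume "F \<in> {F. F \<subseteq> UNIV \<and> finite F}"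
      then have "finite F" by simp
      then have "\<forall>\<^sub>F N in sequentially. F \<subseteq> {..<N} \<times> {..<N}"
        using box_filterlim unfolding filterlim_finite_subsets_at_top by (auto elim: eventually_mono)
      then obtain N where N: "F \<subseteq> {..<N} \<times> {..<N}" unfolding eventually_sequentially by blast
      have "sum (\<lambda>(i, j). (cmod (X i j))\<^sup>2) F \<le> box_sq N X"
        unfolding box_sq_eq using N by (intro sum_mono2) auto
      then show "sum (\<lambda>(i, j). (cmod (X i j))\<^sup>2) F \<le> B" using B[of N] by linarith
    qed
  qed auto
qed

lemma box_sq_tendsto: "hs X \<Longrightarrow> (\<lambda>N. box_sq N X) \<longlonglongrightarrow> (hs_norm X)\<^sup>2"
proof -
  assume "hs X"
  then have s: "(\<lambda>(i, j). (cmod (X i j))\<^sup>2) summable_on UNIV" by (simp add: hs_def)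
  have "(\<lambda>N. box_sq N X) \<longlonglongrightarrow> infsum (\<lambda>(i, j). (cmod (X i j))\<^sup>2) UNIV"
    using box_tendsto[OF s] by (simp add: box_sq_def)
  moreover have "0 \<le> infsum (\<lambda>(i, j). (cmod (X i j))\<^sup>2) (UNIV :: (nat \<times> nat) set)"
    by (rule infsum_nonneg) auto
  ultimately show ?thesis by (simp add: hs_norm_def)
qed

lemma hs_norm_nonneg: "0 \<le> hs_norm X"
  unfolding hs_norm_def by (intro real_sqrt_ge_zero infsum_nonneg) auto

lemma box_sq_le_hs_norm: "hs X \<Longrightarrow> box_sq N X \<le> (hs_norm X)\<^sup>2"
  by (rule LIMSEQ_le_const[OF box_sq_tendsto]) (auto intro: box_sq_mono)

lemma hs_norm_le: "(\<And>N. box_sq N X \<le> B) \<Longrightarrow> (hs_norm X)\<^sup>2 \<le> B"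
proof -
  assume B: "\<And>N. box_sq N X \<le> B"
  then have "hs X" unfolding hs_iff by blast
  from LIMSEQ_le_const2[OF box_sq_tendsto[OF this]] B show ?thesis by blast
qed

lemma entry_le_hs_norm: "hs X \<Longrightarrow> cmod (X n m) \<le> hs_norm X"
proof -
  assume X: "hs X"
  have "(cmod (X n m))\<^sup>2 \<le> box_sq (Suc (max n m)) X" by (rule entry_le_box_sq) auto
  also have "\<dots> \<le> (hs_norm X)\<^sup>2" by (rule box_sq_le_hs_norm[OF X])
  finally show ?thesis using hs_norm_nonneg by (rule power2_le_imp_le)
qed

definition ipB :: "nat \<Rightarrow> mat \<Rightarrow> mat \<Rightarrow> complex" where
  "ipB N X Y = (\<Sum>n<N. \<Sum>m<N. cnj (X n m) * Y n m)"

lemma Re_ipB_le: "2 * Re (ipB N X Y) \<le> box_sq N X + box_sq N Y"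
proof -
  have "2 * Re (ipB N X Y) = (\<Sum>n<N. \<Sum>m<N. 2 * Re (cnj (X n m) * Y n m))"
    by (simp add: ipB_def sum_distrib_left)
  also have "\<dots> \<le> (\<Sum>n<N. \<Sum>m<N. (cmod (X n m))\<^sup>2 + (cmod (Y n m))\<^sup>2)"
  proof (intro sum_mono)
    fix n m
    have "2 * Re (cnj (X n m) * Y n m) \<le> 2 * cmod (X n m) * cmod (Y n m)"
      using complex_Re_le_cmod[of "cnj (X n m) * Y n m"] by (simp add: norm_mult)
    also have "\<dots> \<le> (cmod (X n m))\<^sup>2 + (cmod (Y n m))\<^sup>2" by (rule sum_squares_bound)
    finally show "2 * Re (cnj (X n m) * Y n m) \<le> (cmod (X n m))\<^sup>2 + (cmod (Y n m))\<^sup>2" .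
  qed
  also have "\<dots> = box_sq N X + box_sq N Y" by (simp add: box_sq_def sum.distrib)
  finally show ?thesis .
qed

lemma ipB_self: "Re (ipB N X X) = box_sq N X"
  unfolding ipB_def box_sq_def cmod_power2 by (simp add: power2_eq_square)

lemma ipB_cs: "cmod (ipB N X Y) \<le> sqrt (box_sq N X) * sqrt (box_sq N Y)"
proof -
  let ?B = "{..<N} \<times> {..<N}"
  have "cmod (ipB N X Y) \<le> (\<Sum>p\<in>?B. \<bar>cmod (case p of (n, m) \<Rightarrow> X n m)\<bar> * \<bar>cmod (case p of (n, m) \<Rightarrow> Y n m)\<bar>)"
    unfolding ipB_def sum.cartesian_product
    by (rule sum_norm_le) (auto simp: norm_mult)
  also have "\<dots> \<le> L2_set (\<lambda>p. cmod (case p of (n, m) \<Rightarrow> X n m)) ?B * L2_set (\<lambda>p. cmod (case p of (n, m) \<Rightarrow> Y n m)) ?B"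
    by (rule L2_set_mult_ineq)
  also have "\<dots> = sqrt (box_sq N X) * sqrt (box_sq N Y)"
    unfolding L2_set_def box_sq_eq by (simp add: case_prod_unfold)
  finally show ?thesis .
qed

lemma hs_ip_tendsto:
  assumes X: "hs X" and Y: "hs Y"
  shows "(\<lambda>N. ipB N X Y) \<longlonglongrightarrow> hs_ip X Y"
proof -
  let ?f = "\<lambda>(i, j). cnj (X i j) * Y i j"
  have s: "(\<lambda>p. (case p of (i, j) \<Rightarrow> (cmod (X i j))\<^sup>2) + (case p of (i, j) \<Rightarrow> (cmod (Y i j))\<^sup>2)) summable_on UNIV"
    using X Y unfolding hs_def by (intro summable_on_add) auto
  have "(\<lambda>p. norm (?f p)) summable_on UNIV"
  proof (rule summable_on_comparison_test[OF s])
    fix p :: "nat \<times> nat"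
    obtain i j where p: "p = (i, j)" by (cases p)
    have "cmod (X i j) * cmod (Y i j) \<le> (cmod (X i j))\<^sup>2 + (cmod (Y i j))\<^sup>2"
    proof -
      have "0 \<le> cmod (X i j) * cmod (Y i j)" by simp
      then show ?thesis using sum_squares_bound[of "cmod (X i j)" "cmod (Y i j)"] by linarith
    qed
    then show "norm (?f p) \<le> (case p of (i, j) \<Rightarrow> (cmod (X i j))\<^sup>2) + (case p of (i, j) \<Rightarrow> (cmod (Y i j))\<^sup>2)"
      by (simp add: p norm_mult)
  qed auto
  then have "?f summable_on UNIV" by (rule abs_summable_summable)
  from box_tendsto[OF this] show ?thesis by (simp add: ipB_def hs_ip_def)
qed

lemma hs_ip_cs: "hs X \<Longrightarrow> hs Y \<Longrightarrow> cmod (hs_ip X Y) \<le> hs_norm X * hs_norm Y"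
proof -
  assume X: "hs X" and Y: "hs Y"
  have "(\<lambda>N. sqrt (box_sq N X) * sqrt (box_sq N Y)) \<longlonglongrightarrow> sqrt ((hs_norm X)\<^sup>2) * sqrt ((hs_norm Y)\<^sup>2)"
    by (intro tendsto_mult tendsto_real_sqrt box_sq_tendsto X Y)
  from LIMSEQ_le[OF tendsto_norm[OF hs_ip_tendsto[OF X Y]] this] ipB_cs
  show ?thesis by (auto simp: hs_norm_nonneg)
qed

lemma hs_add:
  assumes "hs X" "hs Y" shows "hs (\<lambda>i j. X i j + Y i j)"
  unfolding hs_iff
proof (intro exI allI)
  fix N
  have "box_sq N (\<lambda>i j. X i j + Y i j) \<le> (\<Sum>n<N. \<Sum>m<N. 2 * (cmod (X n m))\<^sup>2 + 2 * (cmod (Y n m))\<^sup>2)"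
    unfolding box_sq_def
  proof (intro sum_mono)
    fix n m
    have "(cmod (X n m + Y n m))\<^sup>2 \<le> (cmod (X n m) + cmod (Y n m))\<^sup>2"
      by (intro power_mono norm_triangle_ineq) auto
    also have "\<dots> \<le> 2 * (cmod (X n m))\<^sup>2 + 2 * (cmod (Y n m))\<^sup>2"
      using sum_squares_bound[of "cmod (X n m)" "cmod (Y n m)"] by (simp add: power2_sum)
    finally show "(cmod (X n m + Y n m))\<^sup>2 \<le> 2 * (cmod (X n m))\<^sup>2 + 2 * (cmod (Y n m))\<^sup>2" .
  qed
  also have "\<dots> = 2 * box_sq N X + 2 * box_sq N Y" by (simp add: box_sq_def sum.distrib sum_distrib_left)
  also have "\<dots> \<le> 2 * (hs_norm X)\<^sup>2 + 2 * (hs_norm Y)\<^sup>2"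
    using box_sq_le_hs_norm[OF assms(1), of N] box_sq_le_hs_norm[OF assms(2), of N] by linarith
  finally show "box_sq N (\<lambda>i j. X i j + Y i j) \<le> 2 * (hs_norm X)\<^sup>2 + 2 * (hs_norm Y)\<^sup>2" .
qed

lemma box_sq_cmult: "box_sq N (\<lambda>i j. a * X i j) = (cmod a)\<^sup>2 * box_sq N X"
  by (simp add: box_sq_def norm_mult power_mult_distrib sum_distrib_left)

lemma hs_cmult: assumes "hs X" shows "hs (\<lambda>i j. a * X i j)"
  unfolding hs_iff box_sq_cmult
  using box_sq_le_hs_norm[OF assms] mult_left_mono[of _ _ "(cmod a)\<^sup>2"] by (metis zero_le_power2)

lemma hs_diff: assumes "hs X" "hs Y" shows "hs (\<lambda>i j. X i j - Y i j)"
  using hs_add[OF assms(1) hs_cmult[OF assms(2), of "-1"]] by simp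

lemma hs_quotient: assumes "hs X" "hs Y" "hs Z" shows "hs (\<lambda>i j. (X i j - Y i j) / a - Z i j)"
  using hs_diff[OF hs_cmult[OF hs_diff[OF assms(1,2)], of "inverse a"] assms(3)]
  by (simp add: divide_inverse mult.commute)

definition box :: "nat \<Rightarrow> mat \<Rightarrow> mat" where
  "box N X = (\<lambda>i j. if i < N \<and> j < N then X i j else 0)"

definition supported :: "nat \<Rightarrow> mat \<Rightarrow> bool" where
  "supported N X \<longleftrightarrow> (\<forall>i j. \<not> (i < N \<and> j < N) \<longrightarrow> X i j = 0)"

lemma supported_box: "supported N (box N X)" by (simp add: supported_def box_def)

lemma supported_sum:
  fixes N M :: nat
  assumes "\<And>i j. \<not> (i < N \<and> j < N) \<Longrightarrow> f i j = (0::'a::comm_monoid_add)" "N \<le> M"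
  shows "(\<Sum>n<M. \<Sum>m<M. f n m) = (\<Sum>n<N. \<Sum>m<N. f n m)"
proof -
  have "(\<Sum>n<M. \<Sum>m<M. f n m) = (\<Sum>n<N. \<Sum>m<M. f n m)"
    by (rule sum.mono_neutral_right) (use assms(2) in \<open>auto intro!: sum.neutral assms(1)\<close>)
  also have "\<dots> = (\<Sum>n<N. \<Sum>m<N. f n m)"
    by (rule sum.cong[OF refl], rule sum.mono_neutral_right) (use assms(2) in \<open>auto intro!: assms(1)\<close>)
  finally show ?thesis .
qed

lemma supported_box_sq: "supported N X \<Longrightarrow> N \<le> M \<Longrightarrow> box_sq M X = box_sq N X"
  unfolding box_sq_def by (rule supported_sum) (auto simp: supported_def)

lemma supported_hs: "supported N X \<Longrightarrow> hs X"
  unfolding hs_iff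
proof (intro exI allI)
  fix M assume X: "supported N X"
  show "box_sq M X \<le> box_sq N X"
    using supported_box_sq[OF X, of M] box_sq_mono[of M N X] by (cases "N \<le> M") auto
qed

lemma supported_hs_norm: "supported N X \<Longrightarrow> (hs_norm X)\<^sup>2 = box_sq N X"
proof -
  assume X: "supported N X"
  have "(\<lambda>M. box_sq M X) \<longlonglongrightarrow> box_sq N X"
    by (intro tendsto_eventually eventually_sequentiallyI[of N] supported_box_sq[OF X])
  with box_sq_tendsto[OF supported_hs[OF X]] show ?thesis by (rule LIMSEQ_unique)
qed

lemma supported_hs_ip: "supported N X \<Longrightarrow> hs Y \<Longrightarrow> hs_ip X Y = ipB N X Y"
proof -
  assume X: "supported N X" and Y: "hs Y"
  have "ipB M X Y = ipB N X Y" if "N \<le> M" for M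
    unfolding ipB_def using that X by (intro supported_sum) (auto simp: supported_def)
  then have "(\<lambda>M. ipB M X Y) \<longlonglongrightarrow> ipB N X Y"
    by (intro tendsto_eventually eventually_sequentiallyI[of N])
  with hs_ip_tendsto[OF supported_hs[OF X] Y] show ?thesis by (rule LIMSEQ_unique)
qed

lemma supported_bounded_mat:
  assumes X: "supported N X" shows "bounded_mat X"
proof -
  have "form_bounded (\<Sum>n<N. \<Sum>m<N. cmod (X n m)) X"
    unfolding form_bounded_def
  proof (intro conjI allI)
    show "0 \<le> (\<Sum>n<N. \<Sum>m<N. cmod (X n m))" by (intro sum_nonneg) auto
    fix M v u
    have le: "cmod (w n) \<le> nrm M w" if "n < M" for w :: vec and n
      using that by (intro member_le_L2_set) auto
    have "cmod (form M X v u) \<le> (\<Sum>n<M. \<Sum>m<M. cmod (cnj (v n) * X n m * u m))"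
      unfolding form_def by (intro sum_norm_le norm_sum)
    also have "\<dots> \<le> (\<Sum>n<M. \<Sum>m<M. cmod (X n m) * (nrm M v * nrm M u))"
    proof (intro sum_mono)
      fix n m assume "n \<in> {..<M}" "m \<in> {..<M}"
      then have "cmod (X n m) * (cmod (v n) * cmod (u m)) \<le> cmod (X n m) * (nrm M v * nrm M u)"
        by (intro mult_left_mono mult_mono le) auto
      then show "cmod (cnj (v n) * X n m * u m) \<le> cmod (X n m) * (nrm M v * nrm M u)"
        by (simp add: norm_mult mult_ac)
    qed
    also have "\<dots> = (\<Sum>n<M. \<Sum>m<M. cmod (X n m)) * nrm M v * nrm M u"
      by (simp only: sum_distrib_right mult.assoc)
    also have "\<dots> \<le> (\<Sum>n<N. \<Sum>m<N. cmod (X n m)) * nrm M v * nrm M u"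
    proof (intro mult_right_mono L2_set_nonneg)
      have "(\<Sum>n<M. \<Sum>m<M. cmod (X n m)) \<le> (\<Sum>n<max M N. \<Sum>m<max M N. cmod (X n m))"
        by (rule order_trans[OF sum_mono[OF sum_mono2] sum_mono2]) (auto intro: sum_nonneg)
      also have "\<dots> = (\<Sum>n<N. \<Sum>m<N. cmod (X n m))"
        using X by (intro supported_sum) (auto simp: supported_def)
      finally show "(\<Sum>n<M. \<Sum>m<M. cmod (X n m)) \<le> (\<Sum>n<N. \<Sum>m<N. cmod (X n m))" .
    qed
    finally show "cmod (form M X v u) \<le> (\<Sum>n<N. \<Sum>m<N. cmod (X n m)) * nrm M v * nrm M u" .
  qed
  then show ?thesis by (rule form_bounded_mat(4))
qed

lemma box_sq_box_diff:
  assumes "N \<le> M" shows "box_sq M (\<lambda>i j. X i j - box N X i j) = box_sq M X - box_sq N X"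
proof -
  have "box_sq M X = (\<Sum>n<M. \<Sum>m<M. (cmod (X n m - box N X n m))\<^sup>2 + (cmod (box N X n m))\<^sup>2)"
    unfolding box_sq_def by (intro sum.cong refl) (simp add: box_def)
  also have "\<dots> = box_sq M (\<lambda>i j. X i j - box N X i j) + box_sq M (box N X)"
    by (simp add: box_sq_def sum.distrib)
  also have "box_sq M (box N X) = box_sq N (box N X)" by (rule supported_box_sq[OF supported_box assms])
  also have "box_sq N (box N X) = box_sq N X" unfolding box_sq_def by (intro sum.cong refl) (simp add: box_def)
  finally show ?thesis by simp
qed

lemma hs_box_tendsto:
  assumes X: "hs X" shows "(\<lambda>N. hs_norm (\<lambda>i j. X i j - box N X i j)) \<longlonglongrightarrow> 0"
proof -
  have le: "hs_norm (\<lambda>i j. X i j - box N X i j) \<le> sqrt ((hs_norm X)\<^sup>2 - box_sq N X)" for N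
  proof (rule real_le_rsqrt, rule hs_norm_le)
    fix M
    have "box_sq M (\<lambda>i j. X i j - box N X i j) \<le> box_sq (max M N) (\<lambda>i j. X i j - box N X i j)"
      by (rule box_sq_mono) simp
    also have "\<dots> = box_sq (max M N) X - box_sq N X" by (rule box_sq_box_diff) simp
    also have "\<dots> \<le> (hs_norm X)\<^sup>2 - box_sq N X" using box_sq_le_hs_norm[OF X] by simp
    finally show "box_sq M (\<lambda>i j. X i j - box N X i j) \<le> (hs_norm X)\<^sup>2 - box_sq N X" .
  qed
  have "(\<lambda>N. sqrt ((hs_norm X)\<^sup>2 - box_sq N X)) \<longlonglongrightarrow> sqrt ((hs_norm X)\<^sup>2 - (hs_norm X)\<^sup>2)"
    by (intro tendsto_real_sqrt tendsto_diff tendsto_const box_sq_tendsto X)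
  then have lim: "(\<lambda>N. sqrt ((hs_norm X)\<^sup>2 - box_sq N X)) \<longlonglongrightarrow> 0" by simp
  show ?thesis
    by (rule tendsto_sandwich[OF _ _ tendsto_const lim]) (use hs_norm_nonneg le in auto)
qed

text \<open>Outside a large box the tail of the majorant takes over; inside only finitely many
  entries have to converge.\<close>

lemma hs_dominated_convergence:
  fixes Q :: "'a \<Rightarrow> mat"
  assumes b: "hs b" and dom: "\<forall>\<^sub>F t in F. \<forall>n m. cmod (Q t n m) \<le> cmod (b n m)"
    and lim: "\<And>n m. ((\<lambda>t. Q t n m) \<longlongrightarrow> 0) F"
  shows "((\<lambda>t. hs_norm (Q t)) \<longlongrightarrow> 0) F"
proof -
  have "((\<lambda>t. (hs_norm (Q t))\<^sup>2) \<longlongrightarrow> 0) F"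
  proof (rule tendstoI)
    fix e :: real assume e: "0 < e"
    have "\<forall>\<^sub>F N in sequentially. dist (box_sq N b) ((hs_norm b)\<^sup>2) < e / 2"
      using box_sq_tendsto[OF b] e by (intro tendstoD) auto
    then obtain N where N: "dist (box_sq N b) ((hs_norm b)\<^sup>2) < e / 2"
      unfolding eventually_sequentially by blast
    have "((\<lambda>t. box_sq N (Q t)) \<longlongrightarrow> (\<Sum>n<N. \<Sum>m<N. (cmod 0)\<^sup>2)) F"
      unfolding box_sq_def by (intro tendsto_sum tendsto_power tendsto_norm lim)
    then have "\<forall>\<^sub>F t in F. dist (box_sq N (Q t)) 0 < e / 2" using e by (intro tendstoD) auto
    with dom show "\<forall>\<^sub>F t in F. dist ((hs_norm (Q t))\<^sup>2) 0 < e"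
    proof eventually_elim
      case (elim t)
      have "box_sq M (Q t) \<le> box_sq N (Q t) + ((hs_norm b)\<^sup>2 - box_sq N b)" for M
      proof -
        let ?M = "max M N"
        have "box_sq M (Q t) \<le> box_sq ?M (Q t)" by (rule box_sq_mono) simp
        also have "\<dots> = box_sq N (Q t) + box_sq ?M (\<lambda>i j. Q t i j - box N (Q t) i j)"
          by (subst box_sq_box_diff) auto
        also have "box_sq ?M (\<lambda>i j. Q t i j - box N (Q t) i j) \<le> box_sq ?M (\<lambda>i j. b i j - box N b i j)"
          unfolding box_sq_def using elim(1) by (intro sum_mono power_mono) (auto simp: box_def)
        also have "\<dots> = box_sq ?M b - box_sq N b" by (rule box_sq_box_diff) simp
        also have "\<dots> \<le> (hs_norm b)\<^sup>2 - box_sq N b" using box_sq_le_hs_norm[OF b] by simp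
        finally show ?thesis by simp
      qed
      then have "(hs_norm (Q t))\<^sup>2 \<le> box_sq N (Q t) + ((hs_norm b)\<^sup>2 - box_sq N b)" by (rule hs_norm_le)
      moreover have "box_sq N (Q t) < e / 2" "(hs_norm b)\<^sup>2 - box_sq N b < e / 2"
        using elim(2) N unfolding dist_real_def by linarith+
      ultimately have "(hs_norm (Q t))\<^sup>2 < e" by linarith
      then show ?case by (simp add: dist_real_def)
    qed
  qed
  then have "((\<lambda>t. sqrt ((hs_norm (Q t))\<^sup>2)) \<longlongrightarrow> sqrt 0) F" by (rule tendsto_real_sqrt)
  then show ?thesis by (simp add: hs_norm_nonneg)
qed

section \<open>The semigroup on Hilbert-Schmidt matrices\<close>

locale qfull = qmin +
  fixes T :: "real \<Rightarrow> mat \<Rightarrow> mat"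
  assumes hsT: "hs_semigroup_of lam mu S T"
begin

lemmas T_parts = hsT[unfolded hs_semigroup_of_def, THEN spec, THEN mp]

lemma T_hs: "0 \<le> t \<Longrightarrow> hs X \<Longrightarrow> hs (T t X)"
  by (rule T_parts[THEN conjunct1, rule_format])

lemma T_diff:
  assumes t: "0 \<le> t" and X: "hs X" and Y: "hs Y"
  shows "T t (\<lambda>i j. X i j - Y i j) n m = T t X n m - T t Y n m"
proof -
  have "T t (\<lambda>i j. X i j + (-1) * Y i j) = (\<lambda>i j. T t X i j + T t (\<lambda>i j. (-1) * Y i j) i j)"
    by (rule T_parts[OF t, THEN conjunct2, THEN conjunct1, rule_format, OF X hs_cmult[OF Y]])
  moreover have "T t (\<lambda>i j. (-1) * Y i j) = (\<lambda>i j. (-1) * T t Y i j)"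
    by (rule T_parts[OF t, THEN conjunct2, THEN conjunct2, THEN conjunct1, rule_format, OF Y])
  ultimately show ?thesis by simp
qed

lemma T_norm:
  assumes "0 \<le> t" obtains C where "\<And>X. hs X \<Longrightarrow> hs_norm (T t X) \<le> C * hs_norm X"
  using T_parts[OF assms, THEN conjunct2, THEN conjunct2, THEN conjunct2, THEN conjunct1] by blast

lemma T_iota:
  assumes "0 \<le> t" "bounded_mat x" shows "T t (iota lam mu x) = iota lam mu (S t x)"
  by (rule T_parts[OF assms(1), THEN conjunct2, THEN conjunct2, THEN conjunct2, THEN conjunct2, rule_format, OF assms(2)])

text \<open>Dividing by the weights is harmless on a finite support. Such matrices therefore come
  from bounded ones, where \<open>T t\<close> is prescribed by \<open>S t\<close>.\<close>

lemma supported_iota: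
  assumes X: "supported N X"
  obtains x where "X = iota lam mu x" "bounded_mat x"
proof -
  define x where "x = (\<lambda>i j. X i j / (of_real (c i) * of_real (c j)))"
  have "X = iota lam mu x"
  proof (intro ext)
    fix i j show "X i j = iota lam mu x i j"
      using c_pos[of i] c_pos[of j] by (simp add: iota_def x_def)
  qed
  moreover have "supported N x" using X by (auto simp: supported_def x_def)
  ultimately show thesis using that supported_bounded_mat by blast
qed

lemma T_supported_bound:
  assumes X: "supported N X" and t: "0 \<le> t"
  shows "box_sq M (T t X) \<le> (cmod (state_part N X))\<^sup>2 + exp (- (2 * kap * t)) * (box_sq N X - (cmod (state_part N X))\<^sup>2)"
proof -
  obtain x where x: "X = iota lam mu x" "bounded_mat x" using supported_iota[OF X] .
  obtain K where K: "evol K (\<lambda>t. iota lam mu (S t x))" using S_evol[OF x(2)] .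
  have T: "T t X = iota lam mu (S t x)" unfolding x(1) by (rule T_iota[OF t x(2)])
  have z0: "iota lam mu (S 0 x) = X" using S_0[OF x(2)] x(1) by simp
  have W: "state_part M' X = state_part N X" if "N \<le> M'" for M'
    unfolding state_part_def using that X by (intro sum.mono_neutral_right) (auto simp: supported_def)
  show ?thesis unfolding T
  proof (rule evol_box_bound[OF K t], unfold z0)
    show "(\<lambda>N. box_sq N X) \<longlonglongrightarrow> box_sq N X"
      using box_sq_tendsto[OF supported_hs[OF X]] supported_hs_norm[OF X] by simp
    show "(\<lambda>N. state_part N X) \<longlonglongrightarrow> state_part N X"
      by (intro tendsto_eventually eventually_sequentiallyI[of N] W)
  qed
qed

definition root_rho :: mat where "root_rho = iota lam mu idm"

lemma root_rho_entry: "root_rho n m = (if n = m then of_real (w n) else 0)"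
  unfolding root_rho_def iota_def idm_def c_sq[symmetric] by simp

lemma hs_root_rho: "hs root_rho"
  unfolding hs_iff
proof (intro exI allI)
  fix N
  have "box_sq N root_rho = (\<Sum>n<N. \<Sum>m<N. if n = m then (w n)\<^sup>2 else 0)"
    unfolding box_sq_def root_rho_entry by (intro sum.cong refl) (auto simp: w_pos less_imp_le)
  also have "\<dots> = (\<Sum>n<N. (w n)\<^sup>2)" by (intro sum.cong refl) (simp add: sum.delta')
  also have "\<dots> \<le> 1" by (rule sum_w_sq_le)
  finally show "box_sq N root_rho \<le> 1" .
qed

lemma ipB_root_rho: "ipB N root_rho X = state_part N X"
proof -
  have "ipB N root_rho X = (\<Sum>n<N. \<Sum>m<N. if n = m then of_real (w n) * X n n else 0)"
    unfolding ipB_def root_rho_entry by (intro sum.cong refl) auto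
  also have "\<dots> = state_part N X" unfolding state_part_def by (intro sum.cong refl) (simp add: sum.delta')
  finally show ?thesis .
qed

lemma state_part_tendsto: "hs X \<Longrightarrow> (\<lambda>N. state_part N X) \<longlonglongrightarrow> hs_ip root_rho X"
  using hs_ip_tendsto[OF hs_root_rho] by (simp add: ipB_root_rho)

text \<open>Density of finitely supported matrices. The unspecified norm bound of \<open>T t\<close>
  serves only to make entries converge; the sharp inequality then passes to the limit.\<close>

lemma T_bound:
  assumes X: "hs X" and t: "0 \<le> t"
  shows "(hs_norm (T t X))\<^sup>2 \<le> (cmod (hs_ip root_rho X))\<^sup>2 + exp (- (2 * kap * t)) * ((hs_norm X)\<^sup>2 - (cmod (hs_ip root_rho X))\<^sup>2)"
proof (rule hs_norm_le)
  fix M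
  obtain C where C: "\<And>X. hs X \<Longrightarrow> hs_norm (T t X) \<le> C * hs_norm X" using T_norm[OF t] by blast
  have hb: "hs (box N X)" for N by (rule supported_hs[OF supported_box])
  have lim: "(\<lambda>N. T t (box N X) n m) \<longlonglongrightarrow> T t X n m" for n m
  proof -
    have le: "cmod (T t (box N X) n m - T t X n m) \<le> C * hs_norm (\<lambda>i j. X i j - box N X i j)" for N
    proof -
      have "cmod (T t (box N X) n m - T t X n m) = cmod (T t (\<lambda>i j. X i j - box N X i j) n m)"
        unfolding T_diff[OF t X hb] by (rule norm_minus_commute)
      also have "\<dots> \<le> hs_norm (T t (\<lambda>i j. X i j - box N X i j))"
        by (intro entry_le_hs_norm T_hs t hs_diff X hb)
      also have "\<dots> \<le> C * hs_norm (\<lambda>i j. X i j - box N X i j)" by (intro C hs_diff X hb)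
      finally show ?thesis .
    qed
    have "(\<lambda>N. C * hs_norm (\<lambda>i j. X i j - box N X i j)) \<longlonglongrightarrow> C * 0"
      by (intro tendsto_mult tendsto_const hs_box_tendsto X)
    then have "(\<lambda>N. T t (box N X) n m - T t X n m) \<longlonglongrightarrow> 0"
      using Lim_null_comparison[OF always_eventually[OF allI[OF le]]] by simp
    then show ?thesis using LIM_zero_iff by blast
  qed
  have box_sq: "(\<lambda>N. box_sq M (T t (box N X))) \<longlonglongrightarrow> box_sq M (T t X)"
    unfolding box_sq_def by (intro tendsto_sum tendsto_power tendsto_norm lim)
  let ?b = "\<lambda>N. (cmod (state_part N X))\<^sup>2 + exp (- (2 * kap * t)) * (box_sq N X - (cmod (state_part N X))\<^sup>2)"
  have b: "?b \<longlonglongrightarrow> (cmod (hs_ip root_rho X))\<^sup>2 + exp (- (2 * kap * t)) * ((hs_norm X)\<^sup>2 - (cmod (hs_ip root_rho X))\<^sup>2)"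
    by (intro tendsto_add tendsto_mult tendsto_const tendsto_diff tendsto_power tendsto_norm box_sq_tendsto state_part_tendsto X)
  have le: "box_sq M (T t (box N X)) \<le> ?b N" for N
  proof -
    have "box_sq N (box N X) = box_sq N X" "state_part N (box N X) = state_part N X"
      unfolding box_sq_def state_part_def by (intro sum.cong refl; simp add: box_def)+
    then show ?thesis using T_supported_bound[OF supported_box t, of M N X] by simp
  qed
  show "box_sq M (T t X) \<le> (cmod (hs_ip root_rho X))\<^sup>2 + exp (- (2 * kap * t)) * ((hs_norm X)\<^sup>2 - (cmod (hs_ip root_rho X))\<^sup>2)"
    by (rule LIMSEQ_le[OF box_sq b]) (use le in blast)
qed

section \<open>Dissipativity of the generator and its invariant vector\<close>

abbreviation quot :: "mat \<Rightarrow> real \<Rightarrow> mat" where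
  "quot X t \<equiv> \<lambda>i j. (T t X i j - X i j) / of_real t"

lemma gen_rel_entry:
  assumes X: "hs X" and Y: "gen_rel T X Y"
  shows "((\<lambda>t. quot X t n m) \<longlongrightarrow> Y n m) (at_right 0)"
proof -
  have hY: "hs Y" and lim: "((\<lambda>t. hs_norm (\<lambda>i j. quot X t i j - Y i j)) \<longlongrightarrow> 0) (at_right 0)"
    using Y by (auto simp: gen_rel_def)
  have "\<forall>\<^sub>F t in at_right 0. norm (quot X t n m - Y n m) \<le> hs_norm (\<lambda>i j. quot X t i j - Y i j)"
    using eventually_at_right_less[of "0::real"]
  proof eventually_elim
    case (elim t)
    then show ?case by (intro entry_le_hs_norm hs_quotient T_hs X hY) auto
  qed
  from Lim_null_comparison[OF this lim] show ?thesis using LIM_zero_iff by blast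
qed

text \<open>Convergence in Hilbert-Schmidt norm determines every entry of the limit, so the choice
  in \<open>gen\<close> returns it.\<close>

lemma gen_eq:
  assumes X: "hs X" and Y: "gen_rel T X Y" shows "gen T X = Y"
  unfolding gen_def
proof (rule some_equality[where P = "gen_rel T X", OF Y])
  fix Z assume Z: "gen_rel T X Z"
  show "Z = Y"
    by (intro ext tendsto_unique[OF _ gen_rel_entry[OF X Z] gen_rel_entry[OF X Y]]) simp
qed

lemma ipB_diff_scale:
  "ipB N X (\<lambda>i j. (Y i j - X i j) / of_real t) = (ipB N X Y - ipB N X X) / of_real t"
  unfolding ipB_def by (simp add: sum_subtractf[symmetric] sum_divide_distrib right_diff_distrib diff_divide_distrib)

lemma hs_ip_diff:
  assumes "hs X" "hs Y" "hs Z" shows "hs_ip X (\<lambda>i j. Y i j - Z i j) = hs_ip X Y - hs_ip X Z"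
proof (rule LIMSEQ_unique[OF hs_ip_tendsto[OF assms(1) hs_diff[OF assms(2,3)]]])
  have "ipB N X (\<lambda>i j. Y i j - Z i j) = ipB N X Y - ipB N X Z" for N
    unfolding ipB_def by (simp add: right_diff_distrib sum_subtractf)
  then show "(\<lambda>N. ipB N X (\<lambda>i j. Y i j - Z i j)) \<longlonglongrightarrow> hs_ip X Y - hs_ip X Z"
    by (simp only:) (intro tendsto_diff hs_ip_tendsto assms)
qed

text \<open>The real part of the pairing of \<open>X\<close> with \<open>T t X\<close> is at most
  half the sum of the squared norms, so the difference quotient is bounded by the change of the
  squared norm over \<open>2 * t\<close>. The decay bound and the derivative of
  \<open>exp (- 2 * kap * t)\<close> at 0 then give the factor \<open>kap\<close>.\<close>

lemma dissipation:
  assumes X: "hs X" and Y: "gen_rel T X Y"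
  shows "Re (hs_ip X Y) \<le> - kap * ((hs_norm X)\<^sup>2 - (cmod (hs_ip root_rho X))\<^sup>2)"
proof -
  let ?D = "(hs_norm X)\<^sup>2 - (cmod (hs_ip root_rho X))\<^sup>2"
  have hY: "hs Y" and lim: "((\<lambda>t. hs_norm (\<lambda>i j. quot X t i j - Y i j)) \<longlongrightarrow> 0) (at_right 0)"
    using Y by (auto simp: gen_rel_def)
  have hq: "hs (quot X t)" if "0 < t" for t
  proof -
    have "hs (\<lambda>i j. (T t X i j - X i j) / of_real t - (\<lambda>i j. 0) i j)"
      by (intro hs_quotient T_hs X supported_hs[of 0]) (use that in \<open>auto simp: supported_def\<close>)
    then show ?thesis by simp
  qed
  have conv: "((\<lambda>t. Re (hs_ip X (quot X t))) \<longlongrightarrow> Re (hs_ip X Y)) (at_right 0)"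
  proof -
    have "\<forall>\<^sub>F t in at_right 0. norm (hs_ip X (quot X t) - hs_ip X Y) \<le> hs_norm X * hs_norm (\<lambda>i j. quot X t i j - Y i j)"
      using eventually_at_right_less[of "0::real"]
    proof eventually_elim
      case (elim t)
      show ?case unfolding hs_ip_diff[OF X hq[OF elim] hY, symmetric]
        by (intro hs_ip_cs X hs_diff hq[OF elim] hY)
    qed
    moreover have "((\<lambda>t. hs_norm X * hs_norm (\<lambda>i j. quot X t i j - Y i j)) \<longlongrightarrow> 0) (at_right 0)"
      using tendsto_mult[OF tendsto_const lim, of "hs_norm X"] by simp
    ultimately have "((\<lambda>t. hs_ip X (quot X t) - hs_ip X Y) \<longlongrightarrow> 0) (at_right 0)" by (rule Lim_null_comparison)
    then show ?thesis by (rule tendsto_Re[OF iffD1[OF LIM_zero_iff]])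
  qed
  have le: "Re (hs_ip X (quot X t)) \<le> (exp (- (2 * kap * t)) - 1) / t * (?D / 2)" if t: "0 < t" for t
  proof -
    have TX: "hs (T t X)" using t by (intro T_hs X) auto
    have l1: "(\<lambda>N. Re (ipB N X (quot X t))) \<longlonglongrightarrow> Re (hs_ip X (quot X t))"
      by (intro tendsto_Re hs_ip_tendsto X hq t)
    have l2: "(\<lambda>N. (box_sq N (T t X) - box_sq N X) / (2 * t)) \<longlonglongrightarrow> ((hs_norm (T t X))\<^sup>2 - (hs_norm X)\<^sup>2) / (2 * t)"
      using t by (intro tendsto_divide tendsto_diff tendsto_const box_sq_tendsto X TX) auto
    have "Re (ipB N X (quot X t)) \<le> (box_sq N (T t X) - box_sq N X) / (2 * t)" for N
    proof -
      have "Re (ipB N X (quot X t)) = (Re (ipB N X (T t X)) - box_sq N X) / t"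
        unfolding ipB_diff_scale Re_divide_of_real minus_complex.simps ipB_self ..
      also have "\<dots> = (2 * Re (ipB N X (T t X)) - 2 * box_sq N X) / (2 * t)" using t by (simp add: field_simps)
      also have "\<dots> \<le> (box_sq N (T t X) - box_sq N X) / (2 * t)"
        using t Re_ipB_le[of N X "T t X"] by (intro divide_right_mono) auto
      finally show ?thesis .
    qed
    then have "Re (hs_ip X (quot X t)) \<le> ((hs_norm (T t X))\<^sup>2 - (hs_norm X)\<^sup>2) / (2 * t)"
      using LIMSEQ_le[OF l1 l2] by blast
    also have "\<dots> \<le> ((exp (- (2 * kap * t)) - 1) * ?D) / (2 * t)"
    proof (rule divide_right_mono)
      show "(hs_norm (T t X))\<^sup>2 - (hs_norm X)\<^sup>2 \<le> (exp (- (2 * kap * t)) - 1) * ?D"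
        using T_bound[OF X less_imp_le[OF t]] by (simp add: algebra_simps)
    qed (use t in auto)
    finally show ?thesis by simp
  qed
  have "((\<lambda>t. exp (- (2 * kap * t))) has_real_derivative (- (2 * kap))) (at 0)"
    by (auto intro!: derivative_eq_intros)
  then have "((\<lambda>t. (exp (- (2 * kap * t)) - 1) / t) \<longlongrightarrow> - (2 * kap)) (at 0)"
    by (simp add: has_field_derivative_iff)
  then have "((\<lambda>t. (exp (- (2 * kap * t)) - 1) / t) \<longlongrightarrow> - (2 * kap)) (at_right 0)"
    by (rule tendsto_mono[OF at_le, rotated]) simp
  then have "((\<lambda>t. (exp (- (2 * kap * t)) - 1) / t * (?D / 2)) \<longlongrightarrow> - (2 * kap) * (?D / 2)) (at_right 0)"
    by (intro tendsto_mult tendsto_const)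
  moreover have "\<forall>\<^sub>F t in at_right 0. Re (hs_ip X (quot X t)) \<le> (exp (- (2 * kap * t)) - 1) / t * (?D / 2)"
    using eventually_at_right_less[of "0::real"] by eventually_elim (rule le)
  ultimately have "Re (hs_ip X Y) \<le> - (2 * kap) * (?D / 2)"
    using conv by (intro tendsto_le[of "at_right (0::real)"]) auto
  then show ?thesis by simp
qed

lemma gen_root_rho: "gen_rel T root_rho (\<lambda>i j. 0)"
  unfolding gen_rel_def
proof
  show h0: "hs (\<lambda>i j. 0)" by (rule supported_hs[of 0]) (simp add: supported_def)
  have n0: "hs_norm (\<lambda>i j. 0) = 0" by (simp add: hs_norm_def case_prod_unfold)
  have TW: "T t root_rho = root_rho" if "0 < t" for t
    unfolding root_rho_def using T_iota[OF _ bounded_idm, of t] S_idm[of t] that by simp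
  show "((\<lambda>t. hs_norm (\<lambda>i j. quot root_rho t i j - 0)) \<longlongrightarrow> 0) (at_right 0)"
    by (rule tendsto_eventually, rule eventually_mono[OF eventually_at_right_less[of "0::real"]])
      (simp add: TW n0)
qed

section \<open>Finitely supported matrices belong to the domain\<close>

lemma gd_bound: "cmod (gd n) \<le> (lam\<^sup>2 / 2 + \<bar>zp\<bar> + (mu\<^sup>2 / 2 + \<bar>zm\<bar>)) * ((1 + r) * (real n + 1)\<^sup>2)"
proof -
  let ?o = "(1 + r) * (real n + 1)\<^sup>2"
  have o: "om n \<le> ?o" "om (Suc n) \<le> ?o" using om_Suc_le[of n] om_mono[of n "Suc n"] by auto
  have a: "cmod (of_real (x\<^sup>2 / 2) + \<i> * of_real y) \<le> x\<^sup>2 / 2 + \<bar>y\<bar>" for x y :: real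
    using norm_triangle_ineq[of "of_real (x\<^sup>2 / 2)" "\<i> * complex_of_real y"] by (simp add: norm_mult norm_divide norm_power)
  have "cmod (gd n) \<le> cmod (of_real (lam\<^sup>2 / 2) + \<i> * of_real zp) * om (Suc n) + cmod (of_real (mu\<^sup>2 / 2) + \<i> * of_real zm) * om n"
    unfolding gdiag_def norm_minus_cancel
    using norm_triangle_ineq[of "(of_real (lam\<^sup>2 / 2) + \<i> * of_real zp) * complex_of_real (om (Suc n))" "(of_real (mu\<^sup>2 / 2) + \<i> * of_real zm) * complex_of_real (om n)"]
    unfolding norm_mult norm_of_real abs_of_nonneg[OF om_nonneg] .
  also have "\<dots> \<le> (lam\<^sup>2 / 2 + \<bar>zp\<bar>) * ?o + (mu\<^sup>2 / 2 + \<bar>zm\<bar>) * ?o"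
    by (intro add_mono mult_mono a o) auto
  finally show ?thesis by (simp add: distrib_right)
qed

definition R0 :: real where
  "R0 = 2 * ((lam\<^sup>2 / 2 + \<bar>zp\<bar> + (mu\<^sup>2 / 2 + \<bar>zm\<bar>)) * (1 + r)) + (mu\<^sup>2 + lam\<^sup>2) * (1 + r)"

text \<open>Only polynomial growth in each index matters here, since the weights \<open>c\<close>
  make any such bound square-summable.\<close>

lemma generator_growth:
  assumes X: "\<And>i j. cmod (X i j) \<le> K"
  shows "cmod (drift n m * X n m + jump X n m) \<le> K * (R0 * ((real n + 1)\<^sup>2 * (real m + 1)\<^sup>2))"
proof -
  let ?a = "(real n + 1)\<^sup>2" and ?b = "(real m + 1)\<^sup>2"
  let ?G = "(lam\<^sup>2 / 2 + \<bar>zp\<bar> + (mu\<^sup>2 / 2 + \<bar>zm\<bar>)) * (1 + r)"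
  have K: "0 \<le> K" using X norm_ge_zero order_trans by blast
  have G: "0 \<le> ?G" using r by (intro mult_nonneg_nonneg add_nonneg_nonneg) auto
  have ab: "1 \<le> ?a" "1 \<le> ?b" by (simp_all add: one_le_power)
  have "cmod (drift n m) \<le> cmod (gd n) + cmod (gd m)"
    unfolding drift_def using norm_triangle_ineq[of "cnj (gd n)" "gd m"] by simp
  also have "\<dots> \<le> ?G * ?a + ?G * ?b" using gd_bound[of n] gd_bound[of m] by (simp add: mult.assoc)
  also have "\<dots> \<le> ?G * (?a * ?b) + ?G * (?a * ?b)"
    using mult_left_mono[OF ab(2), of ?a] mult_right_mono[OF ab(1), of ?b]
    by (intro add_mono mult_left_mono G) auto
  finally have g: "cmod (drift n m) \<le> 2 * ?G * (?a * ?b)" by (simp only: mult_2 distrib_right)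
  have s: "sqrt (om i * om j) \<le> (1 + r) * (?a * ?b)" if "i \<le> Suc n" "j \<le> Suc m" for i j
  proof -
    have "om i * om j \<le> ((1 + r) * ?a) * ((1 + r) * ?b)"
      using r order_trans[OF om_mono[OF that(1)] om_Suc_le] order_trans[OF om_mono[OF that(2)] om_Suc_le]
      by (intro mult_mono) auto
    also have "\<dots> = (1 + r)\<^sup>2 * (?a * ?b)" by (simp add: power2_eq_square)
    also have "\<dots> \<le> (1 + r)\<^sup>2 * ((?a * ?b) * (?a * ?b))"
    proof (rule mult_left_mono)
      have "1 * 1 \<le> ?a * ?b" by (rule mult_mono[OF ab]) auto
      then show "?a * ?b \<le> (?a * ?b) * (?a * ?b)"
        using mult_left_mono[of 1 "?a * ?b" "?a * ?b"] by simp
    qed simp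
    also have "\<dots> = ((1 + r) * (?a * ?b))\<^sup>2" by (simp add: power2_eq_square)
    finally show ?thesis using r by (intro real_le_lsqrt) auto
  qed
  have "cmod (drift n m * X n m + jump X n m) \<le> cmod (drift n m * X n m) +
      (cmod (of_real (mu\<^sup>2 * sqrt (om n * om m)) * X (n - 1) (m - 1)) +
       cmod (of_real (lam\<^sup>2 * sqrt (om (Suc n) * om (Suc m))) * X (Suc n) (Suc m)))"
    unfolding jump_def by (rule order_trans[OF norm_triangle_ineq add_left_mono[OF norm_triangle_ineq]])
  also have "\<dots> \<le> 2 * ?G * (?a * ?b) * K + (mu\<^sup>2 * ((1 + r) * (?a * ?b)) * K + lam\<^sup>2 * ((1 + r) * (?a * ?b)) * K)"
  proof (intro add_mono)
    show "cmod (drift n m * X n m) \<le> 2 * ?G * (?a * ?b) * K"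
      unfolding norm_mult by (intro mult_mono g X) (use G in auto)
    show "cmod (of_real (mu\<^sup>2 * sqrt (om n * om m)) * X (n - 1) (m - 1)) \<le> mu\<^sup>2 * ((1 + r) * (?a * ?b)) * K"
      unfolding norm_mult norm_of_real abs_mult using s[of n m] r
      by (intro mult_mono X) (auto simp: abs_of_nonneg)
    show "cmod (of_real (lam\<^sup>2 * sqrt (om (Suc n) * om (Suc m))) * X (Suc n) (Suc m)) \<le> lam\<^sup>2 * ((1 + r) * (?a * ?b)) * K"
      unfolding norm_mult norm_of_real abs_mult using s[of "Suc n" "Suc m"] r
      by (intro mult_mono X) (auto simp: abs_of_nonneg)
  qed
  also have "\<dots> = K * (R0 * (?a * ?b))" unfolding R0_def by (simp add: algebra_simps)
  finally show ?thesis .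
qed

text \<open>The majorant for the difference quotients: quadratic growth in each index against
  geometric weights.\<close>

definition dmaj :: "real \<Rightarrow> mat" where
  "dmaj a n m = of_real (a * ((c n * (real n + 1)\<^sup>2) * (c m * (real m + 1)\<^sup>2)))"

lemma hs_dmaj: "hs (dmaj a)"
  unfolding hs_iff
proof (intro exI allI)
  fix N
  let ?f = "\<lambda>n. (real n + 1) ^ 4 * nu ^ n"
  have c4: "(c n * (real n + 1)\<^sup>2)\<^sup>2 \<le> ?f n" for n
  proof -
    have "(c n * (real n + 1)\<^sup>2)\<^sup>2 = w n * (real n + 1) ^ 4"
      unfolding c_sq[symmetric] by (simp add: power_mult_distrib power2_eq_square[of "c n"] power_mult[symmetric])
    also have "\<dots> \<le> nu ^ n * (real n + 1) ^ 4" by (intro mult_right_mono w_le) auto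
    finally show ?thesis by (simp add: mult.commute)
  qed
  have f: "summable ?f" by (rule polynomial_geometric_summable[OF nu])
  have fs: "(\<Sum>n<N. (c n * (real n + 1)\<^sup>2)\<^sup>2) \<le> suminf ?f"
    by (rule order_trans[OF sum_mono[OF c4] sum_le_suminf[OF f]]) (use nu in auto)
  have "box_sq N (dmaj a) = a\<^sup>2 * ((\<Sum>n<N. (c n * (real n + 1)\<^sup>2)\<^sup>2) * (\<Sum>n<N. (c n * (real n + 1)\<^sup>2)\<^sup>2))"
    unfolding box_sq_def dmaj_def norm_of_real power2_abs power_mult_distrib[of a] power_mult_distrib[of "c _ * _"]
    by (simp only: sum_distrib_left[symmetric] sum_product)
  also have "\<dots> \<le> a\<^sup>2 * (suminf ?f * suminf ?f)"
    using order_trans[OF sum_nonneg fs] by (intro mult_left_mono mult_mono fs sum_nonneg) auto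
  finally show "box_sq N (dmaj a) \<le> a\<^sup>2 * (suminf ?f * suminf ?f)" .
qed

lemma supported_gen_mat: "supported N X \<Longrightarrow> supported (Suc N) (gen_mat X)"
  unfolding supported_def
proof (intro allI impI)
  fix i j assume X: "\<forall>i j. \<not> (i < N \<and> j < N) \<longrightarrow> X i j = 0" and ij: "\<not> (i < Suc N \<and> j < Suc N)"
  have "X i j = 0" "X (i - 1) (j - 1) = 0" "X (Suc i) (Suc j) = 0"
    by (rule X[rule_format], use ij in linarith)+
  then show "gen_mat X i j = 0" by (simp add: gen_mat_def)
qed

text \<open>The difference quotient is the time average of \<open>gen_mat\<close> along the orbit,
  so quotient and candidate limit obey the same bound, whence the factor 2 in the majorant. Entries
  converge by differentiability, and dominated convergence yields the limit in norm.\<close>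

lemma gen_supported:
  assumes X: "supported N X" shows "gen_rel T X (gen_mat X)"
  unfolding gen_rel_def
proof
  show "hs (gen_mat X)" by (rule supported_hs[OF supported_gen_mat[OF X]])
  obtain x where x: "X = iota lam mu x" "bounded_mat x" using supported_iota[OF X] .
  obtain K where K: "evol K (\<lambda>t. iota lam mu (S t x))" "\<And>t n m. 0 \<le> t \<Longrightarrow> cmod (S t x n m) \<le> K"
    using S_evol[OF x(2)] by blast
  let ?z = "\<lambda>t. iota lam mu (S t x)"
  have z0: "?z 0 = X" using S_0[OF x(2)] x(1) by simp
  have T: "T t X = ?z t" if "0 \<le> t" for t unfolding x(1) by (rule T_iota[OF that x(2)])
  let ?B = "\<lambda>n m. (K * R0) * ((c n * (real n + 1)\<^sup>2) * (c m * (real m + 1)\<^sup>2))"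
  have LLb: "cmod (gen_mat (?z s) n m) \<le> ?B n m" if "0 \<le> s" for s n m
  proof -
    have "cmod (gen_mat (?z s) n m) = c n * cmod (drift n m * S s x n m + jump (S s x) n m) * c m"
      unfolding iota_gen_mat[symmetric] norm_mult norm_of_real using c_pos[of n] c_pos[of m] by simp
    also have "\<dots> \<le> c n * (K * (R0 * ((real n + 1)\<^sup>2 * (real m + 1)\<^sup>2))) * c m"
      using c_pos[of n] c_pos[of m] by (intro mult_right_mono mult_left_mono generator_growth K(2) that) auto
    also have "\<dots> = ?B n m" by simp
    finally show ?thesis .
  qed
  show "((\<lambda>t. hs_norm (\<lambda>i j. quot X t i j - gen_mat X i j)) \<longlongrightarrow> 0) (at_right 0)"
  proof (rule hs_dominated_convergence[OF hs_dmaj[of "2 * (K * R0)"]])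
    show "\<forall>\<^sub>F t in at_right 0. \<forall>n m. cmod (quot X t n m - gen_mat X n m) \<le> cmod (dmaj (2 * (K * R0)) n m)"
      using eventually_at_right_less[of "0::real"]
    proof (eventually_elim, intro allI)
      fix t :: real and n m assume t: "0 < t"
      have B0: "0 \<le> ?B n m" using LLb[of 0 n m] norm_ge_zero order_trans by blast
      have "((\<lambda>s. gen_mat (?z s) n m) has_integral (?z t n m - ?z 0 n m)) {0..t}"
        by (rule fundamental_theorem_of_calculus)
          (use t in \<open>auto intro!: has_vector_derivative_within_subset[OF evolD(1)[OF K(1)]]\<close>)
      from has_integral_bound_real[OF B0 _ this, of "{}"] LLb
      have "cmod (?z t n m - ?z 0 n m) \<le> ?B n m * t" using t by auto
      then have "cmod (quot X t n m) \<le> ?B n m"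
        using t T[of t] z0 by (simp add: norm_divide pos_divide_le_eq)
      moreover have "cmod (gen_mat X n m) \<le> ?B n m" using LLb[of 0 n m] z0 by simp
      ultimately have "cmod (quot X t n m - gen_mat X n m) \<le> 2 * ?B n m"
        using norm_triangle_ineq4[of "quot X t n m" "gen_mat X n m"] by linarith
      also have "\<dots> = cmod (dmaj (2 * (K * R0)) n m)"
        unfolding dmaj_def norm_of_real using B0 by (simp add: mult.assoc)
      finally show "cmod (quot X t n m - gen_mat X n m) \<le> cmod (dmaj (2 * (K * R0)) n m)" .
    qed
    fix n m
    have "((\<lambda>t. ?z t n m) has_vector_derivative gen_mat X n m) (at 0 within {0<..})"
    proof (rule has_vector_derivative_within_subset)
      show "((\<lambda>t. ?z t n m) has_vector_derivative gen_mat X n m) (at 0 within {0..})"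
        using evolD(1)[OF K(1) order_refl, of n m] unfolding z0 .
    qed auto
    then have l: "((\<lambda>t. (1 / norm (t - 0)) *\<^sub>R (?z t n m - (?z 0 n m + (t - 0) *\<^sub>R gen_mat X n m))) \<longlongrightarrow> 0) (at_right 0)"
      unfolding has_vector_derivative_def has_derivative_within by blast
    have "\<forall>\<^sub>F t in at_right 0. (1 / norm (t - 0)) *\<^sub>R (?z t n m - (?z 0 n m + (t - 0) *\<^sub>R gen_mat X n m)) = quot X t n m - gen_mat X n m"
      using eventually_at_right_less[of "0::real"]
    proof eventually_elim
      case (elim t)
      then show ?case unfolding z0 T[OF less_imp_le[OF elim]]
        by (simp add: scaleR_conv_of_real field_simps)
    qed
    with l show "((\<lambda>t. quot X t n m - gen_mat X n m) \<longlongrightarrow> 0) (at_right 0)"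
      by (rule Lim_transform_eventually)
  qed
qed

end

section \<open>The spectral gap\<close>

context qparam begin

text \<open>Solves the two-term recursion for equality in the arithmetic-geometric inequality on
  every bond of the first superdiagonal; the ratio of consecutive terms is
  \<open>nu * sqrt ((n + 2) (n + r) / ((n + 1) (n + 1 + r)))\<close>.\<close>

definition ground :: "nat \<Rightarrow> real" where
  "ground n = nu ^ n * sqrt ((real n + 1) / (real n + r))"

lemma ground_eigen:
  "al n (Suc n) * ground n = lam * mu * sqrt (om (Suc n) * om (Suc (Suc n))) * ground (Suc n)"
  "be (Suc n) (Suc (Suc n)) * ground (Suc n) = lam * mu * sqrt (om (Suc n) * om (Suc (Suc n))) * ground n"
proof -
  define a b a' b' where "a = sqrt (real n + 1)" and "b = sqrt (real n + r)"
    and "a' = sqrt (real n + 2)" and "b' = sqrt (real n + 1 + r)"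
  have pos: "0 < a" "0 < b" "0 < a'" "0 < b'" using r by (auto simp: a_def b_def a'_def b'_def)
  have sq: "real n + 1 = a * a" "real n + r = b * b" "real n + 2 = a' * a'" "real n + 1 + r = b' * b'"
    using r by (auto simp: a_def b_def a'_def b'_def)
  have o: "sqrt (om (Suc n) * om (Suc (Suc n))) = a * b * (a' * b')"
  proof -
    have "om (Suc n) * om (Suc (Suc n)) = (a * b * (a' * b'))\<^sup>2"
      unfolding om_Suc using sq by (simp add: power2_eq_square add_ac)
    then show ?thesis using pos by simp
  qed
  have h: "ground n = nu ^ n * (a / b)" "ground (Suc n) = nu * nu ^ n * (a' / b')"
    unfolding ground_def a_def b_def a'_def b'_def by (simp_all add: real_sqrt_divide add_ac)
  have m1: "al n (Suc n) = lam\<^sup>2 * (a' * a' * (b * b))"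
    unfolding al_def sq(2,3)[symmetric] by (simp add: max_def min_def)
  have m2: "be (Suc n) (Suc (Suc n)) = mu\<^sup>2 * (a * a * (b' * b'))"
    unfolding be_def sq(1,4)[symmetric] by (simp add: max_def min_def add_ac)
  have l: "lam * mu * nu = lam\<^sup>2" "mu\<^sup>2 * nu = lam * mu" using mu by (simp_all add: power2_eq_square)
  have "lam * mu * (a * b * (a' * b')) * ground (Suc n) = (lam * mu * nu) * (nu ^ n * (a' * a' * (a * b)))"
    unfolding h using pos by simp
  then show "al n (Suc n) * ground n = lam * mu * sqrt (om (Suc n) * om (Suc (Suc n))) * ground (Suc n)"
    unfolding o m1 h(1) l using pos by simp
  have "be (Suc n) (Suc (Suc n)) * ground (Suc n) = (mu\<^sup>2 * nu) * (nu ^ n * (a * a * (a' * b')))"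
    unfolding m2 h using pos by simp
  then show "be (Suc n) (Suc (Suc n)) * ground (Suc n) = lam * mu * sqrt (om (Suc n) * om (Suc (Suc n))) * ground n"
    unfolding o h(1) l using pos by simp
qed

text \<open>For \<open>d = 1\<close> the excess estimate is an equality, so nothing is lost on the
  first superdiagonal.\<close>

lemma Re_drift_superdiag: "Re (drift n (Suc n)) = - (al n (Suc n) + be n (Suc n) + kap)"
  unfolding Re_drift al_def be_def kap_eq om_Suc
  by (simp add: omega_def max_def min_def field_simps)

definition test_vec :: "real \<Rightarrow> nat \<Rightarrow> mat" where
  "test_vec s M n m = (if m = Suc n \<and> n \<le> M then of_real (s * ground n) else 0)"

lemma supported_test_vec: "supported (Suc (Suc M)) (test_vec s M)"
  unfolding supported_def test_vec_def by auto

lemma superdiag_sum: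
  assumes "\<And>n m. m \<noteq> Suc n \<or> M < n \<Longrightarrow> f n m = (0::'a::comm_monoid_add)"
  shows "(\<Sum>n<Suc (Suc M). \<Sum>m<Suc (Suc M). f n m) = (\<Sum>n\<le>M. f n (Suc n))"
proof -
  have "(\<Sum>n<Suc (Suc M). \<Sum>m<Suc (Suc M). f n m) = (\<Sum>n<Suc M. \<Sum>m<Suc (Suc M). f n m) + (\<Sum>m<Suc (Suc M). f (Suc M) m)"
    by simp
  also have "(\<Sum>m<Suc (Suc M). f (Suc M) m) = 0" by (intro sum.neutral) (auto intro!: assms)
  also have "(\<Sum>n<Suc M. \<Sum>m<Suc (Suc M). f n m) = (\<Sum>n<Suc M. f n (Suc n))"
  proof (intro sum.cong refl)
    fix n assume "n \<in> {..<Suc M}"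
    then have "(\<Sum>m<Suc (Suc M). f n m) = (\<Sum>m\<in>{Suc n}. f n m)"
      by (intro sum.mono_neutral_right) (auto intro!: assms)
    then show "(\<Sum>m<Suc (Suc M). f n m) = f n (Suc n)" by simp
  qed
  finally show ?thesis by (simp add: lessThan_Suc_atMost)
qed

lemma box_sq_test_vec: "box_sq (Suc (Suc M)) (test_vec s M) = s\<^sup>2 * (\<Sum>n\<le>M. (ground n)\<^sup>2)"
proof -
  have "box_sq (Suc (Suc M)) (test_vec s M) = (\<Sum>n\<le>M. (cmod (test_vec s M n (Suc n)))\<^sup>2)"
    unfolding box_sq_def by (rule superdiag_sum) (auto simp: test_vec_def)
  also have "\<dots> = s\<^sup>2 * (\<Sum>n\<le>M. (ground n)\<^sup>2)"
    unfolding sum_distrib_left by (intro sum.cong refl) (simp add: test_vec_def norm_mult power_mult_distrib)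
  finally show ?thesis .
qed

text \<open>Up to its last entry, the test vector is an eigenvector of the first superdiagonal block.\<close>
lemma Re_gen_mat_test_vec:
  assumes n: "n \<le> M"
  shows "Re (gen_mat (test_vec s M) n (Suc n)) = s * (- kap * ground n - (if n = M then al n (Suc n) * ground n else 0))"
proof -
  have e1: "lam * mu * (sqrt (om n * om (Suc n)) * Re (test_vec s M (n - 1) (Suc n - 1))) = s * (be n (Suc n) * ground n)"
  proof (cases n)
    case 0 then show ?thesis by (simp add: be_def)
  next
    case (Suc k)
    then have "test_vec s M (n - 1) (Suc n - 1) = of_real (s * ground k)" using n by (simp add: test_vec_def)
    then show ?thesis unfolding Suc ground_eigen(2) by simp
  qed
  have e2: "lam * mu * (sqrt (om (Suc n) * om (Suc (Suc n))) * Re (test_vec s M (Suc n) (Suc (Suc n)))) =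
      s * (if n = M then 0 else al n (Suc n) * ground n)"
    unfolding ground_eigen(1) using n by (simp add: test_vec_def)
  have g: "Re (drift n (Suc n) * test_vec s M n (Suc n)) = - (al n (Suc n) + be n (Suc n) + kap) * (s * ground n)"
    using n by (simp add: test_vec_def Re_drift_superdiag)
  have re: "Re (of_real a * (of_real b * z + of_real b' * z')) = a * (b * Re z) + a * (b' * Re z')" for a b b' z z'
    by (simp add: distrib_left)
  show ?thesis
    unfolding gen_mat_def plus_complex.simps g re e1 e2 by (simp add: algebra_simps)
qed

text \<open>Truncation cuts exactly one bond, the one leaving \<open>(M, M + 1)\<close>. Its
  \<open>al\<close> term is no longer compensated and is the whole excess over
  \<open>kap\<close>.\<close>

lemma energy_test_vec:
  "- Re (ipB (Suc (Suc M)) (test_vec s M) (gen_mat (test_vec s M))) = s\<^sup>2 * (kap * (\<Sum>n\<le>M. (ground n)\<^sup>2) + al M (Suc M) * (ground M)\<^sup>2)"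
proof -
  have "ipB (Suc (Suc M)) (test_vec s M) (gen_mat (test_vec s M)) = (\<Sum>n\<le>M. cnj (test_vec s M n (Suc n)) * gen_mat (test_vec s M) n (Suc n))"
    unfolding ipB_def by (rule superdiag_sum) (auto simp: test_vec_def)
  also have "\<dots> = (\<Sum>n\<le>M. of_real (s * ground n) * gen_mat (test_vec s M) n (Suc n))"
    by (intro sum.cong refl) (simp add: test_vec_def)
  finally have "- Re (ipB (Suc (Suc M)) (test_vec s M) (gen_mat (test_vec s M))) = - (\<Sum>n\<le>M. (s * ground n) * Re (gen_mat (test_vec s M) n (Suc n)))"
    by simp
  also have "\<dots> = (\<Sum>n\<le>M. s\<^sup>2 * (kap * (ground n)\<^sup>2) + (if n = M then s\<^sup>2 * (al M (Suc M) * (ground M)\<^sup>2) else 0))"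
    unfolding sum_negf[symmetric]
    by (intro sum.cong refl) (auto simp: Re_gen_mat_test_vec power2_eq_square algebra_simps)
  also have "\<dots> = s\<^sup>2 * (kap * (\<Sum>n\<le>M. (ground n)\<^sup>2)) + s\<^sup>2 * (al M (Suc M) * (ground M)\<^sup>2)"
    by (simp add: sum.distrib sum_distrib_left)
  finally show ?thesis by (simp add: distrib_left)
qed

lemma boundary_test_vec: "al M (Suc M) * (ground M)\<^sup>2 \<le> 2 * lam\<^sup>2 * ((real M + 1)\<^sup>2 * (nu\<^sup>2) ^ M)"
proof -
  have "(ground M)\<^sup>2 = (nu\<^sup>2) ^ M * ((real M + 1) / (real M + r))"
    unfolding ground_def power_mult_distrib using r by (simp add: power_mult[symmetric] mult.commute)
  then have "al M (Suc M) * (ground M)\<^sup>2 = lam\<^sup>2 * ((real M + 2) * (real M + 1) * (nu\<^sup>2) ^ M)"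
  proof -
    have "al M (Suc M) = lam\<^sup>2 * ((real M + 2) * (real M + r))"
      unfolding al_def by (simp add: max_def min_def)
    moreover have "(real M + r) * ((real M + 1) / (real M + r)) = real M + 1" using r by simp
    moreover have "(L * (x * y)) * (q * z) = L * (x * (y * z) * q)" for L x y q z :: real by simp
    moreover have "real M + r \<noteq> 0" using r by linarith
    ultimately show ?thesis using \<open>(ground M)\<^sup>2 = _\<close> by simp
  qed
  also have "\<dots> \<le> lam\<^sup>2 * ((2 * (real M + 1)) * (real M + 1) * (nu\<^sup>2) ^ M)"
    using nu2 by (intro mult_left_mono mult_right_mono) auto
  also have "\<dots> = 2 * lam\<^sup>2 * ((real M + 1)\<^sup>2 * (nu\<^sup>2) ^ M)"
  proof -
    have "L * ((2 * x) * x * q) = 2 * L * (x\<^sup>2 * q)" for L x q :: real by (simp add: power2_eq_square)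
    then show ?thesis .
  qed
  finally show ?thesis .
qed

end

context qfull begin

lemma state_part_cs: "(cmod (state_part N X))\<^sup>2 \<le> (\<Sum>n<N. (cmod (X n n))\<^sup>2)"
proof -
  have "cmod (state_part N X) = cmod (\<Sum>n<N. cnj (of_real (w n)) * X n n)" by (simp add: state_part_def)
  also have "\<dots> \<le> nrm N (\<lambda>n. of_real (w n)) * nrm N (\<lambda>n. X n n)" by (rule sum_cs)
  also have "\<dots> \<le> 1 * nrm N (\<lambda>n. X n n)"
    using sum_w_sq_le[of N] by (intro mult_right_mono) (auto simp: L2_set_def intro!: sum_nonneg)
  finally have "(cmod (state_part N X))\<^sup>2 \<le> (nrm N (\<lambda>n. X n n))\<^sup>2" by (intro power_mono) auto
  then show ?thesis by (simp add: nrm_sq)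
qed

text \<open>Dissipation with zero right-hand side bounds the full norm by the component along
  \<open>root_rho\<close>. By Cauchy-Schwarz that component is already bounded by the norm of the
  main diagonal, so no room is left for other entries.\<close>

lemma kernel_diagonal:
  assumes Z: "gen_dom T Z" "gen T Z = (\<lambda>i j. 0)" and ij: "i \<noteq> j"
  shows "Z i j = 0"
proof -
  obtain Y where h: "hs Z" and Y: "gen_rel T Z Y" using Z(1) by (auto simp: gen_dom_def)
  have "gen_rel T Z (\<lambda>i j. 0)" using Y gen_eq[OF h Y] Z(2) by simp
  from dissipation[OF h this] have "0 \<le> - kap * ((hs_norm Z)\<^sup>2 - (cmod (hs_ip root_rho Z))\<^sup>2)"
    by (simp add: hs_ip_def case_prod_unfold)
  then have le: "(hs_norm Z)\<^sup>2 \<le> (cmod (hs_ip root_rho Z))\<^sup>2"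
    using kap_pos by (simp add: mult_le_0_iff zero_le_mult_iff)
  have "(cmod (hs_ip root_rho Z))\<^sup>2 + (cmod (Z i j))\<^sup>2 \<le> (hs_norm Z)\<^sup>2"
  proof (rule LIMSEQ_le)
    show "(\<lambda>N. (cmod (state_part N Z))\<^sup>2 + (cmod (Z i j))\<^sup>2) \<longlonglongrightarrow> (cmod (hs_ip root_rho Z))\<^sup>2 + (cmod (Z i j))\<^sup>2"
      by (intro tendsto_add tendsto_const tendsto_power tendsto_norm state_part_tendsto h)
    show "(\<lambda>N. box_sq N Z) \<longlonglongrightarrow> (hs_norm Z)\<^sup>2" by (rule box_sq_tendsto[OF h])
    show "\<exists>N0. \<forall>N\<ge>N0. (cmod (state_part N Z))\<^sup>2 + (cmod (Z i j))\<^sup>2 \<le> box_sq N Z"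
    proof (intro exI allI impI)
      fix N assume N: "Suc (max i j) \<le> N"
      let ?x = "\<lambda>p. (cmod (case p of (n, m) \<Rightarrow> Z n m))\<^sup>2"
      have "(\<Sum>n<N. (cmod (Z n n))\<^sup>2) + (cmod (Z i j))\<^sup>2 = sum ?x ((\<lambda>n. (n, n)) ` {..<N}) + sum ?x {(i, j)}"
        by (subst sum.reindex) (auto simp: inj_on_def)
      also have "\<dots> = sum ?x ((\<lambda>n. (n, n)) ` {..<N} \<union> {(i, j)})"
        using ij by (intro sum.union_disjoint[symmetric]) auto
      also have "\<dots> \<le> sum ?x ({..<N} \<times> {..<N})" using N by (intro sum_mono2) auto
      also have "\<dots> = box_sq N Z" unfolding box_sq_eq by (simp add: case_prod_unfold)
      finally show "(cmod (state_part N Z))\<^sup>2 + (cmod (Z i j))\<^sup>2 \<le> box_sq N Z" using state_part_cs[of N Z] by linarith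
    qed
  qed
  with le have "(cmod (Z i j))\<^sup>2 \<le> 0" by linarith
  then show ?thesis by simp
qed

lemma spectral_gap_eq: "spectral_gap T = kap"
proof -
  define A where "A = {- Re (hs_ip X (gen T X)) | X. gen_dom T X \<and> hs_norm X = 1 \<and>
      (\<forall>Z. gen_dom T Z \<and> gen T Z = (\<lambda>i j. 0) \<longrightarrow> hs_ip Z X = 0)}"
  have lower: "kap \<le> a" if aA: "a \<in> A" for a
  proof -
    obtain X where a: "a = - Re (hs_ip X (gen T X))" and X: "gen_dom T X" "hs_norm X = 1"
      and orth: "\<forall>Z. gen_dom T Z \<and> gen T Z = (\<lambda>i j. 0) \<longrightarrow> hs_ip Z X = 0"
      using aA unfolding A_def by blast
    obtain Y where h: "hs X" and Y: "gen_rel T X Y" using X(1) by (auto simp: gen_dom_def)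
    have "hs_ip root_rho X = 0"
      using orth gen_root_rho hs_root_rho gen_eq[OF hs_root_rho gen_root_rho] unfolding gen_dom_def by blast
    then show ?thesis using dissipation[OF h Y] X(2) unfolding a gen_eq[OF h Y] by simp
  qed
  \<comment> \<open>The excess of the normalised test vector. The factor \<open>r\<close> bounds
    \<open>s^2\<close> for every \<open>M\<close>, since \<open>\<sigma>\<close> contains the term
    \<open>(ground 0)^2 = 1 / r\<close>.\<close>
  define e where "e M = 2 * lam\<^sup>2 * r * ((real M + 1)\<^sup>2 * (nu\<^sup>2) ^ M)" for M
  have upper: "\<exists>a\<in>A. a \<le> kap + e M" for M
  proof -
    define \<sigma> where "\<sigma> = (\<Sum>n\<le>M. (ground n)\<^sup>2)"
    have h0: "(ground 0)\<^sup>2 = 1 / r" using r by (simp add: ground_def)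
    have "(ground 0)\<^sup>2 \<le> \<sigma>" unfolding \<sigma>_def by (rule member_le_sum) auto
    then have \<sigma>: "1 / r \<le> \<sigma>" unfolding h0 .
    then have \<sigma>0: "0 < \<sigma>" using r by (meson less_le_trans zero_less_divide_1_iff)
    define s where "s = 1 / sqrt \<sigma>"
    have s: "s\<^sup>2 * \<sigma> = 1" "s\<^sup>2 \<le> r"
    proof -
      have s2: "s\<^sup>2 = 1 / \<sigma>" using \<sigma>0 by (simp add: s_def power_divide)
      then show "s\<^sup>2 * \<sigma> = 1" using \<sigma>0 by simp
      have "1 \<le> r * \<sigma>" using \<sigma> r by (simp add: pos_divide_le_eq mult.commute)
      then show "s\<^sup>2 \<le> r" unfolding s2 using \<sigma>0 by (simp add: pos_divide_le_eq)
    qed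
    let ?X = "test_vec s M"
    have hX: "hs ?X" by (rule supported_hs[OF supported_test_vec])
    have gX: "gen_rel T ?X (gen_mat ?X)" by (rule gen_supported[OF supported_test_vec])
    have "(hs_norm ?X)\<^sup>2 = 1"
      unfolding supported_hs_norm[OF supported_test_vec] box_sq_test_vec using s by (simp add: \<sigma>_def)
    then have n1: "hs_norm ?X = 1" using hs_norm_nonneg[of ?X] by (simp add: power2_eq_1_iff)
    \<comment> \<open>The supports are disjoint: kernel elements live on the main diagonal, the test
      vector on the first superdiagonal.\<close>
    have orth: "hs_ip Z ?X = 0" if "gen_dom T Z" "gen T Z = (\<lambda>i j. 0)" for Z
    proof -
      have "cnj (Z i j) * ?X i j = 0" for i j
        using kernel_diagonal[OF that, of i j] by (auto simp: test_vec_def)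
      then show ?thesis unfolding hs_ip_def by (simp only: case_prod_unfold infsum_0)
    qed
    have "gen_dom T ?X" unfolding gen_dom_def using hX gX by blast
    then have "- Re (hs_ip ?X (gen T ?X)) \<in> A" unfolding A_def using n1 orth by blast
    moreover have "- Re (hs_ip ?X (gen T ?X)) \<le> kap + e M"
    proof -
      have "- Re (hs_ip ?X (gen T ?X)) = s\<^sup>2 * (kap * \<sigma> + al M (Suc M) * (ground M)\<^sup>2)"
      proof -
        have "hs_ip ?X (gen_mat ?X) = ipB (Suc (Suc M)) ?X (gen_mat ?X)"
          by (rule supported_hs_ip[OF supported_test_vec supported_hs[OF supported_gen_mat[OF supported_test_vec]]])
        then show ?thesis unfolding gen_eq[OF hX gX] \<sigma>_def by (simp only: energy_test_vec)
      qed
      also have "\<dots> = kap * (s\<^sup>2 * \<sigma>) + s\<^sup>2 * (al M (Suc M) * (ground M)\<^sup>2)" by (simp add: algebra_simps)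
      also have "\<dots> \<le> kap + r * (2 * lam\<^sup>2 * ((real M + 1)\<^sup>2 * (nu\<^sup>2) ^ M))"
        unfolding s(1) using s(2) al_nonneg[of M "Suc M"] r
        by (intro add_mono mult_mono boundary_test_vec) (auto intro: mult_nonneg_nonneg)
      finally show ?thesis by (simp add: e_def mult_ac)
    qed
    ultimately show ?thesis by blast
  qed
  have bdd: "bdd_below A" using lower by (rule bdd_belowI)
  have "Inf A \<le> kap + e M" for M
  proof -
    obtain a where "a \<in> A" "a \<le> kap + e M" using upper by blast
    then show ?thesis using cInf_lower[OF _ bdd] order_trans by blast
  qed
  moreover have "(\<lambda>M. kap + e M) \<longlonglongrightarrow> kap + 2 * lam\<^sup>2 * r * 0"
    unfolding e_def by (intro tendsto_add tendsto_mult tendsto_const polynomial_geometric_tendsto_0 nu2)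
  ultimately have "Inf A \<le> kap" using LIMSEQ_le_const[of "\<lambda>M. kap + e M" "kap" "Inf A"] by simp
  \<comment> \<open>\<open>upper[of 0]\<close> is used here for the nonemptiness of
    \<open>A\<close>.\<close>
  moreover have "kap \<le> Inf A"
    by (rule cInf_greatest) (use upper[of 0] lower in auto)
  ultimately show ?thesis unfolding spectral_gap_def A_def by simp
qed

end

theorem theorem6p11:
  fixes r lam mu zp zm :: real
    and S :: "real \<Rightarrow> mat \<Rightarrow> mat" and T :: "real \<Rightarrow> mat \<Rightarrow> mat"
  assumes "0 < lam" and "lam < mu" and "0 < r"
    and "minimal_qds r lam mu zp zm S"
    and "hs_semigroup_of lam mu S T"
  shows "((2 * (lam/mu)^2 + r * (1 - (lam/mu)^2)) * lerch_phi ((lam/mu)^2) r \<le> 2 \<longrightarrow>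
            spectral_gap T = mu^2 / 2 * (2 * (lam/mu)^2 + r * (1 - (lam/mu)^2)))
       \<and> (r \<ge> 2 * (lam/mu)^2 / (1 - (lam/mu)^2) \<longrightarrow>
            spectral_gap T = mu^2 / 2 * (2 * (lam/mu)^2 + r * (1 - (lam/mu)^2)))"
proof -
  interpret qparam r lam mu zp zm by unfold_locales (use assms in auto)
  let ?A = "2 * nu\<^sup>2 + r * (1 - nu\<^sup>2)" and ?\<Phi> = "lerch_phi (nu\<^sup>2) r"
  have main: "spectral_gap T = mu\<^sup>2 / 2 * ?A" if "?A * ?\<Phi> \<le> 2"
  proof -
    have "kap * ?\<Phi> \<le> mu\<^sup>2"
      using mult_left_mono[OF that, of "mu\<^sup>2 / 2"] unfolding kap_def by (simp add: mult.assoc)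
    then interpret qfull r lam mu zp zm S T
      by unfold_locales (use assms in auto)
    show ?thesis using spectral_gap_eq unfolding kap_def .
  qed
  moreover have "?A * ?\<Phi> \<le> 2" if "2 * nu\<^sup>2 / (1 - nu\<^sup>2) \<le> r"
  proof -
    note lp = lerch_phi_props[OF nu2 r]
    \<comment> \<open>The assumption makes the first summand of \<open>?A\<close> at most the
      second. This doubles the second, and the elementary bound on the Lerch function shows that
      twice the second summand times \<open>?\<Phi>\<close> is at most 2.\<close>
    have "2 * nu\<^sup>2 \<le> r * (1 - nu\<^sup>2)" using that nu2 by (simp add: pos_divide_le_eq)
    then have "?A * ?\<Phi> \<le> (2 * (r * (1 - nu\<^sup>2))) * ?\<Phi>" using lp(1) by (intro mult_right_mono) auto
    also have "\<dots> = 2 * ((1 - nu\<^sup>2) * r * ?\<Phi>)" by simp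
    also have "\<dots> \<le> 2 * 1" using lp(4) by (intro mult_left_mono) auto
    finally show ?thesis by simp
  qed
  ultimately show ?thesis by blast
qed

end
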